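(* Let $A=(a_1,\ldots,a_n)$ and $B=(b_1,\ldots,b_n)$ be two sequences of points. Then the weak discrete Fréchet gap $d_{FG}^w(A,B)$ and the weak discrete Fréchet ratio $d_{FR}^w(A,B)$ (with simultaneous jumps not allowed) can be computed in $O(n^2\log^2 n)$ time.
   Context: Points lie in a Euclidean space of fixed dimension, and $d(a,b)$ denotes the Euclidean distance. The model of computation is the real RAM: arithmetic operations and comparisons on reals take unit time, and the distance between two given points is computed in constant time. Let $G'$ be the directed graph with vertex set $\{(a_i,b_j): 1\le i,j\le n\}$ (positions, indexed by the pairs $(i,j)$) whose edges are the pairs $((a_i,b_j),(a_{i+1},b_j))$ and $((a_i,b_j),(a_i,b_{j+1}))$ (whenever the indices are in $\{1,\ldots,n\}$), together with the reversals of all these edges. Let $f$ be a function from positions to $\{0,1\}$; a position is valid if $f$ equals $1$ on it. A position $(a_i,b_j)$ is w-reachable w.r.t. $f$ if there is a path in $G'$ from $(a_1,b_1)$ to $(a_i,b_j)$ consisting only of valid positions (endpoints included). For $0\le s\le t$, let $f_{[s,t]}(a_i,b_j)=1$ if $s\le d(a_i,b_j)\le t$ and $0$ otherwise. The range $[s,t]$ is a feasible weak range if $(a_n,b_n)$ is w-reachable w.r.t. $f_{[s,t]}$. The weak discrete Fréchet gap $d_{FG}^w(A,B)$ is the smallest value of $t-s$ over all feasible weak ranges $[s,t]$. The weak discrete Fréchet ratio $d_{FR}^w(A,B)$ is the smallest value of $t/s$ over all feasible weak ranges $[s,t]$, where $t/0$ is interpreted as $+\infty$. *)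

theory Defs
  imports "HOL-Analysis.Analysis" "HOL-Library.Landau_Symbols"
begin

section \<open>Weak discrete Frechet gap and ratio\<close>

text \<open>
  Sequences are lists and indices start at 0: the point $a_i$ is \<open>A ! (i - 1)\<close>, and the position
  $(a_i,b_j)$ is the index pair \<open>(i - 1, j - 1)\<close>.
\<close>

definition positions :: "nat \<Rightarrow> (nat \<times> nat) set" where
  "positions n = {..<n} \<times> {..<n}"

definition forward_edges :: "nat \<Rightarrow> ((nat \<times> nat) \<times> (nat \<times> nat)) set" where
  "forward_edges n =
     {((i, j), (i + 1, j)) | i j. i + 1 < n \<and> j < n} \<union>
     {((i, j), (i, j + 1)) | i j. i < n \<and> j + 1 < n}"

definition weak_edges :: "nat \<Rightarrow> ((nat \<times> nat) \<times> (nat \<times> nat)) set" where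
  "weak_edges n = forward_edges n \<union> (forward_edges n)\<inverse>"

definition weak_path :: "nat \<Rightarrow> (nat \<times> nat) list \<Rightarrow> bool" where
  "weak_path n ps \<longleftrightarrow>
     ps \<noteq> [] \<and> set ps \<subseteq> positions n \<and> successively (\<lambda>p q. (p, q) \<in> weak_edges n) ps"

definition w_reachable :: "nat \<Rightarrow> (nat \<times> nat \<Rightarrow> bool) \<Rightarrow> nat \<times> nat \<Rightarrow> bool" where
  "w_reachable n f p \<longleftrightarrow>
     (\<exists>ps. weak_path n ps \<and> hd ps = (0, 0) \<and> last ps = p \<and> (\<forall>q\<in>set ps. f q))"

definition range_valid ::
  "'a::euclidean_space list \<Rightarrow> 'a list \<Rightarrow> real \<Rightarrow> real \<Rightarrow> nat \<times> nat \<Rightarrow> bool" where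
  "range_valid A B s t = (\<lambda>(i, j). s \<le> dist (A ! i) (B ! j) \<and> dist (A ! i) (B ! j) \<le> t)"

definition feasible_weak_range ::
  "'a::euclidean_space list \<Rightarrow> 'a list \<Rightarrow> real \<Rightarrow> real \<Rightarrow> bool" where
  "feasible_weak_range A B s t \<longleftrightarrow>
     0 \<le> s \<and> s \<le> t \<and>
     w_reachable (length A) (range_valid A B s t) (length A - 1, length A - 1)"

definition range_ratio :: "real \<Rightarrow> real \<Rightarrow> ereal" where
  "range_ratio s t = (if s = 0 then \<infinity> else ereal (t / s))"

text \<open>
  The two minima below exist for nonempty sequences of equal length; see
  \<open>weak_frechet_gap_attained\<close> and \<open>weak_frechet_ratio_attained\<close>.
\<close>

definition weak_frechet_gap :: "'a::euclidean_space list \<Rightarrow> 'a list \<Rightarrow> real" where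
  "weak_frechet_gap A B = (LEAST g. \<exists>s t. feasible_weak_range A B s t \<and> g = t - s)"

definition weak_frechet_ratio :: "'a::euclidean_space list \<Rightarrow> 'a list \<Rightarrow> ereal" where
  "weak_frechet_ratio A B = (LEAST r. \<exists>s t. feasible_weak_range A B s t \<and> r = range_ratio s t)"

lemma feasible_weak_range_exists:
  fixes A B :: "'a::euclidean_space list"
  assumes "A \<noteq> []" "length B = length A"
  shows "\<exists>s t. feasible_weak_range A B s t"
proof -
  define n where "n = length A"
  define D where "D = (\<lambda>(i, j). dist (A ! i) (B ! j)) ` positions n"
  have n: "n \<ge> 1" using assms by (cases A) (auto simp: n_def)
  have finD: "finite D" by (simp add: D_def positions_def)
  have "(0, 0) \<in> positions n" using n by (simp add: positions_def)
  then have neD: "D \<noteq> {}" unfolding D_def by blast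
  have path: "\<exists>ps. weak_path n ps \<and> hd ps = (0, 0) \<and> last ps = (i, j)"
    if "i < n" "j < n" for i j
    using that
  proof (induction "i + j" arbitrary: i j)
    case 0
    then have "weak_path n [(0, 0)]" by (simp add: weak_path_def positions_def)
    with 0 show ?case by (intro exI[of _ "[(0, 0)]"]) auto
  next
    case (Suc k)
    obtain i' j' where ij': "k = i' + j'" "i' < n" "j' < n" "((i', j'), (i, j)) \<in> weak_edges n"
    proof (cases i)
      case 0
      then have "k = i + (j - 1)" "i < n" "j - 1 < n" "((i, j - 1), (i, j)) \<in> weak_edges n"
        using Suc.hyps(2) Suc.prems by (auto simp: weak_edges_def forward_edges_def)
      then show ?thesis by (rule that)
    next
      case (Suc l)
      then have "k = l + j" "l < n" "j < n" "((l, j), (i, j)) \<in> weak_edges n"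
        using Suc.hyps(2) \<open>i < n\<close> \<open>j < n\<close> by (auto simp: weak_edges_def forward_edges_def)
      then show ?thesis by (rule that)
    qed
    obtain ps where ps: "weak_path n ps" "hd ps = (0, 0)" "last ps = (i', j')"
      using Suc.hyps(1)[OF ij'(1-3)] by blast
    then have "weak_path n (ps @ [(i, j)])"
      using Suc.prems ij' by (auto simp: weak_path_def positions_def successively_append_iff)
    with ps show ?case
      by (intro exI[of _ "ps @ [(i, j)]"]) (auto simp: weak_path_def)
  qed
  obtain ps where ps: "weak_path n ps" "hd ps = (0, 0)" "last ps = (n - 1, n - 1)"
    using path[of "n - 1" "n - 1"] n by auto
  have valid: "range_valid A B 0 (Max D) q" if "q \<in> set ps" for q
  proof -
    have "q \<in> positions n" using ps(1) that by (auto simp: weak_path_def)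
    then have "(\<lambda>(i, j). dist (A ! i) (B ! j)) q \<in> D" unfolding D_def by (rule imageI)
    then show ?thesis using Max_ge[OF finD] by (auto simp: range_valid_def split: prod.splits)
  qed
  have "Max D \<in> D" using finD neD by (rule Max_in)
  then have "0 \<le> Max D" by (auto simp: D_def)
  then have "feasible_weak_range A B 0 (Max D)"
    unfolding feasible_weak_range_def w_reachable_def using ps valid by (auto simp: n_def)
  then show ?thesis by blast
qed

lemma feasible_weak_range_shrink:
  assumes "feasible_weak_range A B s t"
  defines "D \<equiv> (\<lambda>(i, j). dist (A ! i) (B ! j)) ` positions (length A)"
  shows "\<exists>s'\<in>D. \<exists>t'\<in>D. s \<le> s' \<and> t' \<le> t \<and> feasible_weak_range A B s' t'"
proof -
  define h where "h = (\<lambda>(i, j). dist (A ! i) (B ! j))"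
  obtain ps where ps: "weak_path (length A) ps" "hd ps = (0, 0)"
      "last ps = (length A - 1, length A - 1)" "\<And>q. q \<in> set ps \<Longrightarrow> range_valid A B s t q"
    using assms(1) by (auto simp: feasible_weak_range_def w_reachable_def)
  have ne: "h ` set ps \<noteq> {}" and fin: "finite (h ` set ps)"
    using ps(1) by (auto simp: weak_path_def)
  have sub: "h ` set ps \<subseteq> D"
    using ps(1) by (auto simp: weak_path_def D_def h_def)
  have bnd: "s \<le> x \<and> x \<le> t" if "x \<in> h ` set ps" for x
    using that ps(4) by (auto simp: range_valid_def h_def split: prod.splits)
  define s' t' where "s' = Min (h ` set ps)" and "t' = Max (h ` set ps)"
  have in': "s' \<in> h ` set ps" "t' \<in> h ` set ps"
    unfolding s'_def t'_def using Min_in[OF fin ne] Max_in[OF fin ne] by auto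
  have "s' \<le> t'" using in'(1) fin by (simp add: t'_def)
  moreover have "range_valid A B s' t' q" if "q \<in> set ps" for q
  proof -
    have "s' \<le> h q" "h q \<le> t'" using that fin by (auto simp: s'_def t'_def)
    then show ?thesis by (auto simp: range_valid_def h_def split: prod.splits)
  qed
  moreover have "0 \<le> s'" using bnd[OF in'(1)] assms(1) by (simp add: feasible_weak_range_def)
  ultimately have "feasible_weak_range A B s' t'"
    unfolding feasible_weak_range_def w_reachable_def using ps by blast
  then show ?thesis using in' sub bnd by blast
qed

lemma least_over_feasible_weak_ranges:
  fixes A B :: "'a::euclidean_space list" and g :: "real \<Rightarrow> real \<Rightarrow> 'b::linorder"
  assumes "A \<noteq> []" "length B = length A"
    and mono: "\<And>s t s' t'. 0 \<le> s \<Longrightarrow> s \<le> s' \<Longrightarrow> s' \<le> t' \<Longrightarrow> t' \<le> t \<Longrightarrow> g s' t' \<le> g s t"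
  defines "m \<equiv> (LEAST x. \<exists>s t. feasible_weak_range A B s t \<and> x = g s t)"
  shows "\<exists>s t. feasible_weak_range A B s t \<and> m = g s t"
    and "feasible_weak_range A B s t \<Longrightarrow> m \<le> g s t"
proof -
  define D where "D = (\<lambda>(i, j). dist (A ! i) (B ! j)) ` positions (length A)"
  define W where "W = (\<lambda>(s, t). g s t) ` {(s, t) \<in> D \<times> D. feasible_weak_range A B s t}"
  have "finite (D \<times> D)" by (simp add: D_def positions_def)
  then have fin: "finite W"
    unfolding W_def by (intro finite_imageI) (rule finite_subset[of _ "D \<times> D"], auto)
  have below: "\<exists>x\<in>W. x \<le> g s t" if f: "feasible_weak_range A B s t" for s t
  proof -
    obtain s' t' where st': "s' \<in> D" "t' \<in> D" "s \<le> s'" "t' \<le> t" "feasible_weak_range A B s' t'"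
      using feasible_weak_range_shrink[OF f] unfolding D_def by blast
    then have "g s' t' \<in> W" unfolding W_def by force
    moreover have "g s' t' \<le> g s t"
      using f st' by (intro mono) (auto simp: feasible_weak_range_def)
    ultimately show ?thesis by blast
  qed
  have ne: "W \<noteq> {}" using feasible_weak_range_exists[OF assms(1,2)] below by blast
  have lb: "Min W \<le> g s t" if "feasible_weak_range A B s t" for s t
    using below[OF that] Min_le[OF fin] order_trans by blast
  have ex: "\<exists>s t. feasible_weak_range A B s t \<and> Min W = g s t"
    using Min_in[OF fin ne] unfolding W_def by auto
  have "m = Min W"
    unfolding m_def by (rule Least_equality) (use ex lb in auto)
  then show "\<exists>s t. feasible_weak_range A B s t \<and> m = g s t"
    and "feasible_weak_range A B s t \<Longrightarrow> m \<le> g s t"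
    using ex lb by auto
qed

lemma weak_frechet_gap_attained:
  assumes "A \<noteq> []" "length B = length A"
  shows "\<exists>s t. feasible_weak_range A B s t \<and> weak_frechet_gap A B = t - s"
    and "feasible_weak_range A B s t \<Longrightarrow> weak_frechet_gap A B \<le> t - s"
  unfolding weak_frechet_gap_def
  using least_over_feasible_weak_ranges[OF assms, of "\<lambda>s t. t - s"] by auto

lemma weak_frechet_ratio_attained:
  assumes "A \<noteq> []" "length B = length A"
  shows "\<exists>s t. feasible_weak_range A B s t \<and> weak_frechet_ratio A B = range_ratio s t"
    and "feasible_weak_range A B s t \<Longrightarrow> weak_frechet_ratio A B \<le> range_ratio s t"
proof -
  have "range_ratio s' t' \<le> range_ratio s t" if "0 \<le> s" "s \<le> s'" "s' \<le> t'" "t' \<le> t" for s t s' t'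
    using that by (auto simp: range_ratio_def intro!: frac_le)
  note * = least_over_feasible_weak_ranges[OF assms, of range_ratio, OF this]
  show "\<exists>s t. feasible_weak_range A B s t \<and> weak_frechet_ratio A B = range_ratio s t"
    and "feasible_weak_range A B s t \<Longrightarrow> weak_frechet_ratio A B \<le> range_ratio s t"
    unfolding weak_frechet_ratio_def using * by auto
qed


section \<open>Real RAM\<close>

text \<open>
  The machine is a structured real RAM. A program is a finite piece of syntax, so it addresses
  finitely many unbounded arrays of natural numbers and of reals, each by indirect addressing.
  Naturals serve as indices and counters; as in the classical random access machine the only
  operations on them are addition, truncated subtraction and comparison, because unit-cost
  multiplication of unbounded integers is too powerful. Reals admit the four field operations,
  comparison and rational constants. There is no conversion between the two sorts, and no
  rounding. The input points can be accessed only through the constant-time operation \<open>RDist\<close>,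
  which returns the distance between two input points given by their indices.
  Every node of the syntax tree that is evaluated costs one time unit.
\<close>

datatype nexp =
    NConst nat
  | NCell nat nexp
  | NAdd nexp nexp
  | NSub nexp nexp

datatype rexp =
    RConst rat
  | RCell nat nexp
  | RAdd rexp rexp
  | RSub rexp rexp
  | RMul rexp rexp
  | RDiv rexp rexp
  | RDist nexp nexp

datatype bexp =
    NLess nexp nexp
  | RLess rexp rexp
  | BNot bexp
  | BAnd bexp bexp

datatype com =
    Skip
  | NAssign nat nexp nexp
  | RAssign nat nexp rexp
  | Seq com com
  | Cond bexp com com
  | While bexp com

record ram_state =
  nat_mem :: "nat \<Rightarrow> nat \<Rightarrow> nat"
  real_mem :: "nat \<Rightarrow> nat \<Rightarrow> real"

primrec nval :: "ram_state \<Rightarrow> nexp \<Rightarrow> nat" where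
  "nval \<sigma> (NConst c) = c"
| "nval \<sigma> (NCell k i) = nat_mem \<sigma> k (nval \<sigma> i)"
| "nval \<sigma> (NAdd e e') = nval \<sigma> e + nval \<sigma> e'"
| "nval \<sigma> (NSub e e') = nval \<sigma> e - nval \<sigma> e'"

definition point_dist :: "'a::euclidean_space list \<Rightarrow> nat \<Rightarrow> nat \<Rightarrow> real" where
  "point_dist P p q = (if p < length P \<and> q < length P then dist (P ! p) (P ! q) else 0)"

primrec rval :: "'a::euclidean_space list \<Rightarrow> ram_state \<Rightarrow> rexp \<Rightarrow> real" where
  "rval P \<sigma> (RConst c) = of_rat c"
| "rval P \<sigma> (RCell k i) = real_mem \<sigma> k (nval \<sigma> i)"
| "rval P \<sigma> (RAdd e e') = rval P \<sigma> e + rval P \<sigma> e'"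
| "rval P \<sigma> (RSub e e') = rval P \<sigma> e - rval P \<sigma> e'"
| "rval P \<sigma> (RMul e e') = rval P \<sigma> e * rval P \<sigma> e'"
| "rval P \<sigma> (RDiv e e') = rval P \<sigma> e / rval P \<sigma> e'"
| "rval P \<sigma> (RDist i j) = point_dist P (nval \<sigma> i) (nval \<sigma> j)"

primrec bval :: "'a::euclidean_space list \<Rightarrow> ram_state \<Rightarrow> bexp \<Rightarrow> bool" where
  "bval P \<sigma> (NLess e e') = (nval \<sigma> e < nval \<sigma> e')"
| "bval P \<sigma> (RLess e e') = (rval P \<sigma> e < rval P \<sigma> e')"
| "bval P \<sigma> (BNot b) = (\<not> bval P \<sigma> b)"
| "bval P \<sigma> (BAnd b b') = (bval P \<sigma> b \<and> bval P \<sigma> b')"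

primrec ncost :: "nexp \<Rightarrow> nat" where
  "ncost (NConst c) = 1"
| "ncost (NCell k i) = 1 + ncost i"
| "ncost (NAdd e e') = 1 + ncost e + ncost e'"
| "ncost (NSub e e') = 1 + ncost e + ncost e'"

primrec rcost :: "rexp \<Rightarrow> nat" where
  "rcost (RConst c) = 1"
| "rcost (RCell k i) = 1 + ncost i"
| "rcost (RAdd e e') = 1 + rcost e + rcost e'"
| "rcost (RSub e e') = 1 + rcost e + rcost e'"
| "rcost (RMul e e') = 1 + rcost e + rcost e'"
| "rcost (RDiv e e') = 1 + rcost e + rcost e'"
| "rcost (RDist i j) = 1 + ncost i + ncost j"

primrec bcost :: "bexp \<Rightarrow> nat" where
  "bcost (NLess e e') = 1 + ncost e + ncost e'"
| "bcost (RLess e e') = 1 + rcost e + rcost e'"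
| "bcost (BNot b) = 1 + bcost b"
| "bcost (BAnd b b') = 1 + bcost b + bcost b'"

definition write_cell :: "(nat \<Rightarrow> nat \<Rightarrow> 'v) \<Rightarrow> nat \<Rightarrow> nat \<Rightarrow> 'v \<Rightarrow> nat \<Rightarrow> nat \<Rightarrow> 'v" where
  "write_cell M k i v = M(k := (M k)(i := v))"

text \<open>
  \<open>exec P c \<sigma> \<tau> \<sigma>'\<close>: on input points \<open>P\<close>, the command \<open>c\<close> started in \<open>\<sigma>\<close> terminates
  after \<open>\<tau>\<close> time units in \<open>\<sigma>'\<close>.
\<close>

inductive exec ::
  "'a::euclidean_space list \<Rightarrow> com \<Rightarrow> ram_state \<Rightarrow> nat \<Rightarrow> ram_state \<Rightarrow> bool" for P where
  Skip: "exec P Skip \<sigma> 1 \<sigma>"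
| NAssign:
    "exec P (NAssign k i e) \<sigma> (1 + ncost i + ncost e)
       (\<sigma>\<lparr>nat_mem := write_cell (nat_mem \<sigma>) k (nval \<sigma> i) (nval \<sigma> e)\<rparr>)"
| RAssign:
    "exec P (RAssign k i e) \<sigma> (1 + ncost i + rcost e)
       (\<sigma>\<lparr>real_mem := write_cell (real_mem \<sigma>) k (nval \<sigma> i) (rval P \<sigma> e)\<rparr>)"
| Seq:
    "exec P c \<sigma> \<tau> \<sigma>' \<Longrightarrow> exec P c' \<sigma>' \<tau>' \<sigma>'' \<Longrightarrow> exec P (Seq c c') \<sigma> (1 + \<tau> + \<tau>') \<sigma>''"
| CondTrue:
    "bval P \<sigma> b \<Longrightarrow> exec P c \<sigma> \<tau> \<sigma>' \<Longrightarrow> exec P (Cond b c c') \<sigma> (1 + bcost b + \<tau>) \<sigma>'"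
| CondFalse:
    "\<not> bval P \<sigma> b \<Longrightarrow> exec P c' \<sigma> \<tau> \<sigma>' \<Longrightarrow> exec P (Cond b c c') \<sigma> (1 + bcost b + \<tau>) \<sigma>'"
| WhileFalse:
    "\<not> bval P \<sigma> b \<Longrightarrow> exec P (While b c) \<sigma> (1 + bcost b) \<sigma>"
| WhileTrue:
    "bval P \<sigma> b \<Longrightarrow> exec P c \<sigma> \<tau> \<sigma>' \<Longrightarrow> exec P (While b c) \<sigma>' \<tau>' \<sigma>'' \<Longrightarrow>
       exec P (While b c) \<sigma> (1 + bcost b + \<tau> + \<tau>') \<sigma>''"

inductive_cases exec_SkipE: "exec P Skip \<sigma> \<tau> \<sigma>'"
inductive_cases exec_NAssignE: "exec P (NAssign k i e) \<sigma> \<tau> \<sigma>'"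
inductive_cases exec_RAssignE: "exec P (RAssign k i e) \<sigma> \<tau> \<sigma>'"
inductive_cases exec_SeqE: "exec P (Seq c c') \<sigma> \<tau> \<sigma>'"
inductive_cases exec_CondE: "exec P (Cond b c c') \<sigma> \<tau> \<sigma>'"
inductive_cases exec_WhileE: "exec P (While b c) \<sigma> \<tau> \<sigma>'"

lemma exec_deterministic:
  assumes "exec P c \<sigma> \<tau>1 \<sigma>1" "exec P c \<sigma> \<tau>2 \<sigma>2"
  shows "\<tau>1 = \<tau>2 \<and> \<sigma>1 = \<sigma>2"
  using assms
proof (induction arbitrary: \<tau>2 \<sigma>2 rule: exec.induct)
  case (Skip \<sigma>)
  from Skip.prems show ?case by (rule exec_SkipE) simp
next
  case (NAssign k i e \<sigma>)
  from NAssign.prems show ?case by (rule exec_NAssignE) simp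
next
  case (RAssign k i e \<sigma>)
  from RAssign.prems show ?case by (rule exec_RAssignE) simp
next
  case (Seq c \<sigma> \<tau> \<sigma>' c' \<tau>' \<sigma>'')
  from Seq.prems show ?case
    by (rule exec_SeqE) (metis Seq.IH add.assoc plus_1_eq_Suc)
next
  case (CondTrue \<sigma> b c \<tau> \<sigma>' c')
  from CondTrue.prems show ?case
    by (rule exec_CondE) (use CondTrue.hyps(1) CondTrue.IH in simp_all)
next
  case (CondFalse \<sigma> b c' \<tau> \<sigma>' c)
  from CondFalse.prems show ?case
    by (rule exec_CondE) (use CondFalse.hyps(1) CondFalse.IH in simp_all)
next
  case (WhileFalse \<sigma> b c)
  from WhileFalse.prems show ?case
    by (rule exec_WhileE) (use WhileFalse.hyps(1) in simp_all)
next
  case (WhileTrue \<sigma> b c \<tau> \<sigma>' \<tau>' \<sigma>'')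
  from WhileTrue.prems show ?case
  proof (rule exec_WhileE)
    assume "\<not> bval P \<sigma> b"
    with WhileTrue.hyps(1) show ?thesis by contradiction
  next
    fix \<tau>a \<sigma>a \<tau>b
    assume eq: "\<tau>2 = Suc (bcost b + \<tau>a + \<tau>b)" "exec P c \<sigma> \<tau>a \<sigma>a" "exec P (While b c) \<sigma>a \<tau>b \<sigma>2"
    have "\<tau> = \<tau>a" "\<sigma>' = \<sigma>a" using WhileTrue.IH(1)[OF eq(2)] by auto
    with WhileTrue.IH(2) eq show ?thesis by simp
  qed
qed

text \<open>
  Initially all cells are 0, except that cell 0 of natural array 0 holds the length of the
  sequences. The result is an extended real: it is \<open>\<infinity>\<close> if cell 0 of natural array 1 is nonzero
  at termination, and otherwise the content of cell 0 of real array 0.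
\<close>

definition initial_state :: "nat \<Rightarrow> ram_state" where
  "initial_state n = \<lparr>nat_mem = write_cell (\<lambda>_ _. 0) 0 0 n, real_mem = (\<lambda>_ _. 0)\<rparr>"

definition result :: "ram_state \<Rightarrow> ereal" where
  "result \<sigma> = (if nat_mem \<sigma> 1 0 = 0 then ereal (real_mem \<sigma> 0 0) else \<infinity>)"

text \<open>
  Since the input points are \<open>A @ B\<close>, the point \<open>A ! i\<close> has index \<open>i\<close> and \<open>B ! j\<close> has
  index \<open>n + j\<close>. One program has to work for all lengths and all points.
\<close>

definition computable_in_time ::
  "('a::euclidean_space list \<Rightarrow> 'a list \<Rightarrow> ereal) \<Rightarrow> (nat \<Rightarrow> real) \<Rightarrow> bool" where
  "computable_in_time F T \<longleftrightarrow>
     (\<exists>c. \<forall>n\<ge>1. \<forall>A B. length A = n \<and> length B = n \<longrightarrow>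
        (\<exists>\<tau> \<sigma>. exec (A @ B) c (initial_state n) \<tau> \<sigma> \<and> real \<tau> \<le> T n \<and> result \<sigma> = F A B))"

end

theory Submission
  imports Defs
begin

text \<open>
  Sort the $N = n^2$ positions by distance. A range is feasible iff a window of consecutive
  positions in this order connects the start to the goal in the grid, so it suffices to find for
  every left end \<open>l\<close> the least right end \<open>reach l\<close> of such a window. Since \<open>reach\<close> is monotone,
  divide and conquer applies: \<open>reach\<close> of the middle left end splits both the range of left ends and
  the range of possible right ends, and the positions that lie in every window of a subproblem stay
  active in a union-find structure while the subproblem is solved. That structure links by size
  without path compression, so that it has logarithmic height and every activation can be undone.
  Each of the $O(\log n)$ levels of the recursion activates $O(N)$ positions at cost $O(\log n)$ each.
\<close>

section \<open>Execution with time bounds\<close>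

text \<open>A sliding window over the sorted positions would find all values of \<open>reach\<close>
  in one sweep, but moving its left end deletes the oldest position, and a union-find structure can
  only take back its latest change. The divide and conquer order turns these deletions into undo
  steps in stack order, for one more logarithmic factor. Only the shortest window of each left end
  matters, because gap and ratio cannot grow when a range shrinks. Equal distances do no harm: the
  positions of a window are all valid for the range between its extreme keys. The machine shapes the
  rest. It has no procedures, so the recursion is an explicit stack of tasks, each of which restores
  the activation state it needs. Naturals have no multiplication or division, so halves are
  tabulated, and minima and maxima are written with truncated subtraction. Running time is proved by
  a potential: pending tasks carry credit for their whole subtree, and every active position carries
  credit for its own removal.\<close>

definition runs ::
  "'a::euclidean_space list \<Rightarrow> com \<Rightarrow> ram_state \<Rightarrow> (nat \<Rightarrow> ram_state \<Rightarrow> bool) \<Rightarrow> bool" where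
  "runs P c M Q \<longleftrightarrow> (\<exists>\<tau> M'. exec P c M \<tau> M' \<and> Q \<tau> M')"

lemma runs_mono:
  assumes "runs P c M Q" "\<And>\<tau> M'. Q \<tau> M' \<Longrightarrow> Q' \<tau> M'"
  shows "runs P c M Q'"
  using assms unfolding runs_def by blast

text \<open>
  Used as a congruence rule, it keeps the simplifier from executing the rest of a program
  symbolically before the state in which that rest starts is known.
\<close>

lemma runs_weak_cong: "c = c' \<Longrightarrow> M = M' \<Longrightarrow> runs P c M Q \<longleftrightarrow> runs P c' M' Q"
  by simp

text \<open>This and the next rules are equations rather than implications, so that the simplifier
  executes straight-line code symbolically and adds up its exact cost on the way.\<close>

lemma runs_Skip [simp]: "runs P Skip M Q \<longleftrightarrow> Q 1 M"
  unfolding runs_def by (metis exec.Skip exec_deterministic)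

lemma runs_NAssign [simp]:
  "runs P (NAssign k i e) M Q \<longleftrightarrow> Q (1 + ncost i + ncost e)
     (M\<lparr>nat_mem := write_cell (nat_mem M) k (nval M i) (nval M e)\<rparr>)"
  unfolding runs_def by (metis exec.NAssign exec_deterministic)

lemma runs_RAssign [simp]:
  "runs P (RAssign k i e) M Q \<longleftrightarrow> Q (1 + ncost i + rcost e)
     (M\<lparr>real_mem := write_cell (real_mem M) k (nval M i) (rval P M e)\<rparr>)"
  unfolding runs_def by (metis exec.RAssign exec_deterministic)

lemma runs_Seq [simp]:
  "runs P (Seq c d) M Q \<longleftrightarrow> runs P c M (\<lambda>\<tau> M'. runs P d M' (\<lambda>\<tau>' M''. Q (1 + \<tau> + \<tau>') M''))"
  unfolding runs_def by (fastforce intro: exec.Seq elim!: exec_SeqE)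

lemma runs_Cond [simp]:
  "runs P (Cond b c d) M Q \<longleftrightarrow>
     (if bval P M b then runs P c M (\<lambda>\<tau>. Q (1 + bcost b + \<tau>))
      else runs P d M (\<lambda>\<tau>. Q (1 + bcost b + \<tau>)))"
proof (cases "bval P M b")
  case True
  then have "exec P (Cond b c d) M \<tau> M' \<longleftrightarrow> (\<exists>\<tau>'. \<tau> = 1 + bcost b + \<tau>' \<and> exec P c M \<tau>' M')" for \<tau> M'
    using exec.CondTrue[OF True] by (auto elim: exec_CondE)
  then show ?thesis using True unfolding runs_def by auto
next
  case False
  then have "exec P (Cond b c d) M \<tau> M' \<longleftrightarrow> (\<exists>\<tau>'. \<tau> = 1 + bcost b + \<tau>' \<and> exec P d M \<tau>' M')" for \<tau> M'
    using exec.CondFalse[OF False] by (auto elim: exec_CondE)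
  then show ?thesis using False unfolding runs_def by auto
qed

definition runs_in ::
  "'a::euclidean_space list \<Rightarrow> com \<Rightarrow> ram_state \<Rightarrow> nat \<Rightarrow> (ram_state \<Rightarrow> bool) \<Rightarrow> bool" where
  "runs_in P c M t Q \<longleftrightarrow> runs P c M (\<lambda>\<tau> M'. Q M' \<and> \<tau> \<le> t)"

lemma runs_in_mono:
  assumes "runs_in P c M t Q" "t \<le> t'" "\<And>M'. Q M' \<Longrightarrow> Q' M'"
  shows "runs_in P c M t' Q'"
  using assms unfolding runs_in_def by (auto elim!: runs_mono)

lemma runs_in_Seq:
  assumes "runs_in P c M t R" "\<And>M'. R M' \<Longrightarrow> runs_in P d M' t' Q" "t + t' + 1 \<le> t''"
  shows "runs_in P (Seq c d) M t'' Q"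
  unfolding runs_in_def runs_Seq
proof (rule runs_mono[OF assms(1)[unfolded runs_in_def]])
  fix \<tau> M' assume "R M' \<and> \<tau> \<le> t"
  then show "runs P d M' (\<lambda>\<tau>' M''. Q M'' \<and> 1 + \<tau> + \<tau>' \<le> t'')"
    using assms(2)[of M'] assms(3) unfolding runs_in_def by (auto elim!: runs_mono)
qed

text \<open>The measure is a potential in time units: each iteration lowers it by at least its own
  running time plus the test and the unit for the loop node. So it is a termination measure and a
  time bound at once, and iterations of very different length are allowed.\<close>

lemma runs_in_While:
  assumes "I M"
    and step: "\<And>M. I M \<Longrightarrow> bval P M b \<Longrightarrow>
      \<exists>t. runs_in P c M t (\<lambda>M'. I M' \<and> m M' + t + bcost b + 1 \<le> m M)"
  shows "runs_in P (While b c) M (m M + 1 + bcost b) (\<lambda>M'. I M' \<and> \<not> bval P M' b)"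
  using assms(1)
proof (induction "m M" arbitrary: M rule: less_induct)
  case less
  show ?case
  proof (cases "bval P M b")
    case False
    then show ?thesis
      using less.prems exec.WhileFalse[OF False] unfolding runs_in_def runs_def
      by (intro exI[of _ "1 + bcost b"] exI[of _ M]) simp
  next
    case True
    obtain \<tau> M' where 1: "exec P c M \<tau> M'" "I M'" "m M' + \<tau> + bcost b + 1 \<le> m M"
      using step[OF less.prems True] unfolding runs_in_def runs_def by fastforce
    have "m M' < m M" using 1(3) by simp
    then obtain \<tau>' M'' where 2: "exec P (While b c) M' \<tau>' M''" "I M''" "\<not> bval P M'' b"
        "\<tau>' \<le> m M' + 1 + bcost b"
      using less.hyps[of M'] 1(2) unfolding runs_in_def runs_def by blast
    show ?thesis
      using exec.WhileTrue[OF True 1(1) 2(1)] 1 2 unfolding runs_in_def runs_def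
      by (intro exI[of _ "1 + bcost b + \<tau> + \<tau>'"] exI[of _ M'']) simp
  qed
qed

lemma runs_in_Cond:
  assumes "bval P M b \<Longrightarrow> runs_in P c M t Q" "\<not> bval P M b \<Longrightarrow> runs_in P d M t Q"
    and "t + bcost b + 1 \<le> t'"
  shows "runs_in P (Cond b c d) M t' Q"
  using assms unfolding runs_in_def by (auto elim!: runs_mono)

section \<open>Memory updates and the arrays that a command may change\<close>

lemma write_cell_apply [simp]:
  "write_cell M k i v k' = (if k' = k then (M k)(i := v) else M k')"
  by (simp add: write_cell_def)

text \<open>\<open>K\<close> lists the natural arrays that may change. No real cell may change,
  which suits all commands except the setup and the recording of a value.\<close>

definition frame :: "nat set \<Rightarrow> ram_state \<Rightarrow> ram_state \<Rightarrow> bool" where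
  "frame K M M' \<longleftrightarrow>
     real_mem M' = real_mem M \<and> (\<forall>k. k \<notin> K \<longrightarrow> nat_mem M' k = nat_mem M k)"

lemma frameD:
  assumes "frame K M M'"
  shows "k \<notin> K \<Longrightarrow> nat_mem M' k = nat_mem M k" and "real_mem M' = real_mem M"
  using assms by (auto simp: frame_def)

lemma frame_refl [simp]: "frame K M M"
  by (simp add: frame_def)

lemma frame_trans:
  assumes "frame K M M'" "frame K M' M''"
  shows "frame K M M''"
  using assms by (simp add: frame_def)

lemma frame_mono: "frame K M M' \<Longrightarrow> K \<subseteq> K' \<Longrightarrow> frame K' M M'"
  by (auto simp: frame_def)

section \<open>Binary length, the discrete logarithm in which the time bounds are stated\<close>

fun bits :: "nat \<Rightarrow> nat" where
  "bits m = (if m = 0 then 0 else Suc (bits (m div 2)))"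

declare bits.simps [simp del]

lemma bits_0 [simp]: "bits 0 = 0"
  by (simp add: bits.simps)

lemma bits_double: "0 < m \<Longrightarrow> bits (2 * m) = Suc (bits m)"
  by (simp add: bits.simps[of "2 * m"])

lemma bits_mono: "m \<le> m' \<Longrightarrow> bits m \<le> bits m'"
proof (induction m arbitrary: m' rule: less_induct)
  case (less m)
  show ?case
  proof (cases "m = 0")
    case False
    then have "bits (m div 2) \<le> bits (m' div 2)" using less by (simp add: div_le_mono)
    then show ?thesis using False less.prems by (simp add: bits.simps[of m] bits.simps[of m'])
  qed simp
qed

lemma bits_pos: "0 < m \<Longrightarrow> 0 < bits m"
  by (subst bits.simps) simp

lemma power_bits_le: "0 < m \<Longrightarrow> 2 ^ bits m \<le> 2 * m"
proof (induction m rule: less_induct)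
  case (less m)
  show ?case
  proof (cases "m = 1")
    case False
    then have "2 ^ bits (m div 2) \<le> 2 * (m div 2)" using less by (intro less.IH) auto
    then show ?thesis using less.prems by (subst bits.simps) simp
  qed (simp add: bits.simps[of "Suc 0"])
qed

section \<open>Union-find with undo\<close>

text \<open>
  The last component \<open>r\<close> maps every element to its root. Because a child is linked below a root
  that is at least as large, the frozen size of a non-root is at most half the size of its parent,
  which bounds the height of the forest.
\<close>

definition forest ::
  "nat set \<Rightarrow> (nat \<times> nat) set \<Rightarrow> (nat \<Rightarrow> nat) \<Rightarrow> (nat \<Rightarrow> nat) \<Rightarrow> (nat \<Rightarrow> nat) \<Rightarrow> bool" where
  "forest S E p z r \<longleftrightarrow>
     finite S \<and> 0 \<notin> S \<and> (\<forall>x. x \<notin> S \<longrightarrow> p x = 0 \<and> z x = 0 \<and> r x = 0) \<and>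
     (\<forall>x\<in>S. p x \<in> S \<and> 0 < z x \<and> r x \<in> S \<and> p (r x) = r x \<and> r (p x) = r x \<and>
        (p x = x \<longrightarrow> r x = x) \<and> (p x \<noteq> x \<longrightarrow> 2 * z x \<le> z (p x))) \<and>
     (\<Sum>x\<in>{x\<in>S. p x = x}. z x) = card S \<and>
     sym E \<and> (\<forall>(x, y)\<in>E. x \<in> S \<and> y \<in> S \<and> r x = r y) \<and>
     (\<forall>x\<in>S. \<forall>y\<in>S. r x = r y \<longrightarrow> (x, y) \<in> E\<^sup>*)"

lemma forest_empty: "forest {} {} (\<lambda>_. 0) (\<lambda>_. 0) (\<lambda>_. 0)"
  by (simp add: forest_def sym_def)

text \<open>A vertex of maximal size must be a root, since the parent of a non-root is at least
  twice as large. The size of a root is one summand of the total \<open>card S\<close>.\<close>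

lemma forest_size_le:
  assumes "forest S E p z r" "x \<in> S"
  shows "z x \<le> card S"
proof -
  have S: "finite S" "S \<noteq> {}" using assms by (auto simp: forest_def)
  obtain y where y: "y \<in> S" "Max (z ` S) = z y" 
    using obtains_MAX[OF S] by metis
  have le: "z w \<le> z y" if "w \<in> S" for w using y(2) S that by (metis Max_ge finite_imageI imageI)
  have "p y = y"
  proof (rule ccontr)
    assume "p y \<noteq> y"
    then have "2 * z y \<le> z (p y)" "0 < z y" "p y \<in> S" using assms(1) y(1) by (auto simp: forest_def)
    then show False using le[of "p y"] by simp
  qed
  then have "z y \<le> (\<Sum>x\<in>{x\<in>S. p x = x}. z x)" using y(1) S by (intro member_le_sum) auto
  then show ?thesis using le[OF assms(2)] assms(1) by (simp add: forest_def)
qed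

text \<open>The relation \<open>E\<close> stays as it is although \<open>v\<close> may have active
  neighbours: the new vertex starts as a component of its own, and the later union steps contribute
  its edges.\<close>

lemma forest_activate:
  assumes f: "forest S E p z r" and v: "v \<notin> S" "v \<noteq> 0"
  shows "forest (insert v S) E (p(v := v)) (z(v := 1)) (r(v := v))"
proof -
  have "{x \<in> insert v S. (p(v := v)) x = x} = insert v {x \<in> S. p x = x}"
    using v by auto
  moreover have "(\<Sum>x\<in>{x \<in> S. p x = x}. (z(v := 1)) x) = (\<Sum>x\<in>{x \<in> S. p x = x}. z x)"
    using v by (intro sum.cong) auto
  ultimately have "(\<Sum>x\<in>{x \<in> insert v S. (p(v := v)) x = x}. (z(v := 1)) x) = card (insert v S)"
    using f v by (auto simp: forest_def)
  moreover have "\<forall>x\<in>S. p x \<noteq> v \<and> r x \<noteq> v" using f v by (auto simp: forest_def)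
  ultimately show ?thesis using f v unfolding forest_def by (auto 0 3)
qed

text \<open>The doubling condition for the new child \<open>c\<close> holds because the size of
  \<open>q\<close> becomes \<open>z q + z c\<close>, which is at least \<open>2 * z c\<close>. For
  the other children it persists, since their own sizes are frozen and the size of a parent can only
  grow. One pointer changes, but the ghost map \<open>r\<close> relabels the whole class of
  \<open>c\<close>.\<close>

lemma forest_link:
  assumes f: "forest S E p z r" and S: "v \<in> S" "y \<in> S" and ne: "r v \<noteq> r y"
    and c: "{c, q} = {r v, r y}" "z c \<le> z q"
  shows "forest S (E \<union> {(v, y), (y, v)}) (p(c := q)) (z(q := z q + z c))
           (\<lambda>x. if r x = c then q else r x)"
proof -
  let ?p = "p(c := q)" and ?z = "z(q := z q + z c)" and ?r = "\<lambda>x. if r x = c then q else r x"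
  let ?E = "E \<union> {(v, y), (y, v)}"
  have cq: "c \<in> S" "q \<in> S" "c \<noteq> q" "p c = c" "p q = q" "r c = c" "r q = q"
    using f S ne c(1) by (auto simp: forest_def doubleton_eq_iff)
  let ?R = "{x\<in>S. p x = x}"
  have fin: "finite S" using f by (simp add: forest_def)
  have R: "{x\<in>S. ?p x = x} = ?R - {c}" using cq by auto
  \<comment> \<open>The vertex \<open>c\<close> stops being a root and its size moves into that of
    \<open>q\<close>, so the total over the roots is kept.\<close>
  have "(\<Sum>x\<in>?R - {c}. ?z x) = (z q + z c) + (\<Sum>x\<in>?R - {c} - {q}. z x)"
    using fin cq by (subst sum.remove[of _ q]) (auto intro!: sum.cong)
  also have "\<dots> = (\<Sum>x\<in>?R. z x)"
    using fin cq by (subst sum.remove[of ?R c], simp, simp, subst sum.remove[of "?R - {c}" q]) auto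
  finally have sum: "(\<Sum>x\<in>{x\<in>S. ?p x = x}. ?z x) = card S"
    using R f by (simp add: forest_def)
  have symE: "sym ?E" using f by (auto simp: forest_def sym_def)
  have old: "(a, b) \<in> ?E\<^sup>*" if "a \<in> S" "b \<in> S" "r a = r b" for a b
  proof -
    have "(a, b) \<in> E\<^sup>*" using f that by (simp add: forest_def)
    then show ?thesis using rtrancl_mono[of E ?E] by blast
  qed
  \<comment> \<open>A path from the class of \<open>c\<close> to the class of \<open>q\<close> goes
    through the new edge; its orientation depends on which endpoint lies in the class of
    \<open>c\<close>.\<close>
  have new: "(a, b) \<in> ?E\<^sup>*" if "a \<in> S" "b \<in> S" "r a = c" "r b = q" for a b
  proof (cases "c = r v")
    case True
    then have "q = r y" using c(1) ne by (auto simp: doubleton_eq_iff)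
    then have "(a, v) \<in> ?E\<^sup>*" "(v, y) \<in> ?E\<^sup>*" "(y, b) \<in> ?E\<^sup>*" using old that S True by auto
    then show ?thesis by (meson rtrancl_trans)
  next
    case False
    then have "c = r y" "q = r v" using c(1) ne by (auto simp: doubleton_eq_iff)
    then have "(a, y) \<in> ?E\<^sup>*" "(y, v) \<in> ?E\<^sup>*" "(v, b) \<in> ?E\<^sup>*" using old that S by auto
    then show ?thesis by (meson rtrancl_trans)
  qed
  have new': "(b, a) \<in> ?E\<^sup>*" if "a \<in> S" "b \<in> S" "r a = c" "r b = q" for a b
    using new[OF that] symE by (simp add: sym_rtrancl symD)
  have conn: "(a, b) \<in> ?E\<^sup>*"
    if "a \<in> S" "b \<in> S" "?r a = ?r b" for a b
    using that old new new' by (metis (full_types))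
  have edge: "\<forall>(a, b)\<in>?E. a \<in> S \<and> b \<in> S \<and>
      ?r a = ?r b"
    using f S c(1) by (auto simp: forest_def doubleton_eq_iff split: if_splits)
  let ?N = "\<lambda>x. ?p x \<in> S \<and> 0 < ?z x \<and>
      ?r x \<in> S \<and>
      ?p (?r x) = ?r x \<and>
      ?r (?p x) = ?r x \<and>
      (?p x = x \<longrightarrow> ?r x = x) \<and>
      (?p x \<noteq> x \<longrightarrow> 2 * ?z x \<le> ?z (?p x))"
  have nodes: "\<forall>x\<in>S. ?N x"
  proof
    fix x assume x: "x \<in> S"
    have fx: "p x \<in> S" "0 < z x" "r x \<in> S" "p (r x) = r x" "r (p x) = r x"
      "p x = x \<Longrightarrow> r x = x" "p x \<noteq> x \<Longrightarrow> 2 * z x \<le> z (p x)" using f x by (auto simp: forest_def)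
    have "2 * ?z x \<le> ?z (?p x)" if "?p x \<noteq> x"
    proof (cases "x = c")
      case True
      then show ?thesis using cq c(2) by simp
    next
      case False
      then have "p x \<noteq> x" "x \<noteq> q" using that cq by auto
      moreover have "z (p x) \<le> ?z (p x)" by simp
      ultimately show ?thesis using fx(7) False by (simp del: fun_upd_apply add: fun_upd_other)
    qed
    moreover have "?r (?p x) = ?r x"
      using fx(5) cq by (cases "x = c") simp_all
    moreover have "?p (?r x) = ?r x"
      using fx(4) cq by simp
    moreover have "?p x = x \<longrightarrow> ?r x = x"
      using fx(6) cq by (cases "x = c") auto
    moreover have "?p x \<in> S" "0 < ?z x" "?r x \<in> S"
      using fx(1-3) cq by auto
    ultimately show "?N x"
      by blast
  qed
  have out: "\<forall>x. x \<notin> S \<longrightarrow> ?p x = 0 \<and> ?z x = 0 \<and>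
      ?r x = 0"
    using f cq by (auto simp: forest_def)
  have "finite S" "0 \<notin> S" using f by (simp_all add: forest_def)
  then show ?thesis
    unfolding forest_def using sum symE conn edge nodes out by blast
qed

text \<open>One number per union is enough: the pointer of the child still names the root it was
  linked to, and its size is unchanged since then. Subtracting that size restores the root.\<close>

definition undo :: "nat \<Rightarrow> (nat \<Rightarrow> nat) \<times> (nat \<Rightarrow> nat) \<Rightarrow> (nat \<Rightarrow> nat) \<times> (nat \<Rightarrow> nat)" where
  "undo c = (\<lambda>(p, z). (p(c := c), z(p c := z (p c) - z c)))"

lemma undo_link: "p c = c \<Longrightarrow> c \<noteq> q \<Longrightarrow> undo c (p(c := q), z(q := z q + z c)) = (p, z)"
  by (auto simp: undo_def fun_eq_iff)

text \<open>Vertex 0 is never active, so its pointer and size are both 0 and undoing it writes back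
  what is already there.\<close>

lemma undo_none: "forest S E p z r \<Longrightarrow> undo 0 (p, z) = (p, z)"
  by (auto simp: undo_def forest_def fun_eq_iff)

text \<open>Grid adjacency on codes with row width \<open>w\<close>. Stepping over the end of a row
  is not excluded here; the codes of positions are chosen so that such a step never joins two
  positions.\<close>

definition adj :: "nat \<Rightarrow> (nat \<times> nat) set" where
  "adj w = {(x, y). y = x + 1 \<or> x = y + 1 \<or> y = x + w \<or> x = y + w}"

text \<open>
  \<open>history w p z us vs\<close>: the arrays \<open>p\<close> and \<open>z\<close> arise by activating the vertices \<open>vs\<close>
  (latest first), each with four union steps whose recorded children are in \<open>us\<close>; the child 0 records
  that nothing was linked.
\<close>

inductive history ::
  "nat \<Rightarrow> (nat \<Rightarrow> nat) \<Rightarrow> (nat \<Rightarrow> nat) \<Rightarrow> nat list \<Rightarrow> nat list \<Rightarrow> bool" for w where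
  history_Nil: "history w (\<lambda>_. 0) (\<lambda>_. 0) [] []"
| history_Cons:
    "history w p z us vs \<Longrightarrow> v \<notin> set vs \<Longrightarrow> v \<noteq> 0 \<Longrightarrow>
     undo c1 (undo c2 (undo c3 (undo c4 (p', z')))) = (p(v := v), z(v := 1)) \<Longrightarrow>
     forest (insert v (set vs)) (adj w \<inter> insert v (set vs) \<times> insert v (set vs)) p' z' r \<Longrightarrow>
     history w p' z' (c4 # c3 # c2 # c1 # us) (v # vs)"

lemma history_forest:
  assumes "history w p z us vs"
  obtains r where "forest (set vs) (adj w \<inter> set vs \<times> set vs) p z r"
proof -
  have "\<exists>r. forest (set vs) (adj w \<inter> set vs \<times> set vs) p z r"
    using assms by cases (auto intro: forest_empty)
  then show thesis using that by blast
qed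

section \<open>Machine code for finding roots and for linking\<close>

abbreviation (input) "aW \<equiv> 2 :: nat"
abbreviation (input) "aT \<equiv> 3 :: nat"
abbreviation (input) "aPar \<equiv> 8 :: nat"
abbreviation (input) "aSize \<equiv> 9 :: nat"
abbreviation (input) "aUst \<equiv> 10 :: nat"
abbreviation (input) "aUp \<equiv> 11 :: nat"
abbreviation (input) "aVst \<equiv> 12 :: nat"
abbreviation (input) "aSp \<equiv> 13 :: nat"
abbreviation (input) "aX \<equiv> 14 :: nat"
abbreviation (input) "aV \<equiv> 19 :: nat"
abbreviation (input) "aRoot \<equiv> 15 :: nat"
abbreviation (input) "aChild \<equiv> 16 :: nat"
abbreviation (input) "aTop \<equiv> 17 :: nat"
abbreviation (input) "aConn \<equiv> 18 :: nat"

abbreviation Var :: "nat \<Rightarrow> nexp" where "Var k \<equiv> NCell k (NConst 0)"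
abbreviation assign :: "nat \<Rightarrow> nexp \<Rightarrow> com" where "assign k e \<equiv> NAssign k (NConst 0) e"
abbreviation incr :: "nat \<Rightarrow> com" where "incr k \<equiv> assign k (NAdd (Var k) (NConst 1))"
abbreviation decr :: "nat \<Rightarrow> com" where "decr k \<equiv> assign k (NSub (Var k) (NConst 1))"
definition NEq :: "nexp \<Rightarrow> nexp \<Rightarrow> bexp" where
  "NEq a b = BAnd (BNot (NLess a b)) (BNot (NLess b a))"

lemma bval_NEq [simp]: "bval P M (NEq a b) \<longleftrightarrow> nval M a = nval M b"
  by (auto simp: NEq_def)

lemma bcost_NEq [simp]: "bcost (NEq a b) = 5 + 2 * ncost a + 2 * ncost b"
  by (simp add: NEq_def)

notation Seq (infixr ";;" 60)

definition find_com :: com where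
  "find_com = While (BNot (NEq (NCell aPar (Var aX)) (Var aX))) (assign aX (NCell aPar (Var aX)))"

text \<open>Sizes at least double along parent pointers, so their binary length strictly increases
  and is at most \<open>bits N\<close>. The start may also be inactive: its pointer and its
  \<open>r\<close> value are 0, hence the search ends at 0. This is how callers recognise inactive
  neighbours. One round costs 22: 16 for the test, 5 for the assignment, 1 for the loop.\<close>

lemma run_find:
  assumes f: "forest S E (nat_mem M aPar) (nat_mem M aSize) r" and N: "card S \<le> N"
  shows "runs_in P find_com M (22 * bits N + 39)
           (\<lambda>M'. nat_mem M' aX 0 = r (nat_mem M aX 0) \<and> frame {aX} M M')"
    (is "runs_in _ _ _ _ ?Q")
proof -
  let ?p = "nat_mem M aPar" and ?z = "nat_mem M aSize"
  \<comment> \<open>An upper bound on the remaining pointer steps. An inactive nonzero vertex needs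
    exactly one, to 0.\<close>
  define g where "g x = (if x \<in> S then bits N - bits (?z x) else if x = 0 then 0 else 1)" for x
  have r: "r (?p x) = r x" for x using f by (cases "x \<in> S") (auto simp: forest_def)
  have g: "g (?p x) < g x" if "?p x \<noteq> x" for x
  proof (cases "x \<in> S")
    case True
    then have z: "0 < ?z x" "2 * ?z x \<le> ?z (?p x)" "?p x \<in> S"
      using f that by (auto simp: forest_def)
    have "Suc (bits (?z x)) \<le> bits (?z (?p x))" using bits_mono[OF z(2)] bits_double[OF z(1)] by simp
    moreover have "bits (?z (?p x)) \<le> bits N"
      using forest_size_le[OF f z(3)] N by (intro bits_mono) simp
    ultimately show ?thesis using True z(3) by (simp add: g_def)
  next
    case False
    then have "?p x = 0" "0 \<notin> S" using f by (auto simp: forest_def)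
    then show ?thesis using False that by (simp add: g_def)
  qed
  have root: "r x = x" if "?p x = x" for x
    using f that by (cases "x \<in> S") (auto simp: forest_def)
  have I: "frame {aX} M M \<and> r (nat_mem M aX 0) = r (nat_mem M aX 0)" by simp
  show ?thesis unfolding find_com_def
  proof (rule runs_in_mono[OF runs_in_While[where m = "\<lambda>M'. 22 * g (nat_mem M' aX 0)" and
      I = "\<lambda>M'. frame {aX} M M' \<and> r (nat_mem M' aX 0) = r (nat_mem M aX 0)", OF I]])
    fix M' assume I: "frame {aX} M M' \<and> r (nat_mem M' aX 0) = r (nat_mem M aX 0)"
      and b: "bval P M' (BNot (NEq (NCell aPar (Var aX)) (Var aX)))"
    have p: "nat_mem M' aPar = ?p" using I by (simp add: frame_def)
    have "g (?p (nat_mem M' aX 0)) < g (nat_mem M' aX 0)" using b p by (intro g) auto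
    then show "\<exists>t. runs_in P (assign aX (NCell aPar (Var aX))) M' t (\<lambda>M''.
      (frame {aX} M M'' \<and> r (nat_mem M'' aX 0) = r (nat_mem M aX 0)) \<and>
      22 * g (nat_mem M'' aX 0) + t + bcost (BNot (NEq (NCell aPar (Var aX)) (Var aX))) + 1
        \<le> 22 * g (nat_mem M' aX 0))"
      using I p r by (intro exI[of _ 5]) (simp add: frame_def runs_in_def)
  next
    have "g x \<le> bits N + 1" for x by (auto simp: g_def)
    from this[of "nat_mem M aX 0"] show "22 * g (nat_mem M aX 0) + 1 + bcost (BNot (NEq (NCell aPar (Var aX)) (Var aX)))
        \<le> 22 * bits N + 39" by simp
  next
    fix M'
    assume a: "(frame {aX} M M' \<and> r (nat_mem M' aX 0) = r (nat_mem M aX 0)) \<and>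
      \<not> bval P M' (BNot (NEq (NCell aPar (Var aX)) (Var aX)))"
    have "nat_mem M' aPar = ?p" using a by (simp add: frame_def)
    then have "r (nat_mem M' aX 0) = nat_mem M' aX 0" using a by (intro root) simp
    then show "?Q M'" using a by simp
  qed
qed

definition root_com :: "nexp \<Rightarrow> com" where
  "root_com e = assign aX e;; find_com"

lemma run_root:
  assumes f: "forest S E (nat_mem M aPar) (nat_mem M aSize) r" and N: "card S \<le> N"
    and e: "nval M e = y" "ncost e \<le> 5"
  shows "runs_in P (root_com e) M (22 * bits N + 50)
           (\<lambda>M'. nat_mem M' aX 0 = r y \<and> frame {aX} M M')"
    (is "runs_in _ _ _ _ ?Q")
  unfolding root_com_def
proof (rule runs_in_Seq)
  let ?M' = "M\<lparr>nat_mem := write_cell (nat_mem M) aX 0 y\<rparr>"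
  show "runs_in P (assign aX e) M 7 (\<lambda>M'. M' = ?M')"
    using e by (simp add: runs_in_def)
  show "runs_in P find_com M' (22 * bits N + 39)
      ?Q" if s: "M' = ?M'" for M'
    unfolding s
    by (rule runs_in_mono[OF run_find[OF _ N]]) (use f in \<open>auto simp: frame_def\<close>)
qed simp

text \<open>The case in which a union finds equal roots: the arrays stay, but the new edge has to
  enter the relation so that all its edges are accounted for at the end.\<close>

lemma forest_add_edge:
  assumes f: "forest S E p z r" and S: "v \<in> S" "y \<in> S" and r: "r v = r y"
  shows "forest S (E \<union> {(v, y), (y, v)}) p z r"
proof -
  have "E\<^sup>* \<subseteq> (E \<union> {(v, y), (y, v)})\<^sup>*" by (rule rtrancl_mono) blast
  then have "\<forall>a\<in>S. \<forall>b\<in>S. r a = r b \<longrightarrow> (a, b) \<in> (E \<union> {(v, y), (y, v)})\<^sup>*"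
    using f unfolding forest_def by (meson subsetD)
  moreover have "sym (E \<union> {(v, y), (y, v)})" using f by (auto simp: forest_def sym_def)
  moreover have "\<forall>(a, b)\<in>E \<union> {(v, y), (y, v)}. a \<in> S \<and> b \<in> S \<and> r a = r b"
    using f S r by (auto simp: forest_def)
  ultimately show ?thesis using f unfolding forest_def by (elim conjE) (intro conjI)
qed

text \<open>A child is recorded even if nothing is linked, namely 0. Every vertex thus owns exactly
  four entries of the undo stack, and removing it needs no counter.\<close>

definition link_com :: com where
  "link_com =
     Cond (BAnd (NLess (NConst 0) (Var aX)) (BNot (NEq (Var aX) (Var aRoot))))
       (Cond (NLess (NCell aSize (Var aRoot)) (NCell aSize (Var aX)))
          (assign aChild (Var aRoot);; assign aTop (Var aX))
          (assign aChild (Var aX);; assign aTop (Var aRoot));;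
        NAssign aPar (Var aChild) (Var aTop);;
        NAssign aSize (Var aTop) (NAdd (NCell aSize (Var aTop)) (NCell aSize (Var aChild))))
       (assign aChild (NConst 0));;
     NAssign aUst (Var aUp) (Var aChild);; incr aUp"

definition union_com :: "nexp \<Rightarrow> com" where
  "union_com e = root_com (Var aV);; assign aRoot (Var aX);; root_com e;; link_com"

definition linked ::
  "nat set \<Rightarrow> (nat \<times> nat) set \<Rightarrow> nat \<Rightarrow> nat \<Rightarrow> ram_state \<Rightarrow> ram_state \<Rightarrow> bool" where
  "linked S E v y M M' \<longleftrightarrow> (\<exists>r' c. forest S (E \<union> (if y \<in> S then {(v, y), (y, v)} else {})) (nat_mem M' aPar) (nat_mem M' aSize) r' \<and>
      undo c (nat_mem M' aPar, nat_mem M' aSize) = (nat_mem M aPar, nat_mem M aSize) \<and>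
      nat_mem M' aUst = (nat_mem M aUst)(nat_mem M aUp 0 := c) \<and>
      nat_mem M' aUp 0 = nat_mem M aUp 0 + 1)"

lemma run_link:
  assumes f: "forest S E (nat_mem M aPar) (nat_mem M aSize) r"
    and v: "nat_mem M aRoot 0 = r v" "v \<in> S" and y: "nat_mem M aX 0 = r y"
  shows "runs_in P link_com M 90 (\<lambda>M'. linked S E v y M M' \<and> frame {8, 9, 10, 11, 16, 17} M M')"
proof -
  let ?p = "nat_mem M aPar" and ?z = "nat_mem M aSize"
  \<comment> \<open>The machine sees roots only; root 0 is its sign that \<open>y\<close> is not
    active.\<close>
  have "y \<in> S \<Longrightarrow> r y \<in> S" "y \<notin> S \<Longrightarrow> r y = 0" "0 \<notin> S" using f by (simp_all add: forest_def)
  then have ry: "r y \<noteq> 0 \<longleftrightarrow> y \<in> S" by metis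
  define c where "c = (if y \<in> S \<and> r y \<noteq> r v then (if ?z (r v) < ?z (r y) then r v else r y) else 0)"
  define q where "q = (if ?z (r v) < ?z (r y) then r y else r v)"
  define p' where "p' = (if y \<in> S \<and> r y \<noteq> r v then ?p(c := q) else ?p)"
  define z' where "z' = (if y \<in> S \<and> r y \<noteq> r v then ?z(q := ?z q + ?z c) else ?z)"
  have "(\<exists>r'. forest S (E \<union> (if y \<in> S then {(v, y), (y, v)} else {})) p' z' r') \<and>
      undo c (p', z') = (?p, ?z)"
  proof (cases "y \<in> S \<and> r y \<noteq> r v")
    case True
    have "?p c = c" using f v True by (auto simp: forest_def c_def)
    moreover have "c \<noteq> q" using True by (auto simp: c_def q_def)
    ultimately have "undo c (p', z') = (?p, ?z)" using True undo_link[of ?p c q ?z]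
      by (simp add: p'_def z'_def)
    moreover have "forest S (E \<union> {(v, y), (y, v)}) (?p(c := q)) (?z(q := ?z q + ?z c))
        (\<lambda>x. if r x = c then q else r x)"
      using True v by (intro forest_link[OF f]) (auto simp: c_def q_def)
    ultimately show ?thesis using True by (auto simp: p'_def z'_def)
  next
    case False
    then have c: "c = 0" "p' = ?p" "z' = ?z" by (simp_all only: c_def p'_def z'_def if_False)
    have "\<exists>r'. forest S (E \<union> (if y \<in> S then {(v, y), (y, v)} else {})) ?p ?z r'"
      using False f forest_add_edge[OF f v(2), of y] by auto
    then show ?thesis using c undo_none[OF f] by simp
  qed
  then obtain r' where r': "forest S (E \<union> (if y \<in> S then {(v, y), (y, v)} else {})) p' z' r'"
    and un: "undo c (p', z') = (?p, ?z)" by blast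
  have b: "0 < r y \<and> r y \<noteq> r v \<longleftrightarrow> y \<in> S \<and> r y \<noteq> r v" using ry by auto
  have "runs_in P link_com M 90 (\<lambda>M'. nat_mem M' aPar = p' \<and> nat_mem M' aSize = z' \<and>
       nat_mem M' aUst = (nat_mem M aUst)(nat_mem M aUp 0 := c) \<and>
       nat_mem M' aUp 0 = nat_mem M aUp 0 + 1 \<and> frame {8, 9, 10, 11, 16, 17} M M')"
  proof (cases "y \<in> S \<and> r y \<noteq> r v")
    case True
    then have "0 < r y" using b by simp
    with True show ?thesis
      by (cases "?z (r v) < ?z (r y)")
        (simp_all add: link_com_def runs_in_def p'_def z'_def c_def q_def v(1) y frame_def)
  next
    case False
    then have "\<not> (0 < r y \<and> r y \<noteq> r v)" using b by simp
    with False show ?thesis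
      by (simp only: p'_def z'_def c_def q_def if_False) (auto simp: link_com_def runs_in_def v(1) y frame_def)
  qed
  then show ?thesis
    by (rule runs_in_mono) (use r' un in \<open>auto simp: linked_def\<close>)
qed

text \<open>The expression \<open>e\<close> is evaluated after the root of \<open>v\<close> has been
  found, so its value must not depend on the two scratch arrays used until then.\<close>

lemma run_union:
  assumes f: "forest S E (nat_mem M aPar) (nat_mem M aSize) r" and N: "card S \<le> N"
    and v: "nat_mem M aV 0 = v" "v \<in> S"
    and e: "\<And>M'. frame {aX, aRoot} M M' \<Longrightarrow> nval M' e = y" "ncost e \<le> 5"
  shows "runs_in P (union_com e) M (44 * bits N + 200) (\<lambda>M'. linked S E v y M M' \<and> frame {8, 9, 10, 11, 14, 15, 16, 17} M M')"
    (is "runs_in _ _ _ _ ?Q")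
  unfolding union_com_def
proof (rule runs_in_Seq)
  show "runs_in P (root_com (Var aV)) M (22 * bits N + 50)
      (\<lambda>M'. nat_mem M' aX 0 = r v \<and> frame {aX} M M')"
    using v by (intro run_root[OF f N]) simp_all
next
  fix M1 assume s1: "nat_mem M1 aX 0 = r v \<and> frame {aX} M M1"
  show "runs_in P (assign aRoot (Var aX);; root_com e;; link_com) M1 (22 * bits N + 148)
    ?Q"
  proof (rule runs_in_Seq)
    show "runs_in P (assign aRoot (Var aX)) M1 4
        (\<lambda>M'. nat_mem M' aRoot 0 = r v \<and> frame {aX, aRoot} M M')"
      using s1 by (simp add: runs_in_def frame_def)
  next
    fix M2 assume s2: "nat_mem M2 aRoot 0 = r v \<and> frame {aX, aRoot} M M2"
    then have m2: "nat_mem M2 aPar = nat_mem M aPar" "nat_mem M2 aSize = nat_mem M aSize"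
      by (simp_all add: frame_def)
    show "runs_in P (root_com e;; link_com) M2 (22 * bits N + 143) ?Q"
    proof (rule runs_in_Seq)
      show "runs_in P (root_com e) M2 (22 * bits N + 50)
          (\<lambda>M'. nat_mem M' aX 0 = r y \<and> frame {aX} M2 M')"
        using s2 f e m2 by (intro run_root[OF _ N]) auto
    next
      fix M3 assume s3: "nat_mem M3 aX 0 = r y \<and> frame {aX} M2 M3"
      have m: "nat_mem M3 aPar = nat_mem M aPar" "nat_mem M3 aSize = nat_mem M aSize"
        "nat_mem M3 aUst = nat_mem M aUst" "nat_mem M3 aUp = nat_mem M aUp"
        "nat_mem M3 aRoot 0 = r v" and s: "frame {aX, aRoot} M M3"
        using s2 s3 by (auto simp: frame_def)
      have f3: "forest S E (nat_mem M3 aPar) (nat_mem M3 aSize) r" using f m by simp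
      show "runs_in P link_com M3 90 ?Q"
      proof (rule runs_in_mono[OF run_link[OF f3 m(5) v(2)]])
        fix M4
        assume l: "linked S E v y M3 M4 \<and> frame {8, 9, 10, 11, 16, 17} M3 M4"
        have "linked S E v y M3 M4 \<longleftrightarrow> linked S E v y M M4" by (simp only: linked_def m(1-4))
        moreover have "frame {8, 9, 10, 11, 14, 15, 16, 17} M M4" using s l by (auto simp: frame_def)
        ultimately show "?Q M4" using l by blast
      qed (use s3 in simp_all)
    qed simp
  qed simp
qed simp

definition stack :: "ram_state \<Rightarrow> nat list" where
  "stack M = map (nat_mem M aVst) [0..<nat_mem M aSp 0]"

text \<open>The machine stacks grow at their end whereas \<open>history\<close> keeps the latest
  entry in front; hence the two reversals.\<close>

definition dsu :: "nat \<Rightarrow> ram_state \<Rightarrow> bool" where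
  "dsu w M \<longleftrightarrow> history w (nat_mem M aPar) (nat_mem M aSize)
     (rev (map (nat_mem M aUst) [0..<nat_mem M aUp 0])) (rev (stack M))"

lemma stack_cong:
  assumes "frame K M M'" "aVst \<notin> K" "aSp \<notin> K"
  shows "stack M' = stack M"
  using assms by (simp add: stack_def frame_def)

lemma dsu_cong:
  assumes "frame K M M'" "K \<inter> {8, 9, 10, 11, 12, 13} = {}"
  shows "dsu w M' \<longleftrightarrow> dsu w M"
proof -
  have "k \<notin> K" if "k \<in> {8, 9, 10, 11, 12, 13}" for k using assms(2) that by blast
  then show ?thesis using assms(1) by (simp add: dsu_def stack_def frame_def)
qed

section \<open>Activating and removing a vertex, and the connectivity query\<close>

definition unions_com :: com where
  "unions_com =
     union_com (NAdd (Var aV) (NConst 1));;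
     union_com (NSub (Var aV) (NConst 1));;
     union_com (NAdd (Var aV) (Var aW));;
     union_com (NSub (Var aV) (Var aW))"

definition push_com :: com where
  "push_com =
     (NAssign aVst (Var aSp) (Var aV);; incr aSp;;
      NAssign aPar (Var aV) (Var aV);; NAssign aSize (Var aV) (NConst 1));;
     unions_com"

definition undo_com :: com where
  "undo_com = decr aUp;; assign aChild (NCell aUst (Var aUp));;
     NAssign aSize (NCell aPar (Var aChild))
       (NSub (NCell aSize (NCell aPar (Var aChild))) (NCell aSize (Var aChild)));;
     NAssign aPar (Var aChild) (Var aChild)"

definition pop_com :: com where
  "pop_com = undo_com;; undo_com;; undo_com;; undo_com;;
     decr aSp;; NAssign aPar (NCell aVst (Var aSp)) (NConst 0);;
     NAssign aSize (NCell aVst (Var aSp)) (NConst 0)"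

text \<open>\<open>aW\<close> doubles as the start vertex, because the code of the first position
  equals the row width. Testing that the goal has a nonzero root suffices: equality of the roots
  then makes the start active as well.\<close>

definition connected_com :: com where
  "connected_com = root_com (Var aW);; assign aRoot (Var aX);; root_com (Var aT);;
     Cond (BAnd (NLess (NConst 0) (Var aX)) (NEq (Var aX) (Var aRoot)))
       (assign aConn (NConst 1)) (assign aConn (NConst 0))"

definition adj_link :: "nat \<Rightarrow> nat \<Rightarrow> nat set \<Rightarrow> (nat \<times> nat) set" where
  "adj_link v y S = (if y \<in> S then {(v, y), (y, v)} else {})"

text \<open>The four candidate neighbours need no border test: where truncated subtraction finds no
  neighbour it returns 0, which is never active and so contributes no edge.\<close>

lemma adj_insert:
  assumes "v \<notin> S" "0 \<notin> S" "v \<noteq> 0" "0 < w"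
  defines "S' \<equiv> insert v S"
  shows "adj w \<inter> S \<times> S \<union> adj_link v (v + 1) S' \<union> adj_link v (v - 1) S' \<union>
    adj_link v (v + w) S' \<union> adj_link v (v - w) S' = adj w \<inter> S' \<times> S'" (is "?L = ?R")
proof
  have "adj_link v (v - w) S' \<subseteq> adj w"
  proof (cases "v - w \<in> S'")
    case True
    then have "v - w \<noteq> 0" using assms by (auto simp: S'_def)
    then show ?thesis by (auto simp: adj_link_def adj_def)
  qed (simp add: adj_link_def)
  then show "?L \<subseteq> ?R" using assms by (auto simp: adj_link_def adj_def)
  show "?R \<subseteq> ?L"
  proof
    fix q assume "q \<in> ?R"
    then obtain x y where q: "q = (x, y)" "(x, y) \<in> adj w" "x \<in> S'" "y \<in> S'" by auto
    have nb: "(a, b) \<in> ?L" "(b, a) \<in> ?L" if "(a, b) \<in> adj w" "a = v" "b \<in> S'" for a b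
    proof -
      have "b = v + 1 \<or> b = v - 1 \<or> b = v + w \<or> b = v - w" using that by (auto simp: adj_def)
      then show "(a, b) \<in> ?L" "(b, a) \<in> ?L" using that by (auto simp: adj_link_def)
    qed
    have sym: "(y, x) \<in> adj w" using q by (auto simp: adj_def)
    show "q \<in> ?L"
    proof (cases "x = v \<or> y = v")
      case True
      then show ?thesis using nb q sym by metis
    next
      case False
      then have "x \<in> S" "y \<in> S" using q by (auto simp: S'_def)
      then show ?thesis using q by blast
    qed
  qed
qed

text \<open>Describes a push between two of its unions, relative to the state \<open>M\<close> in
  which \<open>v\<close> is already active but isolated. The recorded children \<open>cs\<close> are
  listed latest first, so that \<open>fold undo cs\<close> leads back to \<open>M\<close>. The
  relation \<open>E\<close> need not yet be the induced graph.\<close>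

definition unioned ::
  "nat set \<Rightarrow> (nat \<times> nat) set \<Rightarrow> ram_state \<Rightarrow> nat list \<Rightarrow> ram_state \<Rightarrow> bool" where
  "unioned S E M cs M' \<longleftrightarrow> (\<exists>r. forest S E (nat_mem M' aPar) (nat_mem M' aSize) r) \<and>
     fold undo cs (nat_mem M' aPar, nat_mem M' aSize) = (nat_mem M aPar, nat_mem M aSize) \<and>
     nat_mem M' aUp 0 = nat_mem M aUp 0 + length cs \<and>
     map (nat_mem M' aUst) [0..<nat_mem M' aUp 0] =
       map (nat_mem M aUst) [0..<nat_mem M aUp 0] @ rev cs \<and>
     frame {8, 9, 10, 11, 14, 15, 16, 17} M M'"

lemma run_unioned:
  assumes u: "unioned S E M cs M1" and N: "card S \<le> N" and v: "nat_mem M aV 0 = v" "v \<in> S"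
    and e: "\<And>M'. frame {8, 9, 10, 11, 14, 15, 16, 17} M M' \<Longrightarrow> nval M' e = y" "ncost e \<le> 5"
  shows "runs_in P (union_com e) M1 (44 * bits N + 200)
    (\<lambda>M'. \<exists>c. unioned S (E \<union> adj_link v y S) M (c # cs) M')"
proof -
  obtain r where r: "forest S E (nat_mem M1 aPar) (nat_mem M1 aSize) r"
    using u by (auto simp: unioned_def)
  have s: "frame {8, 9, 10, 11, 14, 15, 16, 17} M M1" using u by (simp add: unioned_def)
  show ?thesis
  proof (rule runs_in_mono[OF run_union[OF r N _ v(2)]])
    show "nat_mem M1 aV 0 = v" using s v by (simp add: frame_def)
    show "nval M' e = y" if "frame {aX, aRoot} M1 M'" for M'
      using s that by (intro e(1)) (auto simp: frame_def)
    show "ncost e \<le> 5" by (rule e(2))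
  next
    fix M2
    assume "linked S E v y M1 M2 \<and> frame {8, 9, 10, 11, 14, 15, 16, 17} M1 M2"
    then obtain r' c where 2: "forest S (E \<union> adj_link v y S) (nat_mem M2 aPar) (nat_mem M2 aSize) r'"
      "undo c (nat_mem M2 aPar, nat_mem M2 aSize) = (nat_mem M1 aPar, nat_mem M1 aSize)"
      "nat_mem M2 aUst = (nat_mem M1 aUst)(nat_mem M1 aUp 0 := c)"
      "nat_mem M2 aUp 0 = nat_mem M1 aUp 0 + 1"
      "frame {8, 9, 10, 11, 14, 15, 16, 17} M1 M2" unfolding adj_link_def linked_def by blast
    have "map (nat_mem M2 aUst) [0..<nat_mem M2 aUp 0] =
        map (nat_mem M1 aUst) [0..<nat_mem M1 aUp 0] @ [c]" using 2(3,4) by simp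
    then have "unioned S (E \<union> adj_link v y S) M (c # cs) M2"
      using 2 u frame_trans[OF s 2(5)] unfolding unioned_def by auto
    then show "\<exists>c. unioned S (E \<union> adj_link v y S) M (c # cs) M2" by blast
  qed simp
qed

lemma dsu_distinct: "dsu w M \<Longrightarrow> distinct (stack M)"
proof -
  have "history w p z us vs \<Longrightarrow> distinct vs" for p z us vs
    by (induction rule: history.induct) auto
  then show "dsu w M \<Longrightarrow> distinct (stack M)" unfolding dsu_def by fastforce
qed

text \<open>The four unions add the edges of \<open>v\<close> one candidate at a time, and
  \<open>adj_insert\<close> identifies the sum with the induced graph on the enlarged set. Each
  union costs \<open>44 * bits N + 200\<close>, which explains the factor 176.\<close>

lemma run_push:
  assumes d: "dsu w M" and w: "nat_mem M aW 0 = w" "0 < w"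
    and v: "nat_mem M aV 0 = v" "v \<notin> set (stack M)" "v \<noteq> 0" and N: "length (stack M) < N"
  shows "runs_in P push_com M (176 * bits N + 850) (\<lambda>M'. dsu w M' \<and>
    stack M' = stack M @ [v] \<and> nat_mem M' aVst = (nat_mem M aVst)(nat_mem M aSp 0 := v) \<and>
    nat_mem M' aSp 0 = nat_mem M aSp 0 + 1 \<and> frame {8..18} M M')"
    (is "runs_in P _ M _ ?Q")
proof -
  let ?p = "nat_mem M aPar" and ?z = "nat_mem M aSize"
  define S where "S = set (stack M)"
  define S' where "S' = insert v S"
  define us where "us = map (nat_mem M aUst) [0..<nat_mem M aUp 0]"
  have h: "history w ?p ?z (rev us) (rev (stack M))" using d by (simp add: dsu_def us_def)
  obtain r where r: "forest S (adj w \<inter> S \<times> S) ?p ?z r"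
    using history_forest[OF h] by (auto simp: S_def)
  have S: "v \<notin> S" "0 \<notin> S" using v r by (auto simp: S_def forest_def)
  have c': "card S' \<le> N"
    using N card_length[of "stack M"] S by (simp add: S'_def S_def)
  have vS': "v \<in> S'" by (simp add: S'_def)
  \<comment> \<open>The state with \<open>v\<close> isolated. \<open>history\<close> asks that
    undoing the four unions leads back to its arrays, not to those of \<open>M\<close>.\<close>
  define M1 where "M1 = M\<lparr>nat_mem := write_cell (write_cell (write_cell (write_cell
    (nat_mem M) aVst (nat_mem M aSp 0) v) aSp 0 (Suc (nat_mem M aSp 0))) aPar v v) aSize v 1\<rparr>"
  have v1: "nat_mem M1 aV 0 = v" "nat_mem M1 aW 0 = w" using v w by (simp_all add: M1_def)
  have u0: "unioned S' (adj w \<inter> S \<times> S) M1 [] M1"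
    using forest_activate[OF r S(1) v(3)] by (auto simp: unioned_def M1_def S'_def)
  let ?t = "44 * bits N + 200"
  have A: "runs_in P (NAssign aVst (Var aSp) (Var aV);; incr aSp;;
      NAssign aPar (Var aV) (Var aV);; NAssign aSize (Var aV) (NConst 1)) M 40 (\<lambda>M'. M' = M1)"
    using v(1) by (simp add: runs_in_def M1_def)
  have rn: "runs_in P (union_com e) M' ?t
    (\<lambda>M''. \<exists>cs. length cs = Suc k \<and> unioned S' (E \<union> adj_link v y S') M1 cs M'')"
    if "\<exists>cs. length cs = k \<and> unioned S' E M1 cs M'" "ncost e \<le> 5"
      "\<And>M'. frame {8, 9, 10, 11, 14, 15, 16, 17} M1 M' \<Longrightarrow> nval M' e = y" for e y E k M'
  proof -
    from that(1) obtain cs where cs: "length cs = k" "unioned S' E M1 cs M'" by blast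
    show ?thesis
    proof (rule runs_in_mono[OF run_unioned[OF cs(2) c' v1(1) vS' that(3,2)]])
      fix M'' assume "\<exists>c. unioned S' (E \<union> adj_link v y S') M1 (c # cs) M''"
      then obtain c where "unioned S' (E \<union> adj_link v y S') M1 (c # cs) M''" by blast
      then show "\<exists>cs. length cs = Suc k \<and> unioned S' (E \<union> adj_link v y S') M1 cs M''"
        using cs(1) by (intro exI[of _ "c # cs"]) simp
    qed simp_all
  qed
  have ne: "frame {8, 9, 10, 11, 14, 15, 16, 17} M1 M' \<Longrightarrow>
      nval M' (NAdd (Var aV) (NConst 1)) = v + 1 \<and> nval M' (NSub (Var aV) (NConst 1)) = v - 1 \<and>
      nval M' (NAdd (Var aV) (Var aW)) = v + w \<and> nval M' (NSub (Var aV) (Var aW)) = v - w" for M'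
    using v1 by (simp add: frame_def)
  have B: "runs_in P unions_com M1 (4 * ?t + 3)
    (\<lambda>M''. \<exists>cs. length cs = Suc (Suc (Suc (Suc 0))) \<and>
      unioned S' (adj w \<inter> S \<times> S \<union> adj_link v (v + 1) S' \<union> adj_link v (v - 1) S' \<union>
        adj_link v (v + w) S' \<union> adj_link v (v - w) S') M1 cs M'')"
    unfolding unions_com_def
    apply (rule runs_in_Seq[OF rn])
        apply (rule exI[of _ "[]"]) using u0 apply simp
       apply simp
      using ne apply blast
     apply (rule runs_in_Seq[OF rn])
         apply assumption
        apply simp
       using ne apply blast
      apply (rule runs_in_Seq[OF rn])
          apply assumption
         apply simp
        using ne apply blast
       apply (rule rn)
         apply assumption
        apply simp
       using ne apply blast
      apply (rule order_refl)
     apply (rule order_refl)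
    apply simp
    done
  show ?thesis unfolding push_com_def
  proof (rule runs_in_Seq[OF A])
    fix M' assume "M' = M1"
    show "runs_in P unions_com M' (4 * ?t + 3) ?Q" unfolding \<open>M' = M1\<close>
    proof (rule runs_in_mono[OF B])
      fix M2 assume "\<exists>cs. length cs = Suc (Suc (Suc (Suc 0))) \<and>
      unioned S' (adj w \<inter> S \<times> S \<union> adj_link v (v + 1) S' \<union> adj_link v (v - 1) S' \<union>
        adj_link v (v + w) S' \<union> adj_link v (v - w) S') M1 cs M2"
      then obtain cs where l: "length cs = Suc (Suc (Suc (Suc 0)))" and
        "unioned S' (adj w \<inter> S' \<times> S') M1 cs M2"
        using adj_insert[OF S v(3) w(2)] unfolding S'_def by auto
      then have 2: "\<exists>r. forest S' (adj w \<inter> S' \<times> S') (nat_mem M2 aPar) (nat_mem M2 aSize) r"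
        "fold undo cs (nat_mem M2 aPar, nat_mem M2 aSize) = (?p(v := v), ?z(v := 1))"
        "map (nat_mem M2 aUst) [0..<nat_mem M2 aUp 0] = us @ rev cs"
        "frame {8, 9, 10, 11, 14, 15, 16, 17} M1 M2"
        by (auto simp: unioned_def M1_def us_def)
      obtain c1 c2 c3 c4 where cs: "cs = [c4, c3, c2, c1]"
        using l by (auto simp: length_Suc_conv)
      have st: "nat_mem M2 aVst = (nat_mem M aVst)(nat_mem M aSp 0 := v)"
        "nat_mem M2 aSp 0 = nat_mem M aSp 0 + 1"
        using 2(4) by (simp_all add: frame_def M1_def)
      then have stack: "stack M2 = stack M @ [v]" by (simp add: stack_def)
      obtain r2 where r2: "forest S' (adj w \<inter> S' \<times> S') (nat_mem M2 aPar) (nat_mem M2 aSize) r2"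
        using 2(1) by blast
      have "history w (nat_mem M2 aPar) (nat_mem M2 aSize) (c4 # c3 # c2 # c1 # rev us)
          (v # rev (stack M))"
        using r2 S(1) v(3) 2(2) by (intro history_Cons[OF h]) (auto simp: S'_def S_def cs)
      then have "dsu w M2" unfolding dsu_def 2(3) stack by (simp add: cs)
      moreover have "frame {8..18} M M2"
        using 2(4) by (auto simp: frame_def M1_def)
      ultimately show "?Q M2" using stack st by blast
    qed simp
  qed simp
qed

lemma run_undo:
  "runs_in P undo_com M 40 (\<lambda>M'.
     (nat_mem M' aPar, nat_mem M' aSize) =
       undo (nat_mem M aUst (nat_mem M aUp 0 - 1)) (nat_mem M aPar, nat_mem M aSize) \<and>
     nat_mem M' aUp 0 = nat_mem M aUp 0 - 1 \<and> frame {8, 9, 11, 16} M M')"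
  by (simp add: undo_com_def runs_in_def undo_def frame_def)

text \<open>Inverting \<open>history\<close> yields the four recorded children and the earlier
  arrays \<open>p\<close> and \<open>z\<close>. Undoing the unions gives \<open>p(v := v)\<close>
  and \<open>z(v := 1)\<close>; clearing both cells gives exactly \<open>p\<close> and
  \<open>z\<close>, where the inactive \<open>v\<close> has value 0. No root is searched, so the
  cost is constant.\<close>

lemma run_pop:
  assumes d: "dsu w M" and s: "stack M = vs @ [v]"
  shows "runs_in P pop_com M 200 (\<lambda>M'. dsu w M' \<and> stack M' = vs \<and>
    nat_mem M' aVst = nat_mem M aVst \<and>
    nat_mem M' aSp 0 = nat_mem M aSp 0 - 1 \<and> frame {8, 9, 11, 13, 16} M M')"
    (is "runs_in P _ M _ ?Q")
proof -
  let ?u = "nat_mem M aUp 0" and ?U = "nat_mem M aUst"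
  have "history w (nat_mem M aPar) (nat_mem M aSize) (rev (map ?U [0..<?u])) (v # rev vs)"
    using d s by (simp add: dsu_def)
  then obtain p z us c1 c2 c3 c4 where h: "history w p z us (rev vs)" "v \<notin> set vs"
    and un: "undo c1 (undo c2 (undo c3 (undo c4 (nat_mem M aPar, nat_mem M aSize)))) =
      (p(v := v), z(v := 1))"
    and us: "rev (map ?U [0..<?u]) = c4 # c3 # c2 # c1 # us"
    by cases auto
  obtain r where r: "forest (set vs) (adj w \<inter> set vs \<times> set vs) p z r"
    using history_forest[OF h(1)] by auto
  have pv: "p v = 0" "z v = 0" using r h(2) by (auto simp: forest_def)
  have us': "map ?U [0..<?u] = rev us @ [c1, c2, c3, c4]" using arg_cong[OF us, of rev] by simp
  then have "length (map ?U [0..<?u]) = length us + 4" by simp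
  then have u: "?u = length us + 4" by simp
  have nth: "map ?U [0..<?u] ! i = ?U i" if "i < ?u" for i using that by simp
  have c: "?U (length us) = c1" "?U (length us + 1) = c2" "?U (length us + 2) = c3"
    "?U (length us + 3) = c4"
    using nth[of "length us"] nth[of "length us + 1"] nth[of "length us + 2"] nth[of "length us + 3"]
    unfolding us' by (simp_all add: u nth_append)
  have "[0..<?u] = [0..<length us] @ [length us..<?u]" using u upt_add_eq_append[of 0 "length us" 4] by simp
  then have us0: "map ?U [0..<length us] = rev us" using us' u by (simp add: upt_rec)
  have sp: "nat_mem M aSp 0 = Suc (length vs)" using arg_cong[OF s, of length] by (simp add: stack_def)
  then have vs: "map (nat_mem M aVst) [0..<length vs] = vs" "nat_mem M aVst (length vs) = v"
    using s by (simp_all add: stack_def)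
  let ?R = "\<lambda>k pz M'. (nat_mem M' aPar, nat_mem M' aSize) = pz \<and> nat_mem M' aUp 0 = length us + k \<and>
    frame {8, 9, 11, 16} M M'"
  have undo: "runs_in P undo_com M' 40 (?R k (undo (?U (length us + k)) pz))"
    if "?R (Suc k) pz M'" for k pz M'
  proof (rule runs_in_mono[OF run_undo])
    have U: "nat_mem M' aUst = ?U" using that by (simp add: frame_def)
    fix M''
    assume a: "(nat_mem M'' aPar, nat_mem M'' aSize) =
       undo (nat_mem M' aUst (nat_mem M' aUp 0 - 1)) (nat_mem M' aPar, nat_mem M' aSize) \<and>
     nat_mem M'' aUp 0 = nat_mem M' aUp 0 - 1 \<and> frame {8, 9, 11, 16} M' M''"
    have "frame {8, 9, 11, 16} M M''" using a that frame_trans by blast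
    then show "?R k (undo (?U (length us + k)) pz) M''" using a that U by simp
  qed simp
  have "runs_in P (decr aSp;; NAssign aPar (NCell aVst (Var aSp)) (NConst 0);;
     NAssign aSize (NCell aVst (Var aSp)) (NConst 0)) M' 30 ?Q"
    if R: "?R 0 (p(v := v), z(v := 1)) M'" for M'
  proof -
    have m: "nat_mem M' aVst = nat_mem M aVst" "nat_mem M' aSp 0 = Suc (length vs)"
      "nat_mem M' aUst = ?U" "nat_mem M' aPar = p(v := v)" "nat_mem M' aSize = z(v := 1)"
      "nat_mem M' aUp 0 = length us"
      using R sp by (auto simp: frame_def)
    have pz: "p(v := 0) = p" "z(v := 0) = z" using pv by (auto simp: fun_eq_iff)
    show ?thesis
      using R m vs sp h(1) us0 pz
      by (simp add: runs_in_def dsu_def stack_def frame_def)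
  qed
  then have fin: "runs_in P (decr aSp;; NAssign aPar (NCell aVst (Var aSp)) (NConst 0);;
     NAssign aSize (NCell aVst (Var aSp)) (NConst 0)) M' 30 ?Q"
    if "?R 0 (undo (?U (length us + 0)) (undo (?U (length us + 1)) (undo (?U (length us + 2))
      (undo (?U (length us + 3)) (nat_mem M aPar, nat_mem M aSize))))) M'" for M'
    using that unfolding c add_0_right un by blast
  have R0: "?R (Suc 3) (nat_mem M aPar, nat_mem M aSize) M" using u by simp
  have nums: "Suc 2 = 3" "Suc 1 = 2" "Suc 0 = 1" by simp_all
  show ?thesis unfolding pop_com_def
    apply (rule runs_in_Seq[OF undo[OF R0]])
     apply (rule runs_in_Seq[OF undo[where k = 2, unfolded nums]])
       apply assumption
      apply (rule runs_in_Seq[OF undo[where k = 1, unfolded nums]])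
        apply assumption
       apply (rule runs_in_Seq[OF undo[where k = 0, unfolded nums]])
         apply assumption
        apply (rule fin)
        apply assumption
       apply (rule order_refl)
      apply (rule order_refl)
     apply (rule order_refl)
    apply simp
    done
qed

text \<open>Both directions come from \<open>forest\<close>: every edge stays inside a class of
  \<open>r\<close>, and any two vertices of one class are connected by edges.\<close>

lemma run_connected:
  assumes d: "dsu w M" and w: "nat_mem M aW 0 = w" and N: "length (stack M) \<le> N"
    and t: "nat_mem M aT 0 = t"
  defines "S \<equiv> set (stack M)"
  shows "runs_in P connected_com M (44 * bits N + 150) (\<lambda>M'.
    nat_mem M' aConn 0 = (if w \<in> S \<and> t \<in> S \<and> (w, t) \<in> (adj w \<inter> S \<times> S)\<^sup>* then 1 else 0) \<and>
    frame {14, 15, 18} M M')" (is "runs_in P _ M _ ?Q")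
proof -
  let ?p = "nat_mem M aPar" and ?z = "nat_mem M aSize"
  have "history w ?p ?z (rev (map (nat_mem M aUst) [0..<nat_mem M aUp 0])) (rev (stack M))"
    using d by (simp add: dsu_def)
  from history_forest[OF this] obtain r where r: "forest S (adj w \<inter> S \<times> S) ?p ?z r"
    by (auto simp: S_def)
  have c: "card S \<le> N" using N card_length[of "stack M"] by (simp add: S_def)
  have 0: "r x \<noteq> 0 \<longleftrightarrow> x \<in> S" for x
  proof -
    have "x \<in> S \<Longrightarrow> r x \<in> S" "x \<notin> S \<Longrightarrow> r x = 0" "0 \<notin> S" using r by (simp_all add: forest_def)
    then show ?thesis by metis
  qed
  have edge: "r a = r b" if "(a, b) \<in> adj w \<inter> S \<times> S" for a b
    using r that unfolding forest_def by blast
  have "r a = r b" if "(a, b) \<in> (adj w \<inter> S \<times> S)\<^sup>*" for a b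
    using that by (induction rule: rtrancl_induct) (metis edge)+
  moreover have "(a, b) \<in> (adj w \<inter> S \<times> S)\<^sup>*" if "a \<in> S" "b \<in> S" "r a = r b" for a b
    using r that unfolding forest_def by blast
  ultimately have iff: "(w \<in> S \<and> t \<in> S \<and> (w, t) \<in> (adj w \<inter> S \<times> S)\<^sup>*) \<longleftrightarrow> r t \<noteq> 0 \<and> r t = r w"
    using 0 by metis
  let ?F = "\<lambda>M'. nat_mem M' aConn 0 = (if r t \<noteq> 0 \<and> r t = r w then 1 else 0) \<and>
    frame {14, 15, 18} M M'"
  show ?thesis unfolding connected_com_def iff
  proof (rule runs_in_Seq[OF run_root[OF r c, where y = w]])
    fix M1 assume 1: "nat_mem M1 aX 0 = r w \<and> frame {aX} M M1"
    show "runs_in P (assign aRoot (Var aX);; root_com (Var aT);;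
       Cond (BAnd (NLess (NConst 0) (Var aX)) (NEq (Var aX) (Var aRoot)))
       (assign aConn (NConst 1)) (assign aConn (NConst 0))) M1 (22 * bits N + 99)
       ?F"
    proof (rule runs_in_Seq[of _ _ _ 4 "\<lambda>M2. nat_mem M2 aRoot 0 = r w \<and> frame {aX, aRoot} M M2"])
      show "runs_in P (assign aRoot (Var aX)) M1 4
          (\<lambda>M2. nat_mem M2 aRoot 0 = r w \<and> frame {aX, aRoot} M M2)"
        using 1 by (simp add: runs_in_def frame_def)
      fix M2 assume 2: "nat_mem M2 aRoot 0 = r w \<and> frame {aX, aRoot} M M2"
      then have m: "nat_mem M2 aPar = ?p" "nat_mem M2 aSize = ?z" "nat_mem M2 aT 0 = t"
        using t by (simp_all add: frame_def)
      show "runs_in P (root_com (Var aT);;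
       Cond (BAnd (NLess (NConst 0) (Var aX)) (NEq (Var aX) (Var aRoot)))
       (assign aConn (NConst 1)) (assign aConn (NConst 0))) M2 (22 * bits N + 94)
       ?F"
      proof (rule runs_in_Seq[OF run_root[OF _ c, where y = t and E = "adj w \<inter> S \<times> S" and r = r]])
        show "forest S (adj w \<inter> S \<times> S) (nat_mem M2 aPar) (nat_mem M2 aSize) r" using r m by simp
        fix M3 assume 3: "nat_mem M3 aX 0 = r t \<and> frame {aX} M2 M3"
        then have 33: "nat_mem M3 aRoot 0 = r w" using 2 by (simp add: frame_def)
        show "runs_in P (Cond (BAnd (NLess (NConst 0) (Var aX)) (NEq (Var aX) (Var aRoot)))
         (assign aConn (NConst 1)) (assign aConn (NConst 0))) M3 30
         ?F"
          using 2 3 33 by (auto simp add: runs_in_def frame_def)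
      qed (use m in simp_all)
    qed simp
  qed (use w in simp_all)
qed

section \<open>The divide and conquer search\<close>

abbreviation (input) "aN \<equiv> 4 :: nat"
abbreviation (input) "aOrd \<equiv> 5 :: nat"
abbreviation (input) "aHalf \<equiv> 6 :: nat"
abbreviation (input) "aTH \<equiv> 20 :: nat"
abbreviation (input) "aTX \<equiv> 21 :: nat"
abbreviation (input) "aTY \<equiv> 22 :: nat"
abbreviation (input) "aTLa \<equiv> 23 :: nat"
abbreviation (input) "aTLb \<equiv> 24 :: nat"
abbreviation (input) "aTRa \<equiv> 25 :: nat"
abbreviation (input) "aTRb \<equiv> 26 :: nat"
abbreviation (input) "aTp \<equiv> 27 :: nat"
abbreviation (input) "aH \<equiv> 28 :: nat"
abbreviation (input) "aLo \<equiv> 29 :: nat"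
abbreviation (input) "aHi \<equiv> 30 :: nat"
abbreviation (input) "aLa \<equiv> 31 :: nat"
abbreviation (input) "aLb \<equiv> 32 :: nat"
abbreviation (input) "aRa \<equiv> 33 :: nat"
abbreviation (input) "aRb \<equiv> 34 :: nat"
abbreviation (input) "aMid \<equiv> 35 :: nat"
abbreviation (input) "aR \<equiv> 36 :: nat"

text \<open>What the search relies on and never changes. The table \<open>aHalf\<close> supplies the
  midpoints, since naturals cannot be divided; the keys are stored under the code of a position, not
  under its rank.\<close>

definition prepared ::
  "nat \<Rightarrow> nat \<Rightarrow> nat \<Rightarrow> (nat \<Rightarrow> nat) \<Rightarrow> (nat \<Rightarrow> real) \<Rightarrow> ram_state \<Rightarrow> bool" where
  "prepared w t N ord key M \<longleftrightarrow>
     nat_mem M aW 0 = w \<and> nat_mem M aT 0 = t \<and> nat_mem M aN 0 = N \<and>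
     (\<forall>i<N. nat_mem M aOrd i = ord i) \<and> (\<forall>i\<le>N. nat_mem M aHalf i = i div 2) \<and>
     (\<forall>i<N. real_mem M 1 (ord i) = key (ord i))"

lemma prepared_cong:
  assumes "\<And>k. k \<in> {2, 3, 4, 5, 6} \<Longrightarrow> nat_mem M' k = nat_mem M k" "real_mem M' 1 = real_mem M 1"
  shows "prepared w t N ord key M' \<longleftrightarrow> prepared w t N ord key M"
  using assms by (simp add: prepared_def)

text \<open>
  A task \<open>(h, x, y, la, lb, ra, rb)\<close> asks for the values of \<open>reach\<close> on \<open>{la..<lb}\<close>, which are
  known to lie in \<open>{ra..rb}\<close>. It starts by rolling the union-find structure back to its first \<open>h\<close>
  vertices and then activating the vertices with sorted indices in \<open>{x..<y}\<close>; this leaves exactly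
  those in \<open>{lb..<ra}\<close> active, which belong to every window of the task.
\<close>

type_synonym task = "nat \<times> nat \<times> nat \<times> nat \<times> nat \<times> nat \<times> nat"

definition tasks :: "ram_state \<Rightarrow> task list" where
  "tasks M = map (\<lambda>k. (nat_mem M aTH k, nat_mem M aTX k, nat_mem M aTY k, nat_mem M aTLa k,
     nat_mem M aTLb k, nat_mem M aTRa k, nat_mem M aTRb k)) [0..<nat_mem M aTp 0]"

definition locals :: "ram_state \<Rightarrow> task" where
  "locals M = (nat_mem M aH 0, nat_mem M aLo 0, nat_mem M aHi 0, nat_mem M aLa 0,
     nat_mem M aLb 0, nat_mem M aRa 0, nat_mem M aRb 0)"

lemma tasks_cong:
  assumes "\<And>k. k \<in> {20..27} \<Longrightarrow> nat_mem M' k = nat_mem M k"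
  shows "tasks M' = tasks M"
  using assms by (simp add: tasks_def)

definition push_range_com :: com where
  "push_range_com = While (NLess (Var aLo) (Var aHi))
     (assign aV (NCell aOrd (Var aLo));; push_com;; incr aLo)"

definition rollback_com :: com where
  "rollback_com = While (NLess (Var aH) (Var aSp)) pop_com"

definition load_task_com :: com where
  "load_task_com = decr aTp;;
     assign aH (NCell aTH (Var aTp));; assign aLo (NCell aTX (Var aTp));;
     assign aHi (NCell aTY (Var aTp));; assign aLa (NCell aTLa (Var aTp));;
     assign aLb (NCell aTLb (Var aTp));; assign aRa (NCell aTRa (Var aTp));;
     assign aRb (NCell aTRb (Var aTp))"

text \<open>Truncated subtraction computes the extrema: \<open>lb - (lb - ra)\<close> is
  \<open>min lb ra\<close> and \<open>ra + (mid - ra)\<close> is \<open>max ra mid\<close>.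
  Activating \<open>{mid..<min lb ra}\<close> on top of \<open>{lb..<ra}\<close> leaves exactly the
  window from \<open>mid\<close> to \<open>max ra mid\<close>.\<close>

definition middle_com :: com where
  "middle_com = assign aMid (NAdd (Var aLa) (NCell aHalf (NSub (Var aLb) (Var aLa))));;
     assign aLo (Var aMid);; assign aHi (NSub (Var aLb) (NSub (Var aLb) (Var aRa)));;
     assign aR (NAdd (Var aRa) (NSub (Var aMid) (Var aRa)))"

definition extend_com :: com where
  "extend_com = While (BAnd (NLess (Var aR) (Var aRb)) (NEq (Var aConn) (NConst 0)))
     (assign aV (NCell aOrd (Var aR));; push_com;; incr aR;; connected_com)"

definition store_task_com :: "nat \<Rightarrow> nat \<Rightarrow> nat \<Rightarrow> nat \<Rightarrow> nat \<Rightarrow> nat \<Rightarrow> com" where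
  "store_task_com x y la lb ra rb =
     NAssign aTH (Var aTp) (Var aH);; NAssign aTX (Var aTp) (Var x);;
     NAssign aTY (Var aTp) (Var y);; NAssign aTLa (Var aTp) (Var la);;
     NAssign aTLb (Var aTp) (Var lb);; NAssign aTRa (Var aTp) (Var ra);;
     NAssign aTRb (Var aTp) (Var rb);; incr aTp"

text \<open>Both halves get the same height \<open>aH\<close>, taken when just the common part of
  the parent was active, and differ in the range that they add to it. What was activated for the
  middle left end alone is discarded by the rollback of the half that runs next.\<close>

definition store_tasks_com :: com where
  "store_tasks_com = store_task_com aMid aHi aLa aMid aRa aR;;
     (assign aLo (NAdd (Var aLb) (NSub (Var aRa) (Var aLb)));; assign aLa (NAdd (Var aMid) (NConst 1)));;
     store_task_com aLo aR aLa aLb aR aRb"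

definition split_com :: "com \<Rightarrow> com" where
  "split_com record_com = middle_com;; push_range_com;; connected_com;; extend_com;;
     Cond (NLess (NConst 0) (Var aConn)) record_com Skip;; store_tasks_com"

definition process_com :: "com \<Rightarrow> com" where
  "process_com record_com = load_task_com;; rollback_com;; push_range_com;; assign aH (Var aSp);;
     Cond (NLess (Var aLa) (Var aLb)) (split_com record_com) Skip"

definition first_task_com :: com where
  "first_task_com = NAssign aTH (NConst 0) (NConst 0);; NAssign aTX (NConst 0) (NConst 0);;
     NAssign aTY (NConst 0) (NConst 0);; NAssign aTLa (NConst 0) (NConst 0);;
     NAssign aTLb (NConst 0) (Var aN);; NAssign aTRa (NConst 0) (NConst 0);;
     NAssign aTRb (NConst 0) (Var aN);; assign aTp (NConst 1)"

definition search_com :: "com \<Rightarrow> com" where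
  "search_com record_com =
     first_task_com;;
     While (NLess (NConst 0) (Var aTp)) (process_com record_com)"

text \<open>Gap and ratio share the search: \<open>g\<close> values a window by its extreme keys,
  and \<open>record_com\<close> takes the minimum of that value and the result so far. The parameter
  \<open>w\<close> is both the row width and the start vertex.\<close>

locale window_search =
  fixes P :: "'a::euclidean_space list" and w t N :: nat and ord :: "nat \<Rightarrow> nat"
    and key :: "nat \<Rightarrow> real" and g :: "real \<Rightarrow> real \<Rightarrow> ereal" and record_com :: com
  assumes w_pos: "0 < w" and ord_inj: "inj_on ord {..<N}" and ord_pos: "i < N \<Longrightarrow> ord i \<noteq> 0"
    and run_record: "prepared w t N ord key M \<Longrightarrow> nat_mem M aMid 0 = l \<Longrightarrow> nat_mem M aR 0 = Suc r \<Longrightarrow>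
      l < N \<Longrightarrow> r < N \<Longrightarrow> runs_in P record_com M 100 (\<lambda>M'.
        result M' = min (result M) (g (key (ord l)) (key (ord r))) \<and>
        (\<forall>k. k \<noteq> 1 \<longrightarrow> nat_mem M' k = nat_mem M k) \<and> real_mem M' 1 = real_mem M 1)"
begin

section \<open>Windows of the sorted order and the activation of index ranges\<close>

abbreviation ready :: "ram_state \<Rightarrow> bool" where "ready \<equiv> prepared w t N ord key"

definition window :: "nat \<Rightarrow> nat \<Rightarrow> nat set" where
  "window l r = ord ` {l..<r}"

definition joins :: "nat \<Rightarrow> nat \<Rightarrow> bool" where
  "joins l r \<longleftrightarrow> w \<in> window l r \<and> t \<in> window l r \<and>
     (w, t) \<in> (adj w \<inter> window l r \<times> window l r)\<^sup>*"

text \<open>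
  The value \<open>N\<close> also stands for left ends from which no window joins \<open>w\<close> and \<open>t\<close>; this keeps
  \<open>reach\<close> monotone.
\<close>

definition reach :: "nat \<Rightarrow> nat" where
  "reach l = (LEAST r. joins l r \<or> N \<le> r)"

text \<open>Windows are half-open, so \<open>reach l - 1\<close> is the last index inside.\<close>

definition candidate :: "nat \<Rightarrow> ereal" where
  "candidate l = (if joins l (reach l) then g (key (ord l)) (key (ord (reach l - 1))) else \<infinity>)"

lemma joins_mono:
  assumes "joins l r" "l' \<le> l" "r \<le> r'"
  shows "joins l' r'"
proof -
  have "window l r \<subseteq> window l' r'" using assms unfolding window_def by (intro image_mono) auto
  moreover from this have "(adj w \<inter> window l r \<times> window l r)\<^sup>* \<subseteq> (adj w \<inter> window l' r' \<times> window l' r')\<^sup>*"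
    by (intro rtrancl_mono) blast
  ultimately show ?thesis using assms(1) unfolding joins_def by blast
qed

lemma joins_less: "joins l r \<Longrightarrow> l < r"
  by (auto simp: joins_def window_def)

lemma reach_cases: "joins l (reach l) \<or> reach l = N" and reach_le: "reach l \<le> N"
  and reach_least: "joins l r \<Longrightarrow> reach l \<le> r"
proof -
  show le: "reach l \<le> N" unfolding reach_def by (rule Least_le) simp
  have "joins l (reach l) \<or> N \<le> reach l" unfolding reach_def by (rule LeastI[of _ N]) simp
  then show "joins l (reach l) \<or> reach l = N" using le by auto
  show "joins l r \<Longrightarrow> reach l \<le> r" unfolding reach_def by (rule Least_le) simp
qed

text \<open>A window joining from \<open>l'\<close> still joins when its left end moves down to
  \<open>l\<close>; if no window joins from \<open>l'\<close>, then \<open>reach l'\<close> is the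
  largest possible value \<open>N\<close>.\<close>

lemma reach_mono: "l \<le> l' \<Longrightarrow> reach l \<le> reach l'"
  using reach_cases[of l'] reach_le[of l] reach_least[of l "reach l'"] joins_mono[of l' "reach l'" l]
  by auto

lemma le_reach: "l \<le> N \<Longrightarrow> l \<le> reach l"
  using reach_cases[of l] joins_less[of l "reach l"] by auto

text \<open>Covers the dearest elementary action of the search, activating one vertex and testing
  connectivity (176 + 44 = 220), and a fortiori removing one. Below, costs are counted in these
  units.\<close>

definition unit :: nat where
  "unit = 220 * bits N + 1100"

lemma ready_frame:
  "frame K M M' \<Longrightarrow> K \<inter> {2, 3, 4, 5, 6} = {} \<Longrightarrow> ready M' \<longleftrightarrow> ready M"
  by (intro prepared_cong) (auto simp: frame_def)

text \<open>Since \<open>ord\<close> is injective, an index outside \<open>A\<close> belongs to an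
  inactive vertex; and since \<open>A\<close> misses \<open>i\<close>, fewer than \<open>N\<close>
  vertices are active.\<close>

lemma run_push_ord:
  assumes r: "ready M" and d: "dsu w M" and s: "set (stack M) = ord ` A" "A \<subseteq> {..<N}"
    and i: "i < N" "i \<notin> A" "nval M e = i" and ce: "ncost e \<le> 5"
  shows "runs_in P (assign aV (NCell aOrd e);; push_com) M (176 * bits N + 860)
    (\<lambda>M'. dsu w M' \<and> stack M' = stack M @ [ord i] \<and> frame {8..19} M M')"
    (is "runs_in _ _ _ _ ?Q")
proof (rule runs_in_Seq)
  let ?M' = "M\<lparr>nat_mem := write_cell (nat_mem M) aV 0 (ord i)\<rparr>"
  show "runs_in P (assign aV (NCell aOrd e)) M 8 (\<lambda>M'. M' = ?M')"
    using r i ce by (simp add: runs_in_def prepared_def)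
  have se: "frame {aV} M ?M'" by (simp add: frame_def)
  have st: "stack ?M' = stack M" by (rule stack_cong[OF se]) simp_all
  have "ord i \<notin> ord ` A" using ord_inj s(2) i by (auto dest: inj_onD)
  moreover have "length (stack M) < N"
  proof -
    have "length (stack M) = card (ord ` A)" using dsu_distinct[OF d] s(1) by (metis distinct_card)
    also have "\<dots> \<le> card A" by (rule card_image_le) (use s(2) finite_subset in blast)
    also have "\<dots> < card {..<N}" using s(2) i by (intro psubset_card_mono) auto
    finally show ?thesis by simp
  qed
  moreover have "dsu w ?M'" using dsu_cong[OF se, of w] d by simp
  moreover have "nat_mem M aW 0 = w" using r by (simp add: prepared_def)
  ultimately have "runs_in P push_com ?M' (176 * bits N + 850) (\<lambda>M''. dsu w M'' \<and>
    stack M'' = stack ?M' @ [ord i] \<and> nat_mem M'' aVst = (nat_mem ?M' aVst)(nat_mem ?M' aSp 0 := ord i) \<and>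
    nat_mem M'' aSp 0 = nat_mem ?M' aSp 0 + 1 \<and> frame {8..18} ?M' M'')"
    using s(1) ord_pos[OF i(1)] w_pos st by (intro run_push) simp_all
  then have "runs_in P push_com ?M' (176 * bits N + 850)
    ?Q"
    by (rule runs_in_mono) (auto simp: st frame_def)
  then show "runs_in P push_com M' (176 * bits N + 850)
    ?Q"
    if "M' = ?M'" for M' using that by simp
qed simp

lemma runs_in_assoc:
  "runs_in P (a;; b;; c) M t' Q \<longleftrightarrow> runs_in P ((a;; b);; c) M t' Q"
  by (simp add: runs_in_def add.assoc)

lemma run_push_range:
  assumes r: "ready M" and d: "dsu w M" and s: "set (stack M) = ord ` A" "A \<subseteq> {..<N}"
    and xy: "nat_mem M aLo 0 = x" "nat_mem M aHi 0 = y" "y \<le> N" "A \<inter> {x..<y} = {}"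
  shows "runs_in P push_range_com M (unit * (y - x) + 6)
    (\<lambda>M'. dsu w M' \<and> stack M' = stack M @ map ord [x..<y] \<and> frame ({8..19} \<union> {29}) M M')"
    (is "runs_in _ _ _ _ ?Q")
proof -
  \<comment> \<open>The alternative \<open>z = x\<close> covers an empty range with \<open>x\<close>
    above \<open>y\<close>, which tasks do produce.\<close>
  let ?I = "\<lambda>M'. \<exists>z. dsu w M' \<and> stack M' = stack M @ map ord [x..<z] \<and> nat_mem M' aLo 0 = z \<and>
      (z = x \<or> x \<le> z \<and> z \<le> y) \<and> frame ({8..19} \<union> {29}) M M'"
  have I0: "?I M" using xy d by simp
  show ?thesis unfolding push_range_com_def
  proof (rule runs_in_mono[OF runs_in_While[where I = ?I and
      m = "\<lambda>M'. unit * (y - nat_mem M' aLo 0)", OF I0]])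
    fix M' assume "?I M'" and b: "bval P M' (NLess (Var aLo) (Var aHi))"
    then obtain z where z: "dsu w M'" "stack M' = stack M @ map ord [x..<z]" "nat_mem M' aLo 0 = z"
      "z = x \<or> x \<le> z \<and> z \<le> y" "frame ({8..19} \<union> {29}) M M'" by blast
    have zy: "z < y" using b z(3,5) xy(2) by (simp add: frame_def)
    have "ready M'" using ready_frame[OF z(5)] r by auto
    moreover have "set (stack M') = ord ` (A \<union> {x..<z})" unfolding z(2) using s(1) by auto
    moreover have "A \<union> {x..<z} \<subseteq> {..<N}" using s(2) zy xy(3) by auto
    moreover have "z \<notin> A \<union> {x..<z}" using xy(4) zy z(4) by auto
    ultimately have "runs_in P (assign aV (NCell aOrd (Var aLo));; push_com) M' (176 * bits N + 860)
      (\<lambda>M''. dsu w M'' \<and> stack M'' = stack M' @ [ord z] \<and> frame {8..19} M' M'')"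
      using z zy xy(3) by (intro run_push_ord[where A = "A \<union> {x..<z}"]) simp_all
    then have "runs_in P ((assign aV (NCell aOrd (Var aLo));; push_com);; incr aLo) M' (176 * bits N + 867)
      (\<lambda>M''. ?I M'' \<and> unit * (y - nat_mem M'' aLo 0) + (176 * bits N + 867) + bcost (NLess (Var aLo) (Var aHi)) + 1
         \<le> unit * (y - nat_mem M' aLo 0))"
    proof (rule runs_in_Seq)
      fix M2 assume 2: "dsu w M2 \<and> stack M2 = stack M' @ [ord z] \<and> frame {8..19} M' M2"
      let ?M3 = "M2\<lparr>nat_mem := write_cell (nat_mem M2) aLo 0 (Suc z)\<rparr>"
      have zz: "nat_mem M2 aLo 0 = z" using 2 z(3) by (simp add: frame_def)
      have se: "frame {29} M2 ?M3" by (simp add: frame_def)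
      have d3: "dsu w ?M3" using dsu_cong[OF se, of w] 2 by simp
      have st3: "stack ?M3 = stack M @ map ord [x..<Suc z]"
        using stack_cong[OF se] 2 z(2,4) by auto
      have se3: "frame ({8..19} \<union> {29}) M ?M3" using z(5) 2 by (simp add: frame_def)
      have "?I ?M3" using d3 st3 se3 zy z(4) by (intro exI[of _ "Suc z"]) auto
      moreover have "unit * (y - Suc z) + (176 * bits N + 867) + 6 \<le> unit * (y - z)"
      proof -
        have "y - z = Suc (y - Suc z)" using zy by simp
        then show ?thesis by (simp add: unit_def)
      qed
      ultimately show "runs_in P (incr aLo) M2 6 (\<lambda>M''. ?I M'' \<and>
         unit * (y - nat_mem M'' aLo 0) + (176 * bits N + 867) + bcost (NLess (Var aLo) (Var aHi)) + 1
         \<le> unit * (y - nat_mem M' aLo 0))"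
        using zz z(3) by (simp add: runs_in_def del: ex_simps)
    qed simp
    then show "\<exists>t. runs_in P (assign aV (NCell aOrd (Var aLo));; push_com;; incr aLo) M' t
      (\<lambda>M''. ?I M'' \<and> unit * (y - nat_mem M'' aLo 0) + t + bcost (NLess (Var aLo) (Var aHi)) + 1
         \<le> unit * (y - nat_mem M' aLo 0))" unfolding runs_in_assoc by blast
  next
    fix M' assume a: "?I M' \<and> \<not> bval P M' (NLess (Var aLo) (Var aHi))"
    then obtain z where z: "dsu w M'" "stack M' = stack M @ map ord [x..<z]" "nat_mem M' aLo 0 = z"
      "z = x \<or> x \<le> z \<and> z \<le> y" "frame ({8..19} \<union> {29}) M M'" by blast
    have "y \<le> z" using a z(3,5) xy(2) by (auto simp: frame_def)
    then have "[x..<z] = [x..<y]" using z(4) by auto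
    then show "?Q M'"
      using z by simp
  qed (use xy in simp)
qed

lemma run_rollback:
  assumes d: "dsu w M" and h: "nat_mem M aH 0 = h" "h \<le> length (stack M)"
  shows "runs_in P rollback_com M (unit * (length (stack M) - h) + 6)
    (\<lambda>M'. dsu w M' \<and> stack M' = take h (stack M) \<and> frame {8..18} M M')"
    (is "runs_in _ _ _ _ ?Q")
proof -
  have sp: "nat_mem M' aSp 0 = length (stack M')" for M' by (simp add: stack_def)
  let ?I = "\<lambda>M'. dsu w M' \<and> h \<le> length (stack M') \<and> stack M' = take (length (stack M')) (stack M) \<and>
     frame {8..18} M M'"
  have I0: "?I M" using d h by simp
  show ?thesis unfolding rollback_com_def
  proof (rule runs_in_mono[OF runs_in_While[where I = ?I and
      m = "\<lambda>M'. unit * (length (stack M') - h)", OF I0]])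
    fix M' assume I: "?I M'" and b: "bval P M' (NLess (Var aH) (Var aSp))"
    have hl: "h < length (stack M')" using b I h(1) by (simp add: frame_def sp)
    then obtain vs v where vs: "stack M' = vs @ [v]" by (metis append_butlast_last_id list.size(3) not_less0)
    have "runs_in P pop_com M' 200 (\<lambda>M''. ?I M'' \<and>
        unit * (length (stack M'') - h) + 200 + bcost (NLess (Var aH) (Var aSp)) + 1
          \<le> unit * (length (stack M') - h))"
    proof (rule runs_in_mono[OF run_pop[OF conjunct1[OF I] vs]])
      fix M'' assume a: "dsu w M'' \<and> stack M'' = vs \<and> nat_mem M'' aVst = nat_mem M' aVst \<and>
        nat_mem M'' aSp 0 = nat_mem M' aSp 0 - 1 \<and> frame {8, 9, 11, 13, 16} M' M''"
      have "vs = take (length vs) (stack M)"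
        using I vs by (metis append_eq_conv_conj length_append_singleton take_take min.absorb1 le_SucI order_refl)
      moreover have "frame {8..18} M M''" using a I by (auto simp: frame_def)
      moreover have "h \<le> length vs" using hl vs by simp
      moreover from this have "length (stack M') - h = Suc (length vs - h)" using vs by simp
      ultimately show "?I M'' \<and>
        unit * (length (stack M'') - h) + 200 + bcost (NLess (Var aH) (Var aSp)) + 1
          \<le> unit * (length (stack M') - h)" using a by (simp add: unit_def)
    qed simp
    then show "\<exists>t. runs_in P pop_com M' t (\<lambda>M''. ?I M'' \<and>
        unit * (length (stack M'') - h) + t + bcost (NLess (Var aH) (Var aSp)) + 1
          \<le> unit * (length (stack M') - h))" by blast
  next
    fix M' assume a: "?I M' \<and> \<not> bval P M' (NLess (Var aH) (Var aSp))"
    then have "length (stack M') = h" using h(1) by (auto simp: frame_def sp)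
    then show "?Q M'" using a by metis
  qed simp
qed

lemma run_joins:
  assumes r: "ready M" and d: "dsu w M" and s: "set (stack M) = window l r" and rN: "r \<le> N"
  shows "runs_in P connected_com M (44 * bits N + 150) (\<lambda>M'.
    nat_mem M' aConn 0 = (if joins l r then 1 else 0) \<and> frame {14, 15, 18} M M')"
proof -
  have "length (stack M) = card (window l r)" using dsu_distinct[OF d] s by (metis distinct_card)
  also have "\<dots> \<le> card {l..<r}" unfolding window_def by (rule card_image_le) simp
  finally have "length (stack M) \<le> N" using rN by simp
  then show ?thesis
    using run_connected[OF d, of N t P] r unfolding joins_def s by (simp add: prepared_def)
qed

text \<open>The scan starts at or below \<open>reach l\<close>, and nothing joins before
  \<open>reach l\<close>. So it halts exactly there: by success, or at the bound \<open>b\<close>,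
  which is at least \<open>reach l\<close>.\<close>

lemma run_extend:
  assumes r: "ready M" and d: "dsu w M" and s: "set (stack M) = window l a"
    and a: "nat_mem M aR 0 = a" "nat_mem M aRb 0 = b" "nat_mem M aConn 0 = (if joins l a then 1 else 0)"
    and ab: "l \<le> a" "a \<le> reach l" "reach l \<le> b" "b \<le> N"
  shows "runs_in P extend_com M (unit * (b - a) + 20)
    (\<lambda>M'. dsu w M' \<and> stack M' = stack M @ map ord [a..<reach l] \<and> nat_mem M' aR 0 = reach l \<and>
      nat_mem M' aConn 0 = (if joins l (reach l) then 1 else 0) \<and> frame ({8..19} \<union> {36}) M M')"
proof -
  let ?b = "BAnd (NLess (Var aR) (Var aRb)) (NEq (Var aConn) (NConst 0))"
  let ?I = "\<lambda>M'. \<exists>z. dsu w M' \<and> stack M' = stack M @ map ord [a..<z] \<and> nat_mem M' aR 0 = z \<and>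
      a \<le> z \<and> z \<le> reach l \<and> nat_mem M' aConn 0 = (if joins l z then 1 else 0) \<and>
      frame ({8..19} \<union> {36}) M M'"
  have I0: "?I M" using a ab d by simp
  show ?thesis unfolding extend_com_def
  proof (rule runs_in_mono[OF runs_in_While[where I = ?I and
      m = "\<lambda>M'. unit * (b - nat_mem M' aR 0)", OF I0]])
    fix M' assume "?I M'" and b: "bval P M' ?b"
    then obtain z where z: "dsu w M'" "stack M' = stack M @ map ord [a..<z]" "nat_mem M' aR 0 = z"
      "a \<le> z" "z \<le> reach l" "nat_mem M' aConn 0 = (if joins l z then 1 else 0)"
      "frame ({8..19} \<union> {36}) M M'" by blast
    have zb: "z < b" and nj: "\<not> joins l z"
      using b z(3,6,7) a(2) by (auto simp add: frame_def split: if_splits)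
    \<comment> \<open>If \<open>z\<close> were \<open>reach l\<close> without joining, it would be
      \<open>N\<close>, contrary to \<open>z < b\<close> and \<open>b \<le> N\<close>.\<close>
    have zr: "z < reach l" using reach_cases[of l] nj zb ab(4) z(5) by (metis le_neq_implies_less not_less)
    have rd: "ready M'" using ready_frame[OF z(7)] r by auto
    have set: "set (stack M') = ord ` {l..<z}" unfolding z(2) using s ab(1) z(4)
      by (auto simp: window_def image_Un[symmetric] ivl_disj_un)
    have "runs_in P (assign aV (NCell aOrd (Var aR));; push_com) M' (176 * bits N + 860)
      (\<lambda>M''. dsu w M'' \<and> stack M'' = stack M' @ [ord z] \<and> frame {8..19} M' M'')"
      using z zb ab(4) by (intro run_push_ord[OF rd z(1) set]) auto
    then have "runs_in P ((assign aV (NCell aOrd (Var aR));; push_com);; incr aR;; connected_com) M' (unit - 30)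
      (\<lambda>M''. ?I M'' \<and> unit * (b - nat_mem M'' aR 0) + (unit - 30) + bcost ?b + 1
         \<le> unit * (b - nat_mem M' aR 0))" (is "runs_in _ _ _ _ ?Q")
    proof (rule runs_in_Seq)
      fix M2 assume 2: "dsu w M2 \<and> stack M2 = stack M' @ [ord z] \<and> frame {8..19} M' M2"
      let ?M3 = "M2\<lparr>nat_mem := write_cell (nat_mem M2) aR 0 (Suc z)\<rparr>"
      have zz: "nat_mem M2 aR 0 = z" using 2 z(3) by (simp add: frame_def)
      have se: "frame {36} M2 ?M3" by (simp add: frame_def)
      have d3: "dsu w ?M3" using dsu_cong[OF se, of w] 2 by simp
      have st3: "stack ?M3 = stack M @ map ord [a..<Suc z]"
        using stack_cong[OF se] 2 z(2,4) by auto
      have se3: "frame ({8..19} \<union> {36}) M ?M3" using z(7) 2 by (simp add: frame_def)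
      have r3: "ready ?M3" using ready_frame[OF se3] r by auto
      have "set (stack ?M3) = insert (ord z) (set (stack M'))" unfolding st3 z(2) using z(4) by auto
      then have w3: "set (stack ?M3) = window l (Suc z)" unfolding set using ab(1) z(4)
        by (simp add: window_def atLeastLessThanSuc)
      show "runs_in P (incr aR;; connected_com) M2 (44 * bits N + 160) ?Q"
      proof (rule runs_in_Seq)
        show "runs_in P (incr aR) M2 6 (\<lambda>M'. M' = ?M3)" using zz by (simp add: runs_in_def)
        show "runs_in P connected_com M4 (44 * bits N + 150) ?Q" if "M4 = ?M3" for M4 unfolding that
        proof (rule runs_in_mono[OF run_joins[OF r3 d3 w3]])
          fix M5 assume 5: "nat_mem M5 aConn 0 = (if joins l (Suc z) then 1 else 0) \<and> frame {14, 15, 18} ?M3 M5"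
          then have se5: "frame {14, 15, 18} ?M3 M5" by blast
          have d5: "dsu w M5" using dsu_cong[OF se5, of w] d3 by simp
          have st5: "stack M5 = stack M @ map ord [a..<Suc z]" using stack_cong[OF se5] st3 by simp
          have R5: "nat_mem M5 aR 0 = Suc z" using se5 by (simp add: frame_def)
          have se': "frame ({8..19} \<union> {36}) M M5" using se3 se5 by (auto simp: frame_def)
          have "?I M5" using d5 st5 R5 se' 5 z(4) zr by (intro exI[of _ "Suc z"]) auto
          moreover have "unit * (b - Suc z) + (unit - 30) + 17 + 1 \<le> unit * (b - z)"
          proof -
            have "b - z = Suc (b - Suc z)" using zb by simp
            then show ?thesis by (simp add: unit_def)
          qed
          ultimately show "?Q M5" using R5 z(3) by simp
        qed (use zb ab in simp_all)
      qed simp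
    qed (simp add: unit_def)
    then show "\<exists>t. runs_in P (assign aV (NCell aOrd (Var aR));; push_com;; incr aR;; connected_com) M' t
      (\<lambda>M''. ?I M'' \<and> unit * (b - nat_mem M'' aR 0) + t + bcost ?b + 1
         \<le> unit * (b - nat_mem M' aR 0))" unfolding runs_in_assoc by blast
  next
    fix M' assume x: "?I M' \<and> \<not> bval P M' ?b"
    then obtain z where z: "dsu w M'" "stack M' = stack M @ map ord [a..<z]" "nat_mem M' aR 0 = z"
      "a \<le> z" "z \<le> reach l" "nat_mem M' aConn 0 = (if joins l z then 1 else 0)"
      "frame ({8..19} \<union> {36}) M M'" by blast
    have "b \<le> z \<or> joins l z"
      using x z(3,6,7) a(2) by (auto simp add: frame_def split: if_splits)
    then have "z = reach l" using z(5) ab(3) reach_least[of l z] by auto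
    then show "dsu w M' \<and> stack M' = stack M @ map ord [a..<reach l] \<and> nat_mem M' aR 0 = reach l \<and>
      nat_mem M' aConn 0 = (if joins l (reach l) then 1 else 0) \<and> frame ({8..19} \<union> {36}) M M'"
      using z by simp
  qed (use a in simp)
qed


end

context window_search
begin

section \<open>One step of the recursion\<close>

lemma run_load_task:
  assumes "tasks M = ts @ [k]"
  shows "runs_in P load_task_com M 70 (\<lambda>M'. tasks M' = ts \<and> locals M' = k \<and>
    frame {27, 28, 29, 30, 31, 32, 33, 34} M M')"
proof -
  have tp: "nat_mem M aTp 0 = Suc (length ts)"
    using arg_cong[OF assms, of length] by (simp add: tasks_def)
  then show ?thesis
    using assms apply (simp add: load_task_com_def runs_in_def cong: runs_weak_cong)
    apply (simp add: tasks_def locals_def)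
    apply (simp add: frame_def)
    done
qed

lemma run_middle:
  assumes "ready M" "locals M = (h, x, y, la, lb, ra, rb)" "la < lb" "lb \<le> N"
  defines "mid \<equiv> la + (lb - la) div 2"
  shows "runs_in P middle_com M 60 (\<lambda>M'. locals M' = (h, mid, min lb ra, la, lb, ra, rb) \<and>
    nat_mem M' aMid 0 = mid \<and> nat_mem M' aR 0 = max ra mid \<and> frame {29, 30, 35, 36} M M')"
proof -
  have "nat_mem M aHalf (lb - la) = (lb - la) div 2" using assms by (simp add: prepared_def)
  moreover have "a + (b - a) = max a b" "b - (b - a) = min b a" for a b :: nat by auto
  ultimately show ?thesis
    using assms(2) unfolding mid_def
    apply (simp add: middle_com_def runs_in_def cong: runs_weak_cong)
    apply (simp add: locals_def)
    apply (simp add: frame_def)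
    done
qed

text \<open>The side conditions keep the stored variables apart from the task arrays that are being
  overwritten.\<close>

lemma run_store_task:
  assumes "x \<notin> {20, 21, 22, 23, 24, 25, 26, 27}" "y \<notin> {20, 21, 22, 23, 24, 25, 26, 27}"
    "la \<notin> {20, 21, 22, 23, 24, 25, 26, 27}" "lb \<notin> {20, 21, 22, 23, 24, 25, 26, 27}"
    "ra \<notin> {20, 21, 22, 23, 24, 25, 26, 27}" "rb \<notin> {20, 21, 22, 23, 24, 25, 26, 27}"
  shows "runs_in P (store_task_com x y la lb ra rb) M 65 (\<lambda>M'. tasks M' =
      tasks M @ [(nat_mem M aH 0, nat_mem M x 0, nat_mem M y 0, nat_mem M la 0, nat_mem M lb 0,
        nat_mem M ra 0, nat_mem M rb 0)] \<and> frame {20..27} M M')"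
  using assms
  apply (simp add: store_task_com_def runs_in_def cong: runs_weak_cong)
  apply (simp add: tasks_def)
  apply (simp add: frame_def)
  done

lemma run_store_tasks:
  assumes loc: "locals M = (h, x, y, la, lb, ra, rb)" "nat_mem M aMid 0 = mid" "nat_mem M aR 0 = r"
  shows "runs_in P store_tasks_com M 150 (\<lambda>M'. tasks M' =
      tasks M @ [(h, mid, y, la, mid, ra, r), (h, max lb ra, r, mid + 1, lb, r, rb)] \<and>
    frame ({20..27} \<union> {29, 31}) M M')"
    (is "runs_in _ _ _ _ ?Q")
  unfolding store_tasks_com_def
proof (rule runs_in_Seq[OF run_store_task])
  fix M1
  assume 1: "tasks M1 = tasks M @ [(nat_mem M aH 0, nat_mem M aMid 0, nat_mem M aHi 0, nat_mem M aLa 0,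
    nat_mem M aMid 0, nat_mem M aRa 0, nat_mem M aR 0)] \<and> frame {20..27} M M1"
  let ?M2 = "M1\<lparr>nat_mem := write_cell (write_cell (nat_mem M1) aLo 0 (max lb ra)) aLa 0 (mid + 1)\<rparr>"
  have "lb + (ra - lb) = max lb ra" by simp
  then have A: "runs_in P (assign aLo (NAdd (Var aLb) (NSub (Var aRa) (Var aLb)));;
      assign aLa (NAdd (Var aMid) (NConst 1))) M1 17 (\<lambda>M'. M' = ?M2)"
    using 1 loc by (simp add: runs_in_def locals_def frame_def)
  have "tasks ?M2 = tasks M1" by (rule tasks_cong) auto
  then have B: "runs_in P (store_task_com aLo aR aLa aLb aR aRb) ?M2 65 ?Q"
    using 1 loc
    by (intro runs_in_mono[OF run_store_task]) (simp_all add: locals_def frame_def)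
  show "runs_in P ((assign aLo (NAdd (Var aLb) (NSub (Var aRa) (Var aLb)));;
      assign aLa (NAdd (Var aMid) (NConst 1)));; store_task_com aLo aR aLa aLb aR aRb) M1 84 ?Q"
    by (rule runs_in_Seq[OF A]) (erule ssubst, rule B, simp)
qed simp_all

lemma result_cong: "frame K M M' \<Longrightarrow> 1 \<notin> K \<Longrightarrow> result M' = result M"
  by (simp add: result_def frame_def)

definition window_state :: "ram_state \<Rightarrow> task list \<Rightarrow> nat list \<Rightarrow> ereal \<Rightarrow> bool" where
  "window_state M ts s v \<longleftrightarrow> ready M \<and> dsu w M \<and> tasks M = ts \<and> stack M = s \<and> result M = v"

lemma window_state_frame:
  assumes "window_state M ts s v" "frame K M M'" "K \<inter> ({1..6} \<union> {20..27}) = {}"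
    "dsu w M'" "stack M' = s'"
  shows "window_state M' ts s' v"
proof -
  have K: "nat_mem M' k = nat_mem M k" if "k \<in> {1..6} \<union> {20..27}" for k
    using assms(2,3) that by (auto simp: frame_def)
  have r: "real_mem M' = real_mem M" using assms(2) by (simp add: frame_def)
  have "ready M' \<longleftrightarrow> ready M" using K r by (intro prepared_cong) auto
  moreover have "tasks M' = tasks M" using K by (intro tasks_cong) auto
  moreover have "result M' = result M" using K[of 1] r by (simp add: result_def)
  ultimately show ?thesis using assms by (simp add: window_state_def)
qed

lemma window_state_frame':
  assumes "window_state M ts s v" "frame K M M'" "K \<inter> ({1..6} \<union> {20..27} \<union> {8..13}) = {}"
  shows "window_state M' ts s v"
proof (rule window_state_frame[OF assms(1,2)])
  have K: "K \<inter> {8, 9, 10, 11, 12, 13} = {}" "aVst \<notin> K" "aSp \<notin> K" using assms(3) by auto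
  show "K \<inter> ({1..6} \<union> {20..27}) = {}" using assms(3) by blast
  show "dsu w M'" using dsu_cong[OF assms(2) K(1), of w] assms(1) by (simp add: window_state_def)
  show "stack M' = s" using stack_cong[OF assms(2) K(2,3)] assms(1) by (simp add: window_state_def)
qed

text \<open>All right ends below \<open>max ra mid\<close> can be skipped, as
  \<open>ra \<le> reach mid\<close> and \<open>mid \<le> reach mid\<close>. The search for
  \<open>reach mid\<close> therefore activates at most \<open>lb - la\<close> vertices to the left
  of the common part and at most \<open>rb - ra\<close> to its right. They remain on the stack as
  \<open>s'\<close>.\<close>

lemma run_split:
  assumes st: "window_state M ts s v" and loc: "locals M = (h, x, y, la, lb, ra, rb)"
    and s: "set s = ord ` {lb..<ra}"
    and b: "la < lb" "lb \<le> N" "ra \<le> rb" "rb \<le> N"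
    and reach: "\<And>l. la \<le> l \<Longrightarrow> l < lb \<Longrightarrow> ra \<le> reach l \<and> reach l \<le> rb"
  defines "mid \<equiv> la + (lb - la) div 2"
  shows "runs_in P (split_com record_com) M (unit * ((lb - la) + (rb - ra) + 2)) (\<lambda>M'. \<exists>s'.
    window_state M' (ts @ [(h, mid, min lb ra, la, mid, ra, reach mid),
        (h, max lb ra, reach mid, mid + 1, lb, reach mid, rb)]) (s @ s') (min v (candidate mid)) \<and>
    length s' \<le> (lb - la) + (rb - ra) \<and> set s' \<subseteq> ord ` {..<N})"
    (is "runs_in _ _ _ _ ?Q")
proof -
  have mid: "la \<le> mid" "mid < lb" using b(1) by (auto simp: mid_def)
  have rm: "ra \<le> reach mid" "reach mid \<le> rb" "mid \<le> reach mid"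
    using reach[OF mid] le_reach[of mid] mid b by auto
  define m where "m = min lb ra"
  define a where "a = max ra mid"
  have ab: "mid \<le> a" "a \<le> reach mid" "ra \<le> a" "m \<le> N" using rm b by (auto simp: a_def m_def)
  have A: "{lb..<ra} \<subseteq> {..<N}" "{lb..<ra} \<inter> {mid..<m} = {}" "{lb..<ra} \<union> {mid..<m} = {mid..<a}"
    using mid b by (auto simp: m_def a_def)
  define s1 where "s1 = s @ map ord [mid..<m]"
  define s2 where "s2 = s1 @ map ord [a..<reach mid]"
  have set1: "set s1 = window mid a"
    using s A(3) by (simp add: s1_def window_def image_Un[symmetric])
  let ?L = "\<lambda>M'. (\<exists>z. locals M' = (h, z, m, la, lb, ra, rb)) \<and> nat_mem M' aMid 0 = mid"
  define v' where "v' = min v (candidate mid)"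
  have 1: "runs_in P middle_com M 60 (\<lambda>M'. window_state M' ts s v \<and>
      locals M' = (h, mid, m, la, lb, ra, rb) \<and> nat_mem M' aMid 0 = mid \<and> nat_mem M' aR 0 = a)"
  proof -
    have "ready M" using st by (simp add: window_state_def)
    from run_middle[OF this loc b(1,2), folded mid_def m_def a_def]
    show ?thesis by (rule runs_in_mono) (use window_state_frame'[OF st] in auto)
  qed
  have 2: "runs_in P push_range_com M1 (unit * (m - mid) + 6) (\<lambda>M'. window_state M' ts s1 v \<and>
      ?L M' \<and> nat_mem M' aR 0 = a)"
    if "window_state M1 ts s v \<and> locals M1 = (h, mid, m, la, lb, ra, rb) \<and> nat_mem M1 aMid 0 = mid \<and>
      nat_mem M1 aR 0 = a" for M1
  proof -
    have h: "window_state M1 ts s v" "locals M1 = (h, mid, m, la, lb, ra, rb)" "nat_mem M1 aMid 0 = mid"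
      "nat_mem M1 aR 0 = a" using that by auto
    have "runs_in P push_range_com M1 (unit * (m - mid) + 6)
      (\<lambda>M'. dsu w M' \<and> stack M' = stack M1 @ map ord [mid..<m] \<and> frame ({8..19} \<union> {29}) M1 M')"
      using h s A ab by (intro run_push_range[where A = "{lb..<ra}"])
        (simp_all add: window_state_def locals_def)
    then show ?thesis
    proof (rule runs_in_mono)
      fix M' assume a: "dsu w M' \<and> stack M' = stack M1 @ map ord [mid..<m] \<and> frame ({8..19} \<union> {29}) M1 M'"
      then have "window_state M' ts s1 v"
        using h(1) by (intro window_state_frame[OF h(1), of "{8..19} \<union> {29}"]) (auto simp: s1_def window_state_def)
      moreover have "\<exists>z. locals M' = (h, z, m, la, lb, ra, rb)" "nat_mem M' aMid 0 = mid" "nat_mem M' aR 0 = a"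
        using a h by (simp_all add: frame_def locals_def \<open>nat_mem M1 aR 0 = a\<close>)
      ultimately show "window_state M' ts s1 v \<and>
        ?L M' \<and> nat_mem M' aR 0 = a"
        using h(4) by blast
    qed simp
  qed
  have 3: "runs_in P connected_com M2 (44 * bits N + 150) (\<lambda>M'. window_state M' ts s1 v \<and>
      ?L M' \<and> nat_mem M' aR 0 = a \<and>
      nat_mem M' aConn 0 = (if joins mid a then 1 else 0))"
    if "window_state M2 ts s1 v \<and> ?L M2 \<and>
      nat_mem M2 aR 0 = a" for M2
  proof -
    have st2: "window_state M2 ts s1 v" using that by blast
    then have *: "ready M2" "dsu w M2" "set (stack M2) = window mid a" using set1
      by (simp_all add: window_state_def)
    show ?thesis
    proof (rule runs_in_mono[OF run_joins[OF *]])
      show "a \<le> N" using ab(2) reach_le[of mid] by simp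
      fix M' assume x: "nat_mem M' aConn 0 = (if joins mid a then 1 else 0) \<and> frame {14, 15, 18} M2 M'"
      then have "window_state M' ts s1 v" by (intro window_state_frame'[OF st2, of "{14, 15, 18}"]) auto
      then show "window_state M' ts s1 v \<and> ?L M' \<and> nat_mem M' aR 0 = a \<and>
          nat_mem M' aConn 0 = (if joins mid a then 1 else 0)"
        using x that by (simp add: frame_def locals_def)
    qed simp
  qed
  have 4: "runs_in P extend_com M3 (unit * (rb - a) + 20) (\<lambda>M'. window_state M' ts s2 v \<and>
      ?L M' \<and>
      nat_mem M' aR 0 = reach mid \<and> nat_mem M' aConn 0 = (if joins mid (reach mid) then 1 else 0))"
    if "window_state M3 ts s1 v \<and> ?L M3 \<and>
      nat_mem M3 aR 0 = a \<and> nat_mem M3 aConn 0 = (if joins mid a then 1 else 0)" for M3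
  proof -
    have st3: "window_state M3 ts s1 v" using that by blast
    then have *: "ready M3" "dsu w M3" "set (stack M3) = window mid a" using set1
      by (simp_all add: window_state_def)
    have **: "nat_mem M3 aR 0 = a" "nat_mem M3 aRb 0 = rb"
      "nat_mem M3 aConn 0 = (if joins mid a then 1 else 0)"
      using that by (auto simp: locals_def)
    show ?thesis
    proof (rule runs_in_mono[OF run_extend[OF * ** ab(1,2) rm(2) b(4)]])
      fix M' assume x: "dsu w M' \<and> stack M' = stack M3 @ map ord [a..<reach mid] \<and> nat_mem M' aR 0 = reach mid \<and>
        nat_mem M' aConn 0 = (if joins mid (reach mid) then 1 else 0) \<and> frame ({8..19} \<union> {36}) M3 M'"
      then have "window_state M' ts s2 v"
        using st3 by (intro window_state_frame[OF st3, of "{8..19} \<union> {36}"]) (auto simp: s2_def window_state_def)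
      then show "window_state M' ts s2 v \<and>
        ?L M' \<and>
        nat_mem M' aR 0 = reach mid \<and> nat_mem M' aConn 0 = (if joins mid (reach mid) then 1 else 0)"
        using x that by (simp add: frame_def locals_def)
    qed simp
  qed
  have 5: "runs_in P (Cond (NLess (NConst 0) (Var aConn)) record_com Skip) M4 110 (\<lambda>M'.
      window_state M' ts s2 v' \<and> ?L M' \<and> nat_mem M' aR 0 = reach mid)"
    if "window_state M4 ts s2 v \<and> ?L M4 \<and>
      nat_mem M4 aR 0 = reach mid \<and> nat_mem M4 aConn 0 = (if joins mid (reach mid) then 1 else 0)" for M4
  proof (cases "joins mid (reach mid)")
    case False
    then have "v' = v" by (simp add: v'_def candidate_def)
    then show ?thesis using that False by (simp add: runs_in_def)
  next
    case True
    define r' where "r' = reach mid - 1"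
    have r': "reach mid = Suc r'" "r' < N"
      using joins_less[OF True] reach_le[of mid] by (auto simp: r'_def)
    have v': "v' = min v (g (key (ord mid)) (key (ord r')))"
      using True by (simp add: v'_def candidate_def r'_def)
    have st4: "window_state M4 ts s2 v" using that by blast
    have "runs_in P record_com M4 100 (\<lambda>M'.
        result M' = min (result M4) (g (key (ord mid)) (key (ord r'))) \<and>
        (\<forall>k. k \<noteq> 1 \<longrightarrow> nat_mem M' k = nat_mem M4 k) \<and> real_mem M' 1 = real_mem M4 1)"
      using that r' mid b st4 by (intro run_record) (simp_all add: window_state_def)
    then have "runs_in P record_com M4 100 (\<lambda>M'.
      window_state M' ts s2 v' \<and> ?L M' \<and> nat_mem M' aR 0 = reach mid)"
    proof (rule runs_in_mono)
      fix M' assume x: "result M' = min (result M4) (g (key (ord mid)) (key (ord r'))) \<and>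
        (\<forall>k. k \<noteq> 1 \<longrightarrow> nat_mem M' k = nat_mem M4 k) \<and> real_mem M' 1 = real_mem M4 1"
      have "ready M' \<longleftrightarrow> ready M4" using x by (intro prepared_cong) auto
      moreover have "dsu w M' \<longleftrightarrow> dsu w M4" "stack M' = stack M4" "tasks M' = tasks M4"
        using x by (simp_all add: dsu_def stack_def tasks_def)
      moreover have "locals M' = locals M4" "nat_mem M' aMid 0 = nat_mem M4 aMid 0"
        "nat_mem M' aR 0 = nat_mem M4 aR 0" using x by (simp_all add: locals_def)
      ultimately show "window_state M' ts s2 v' \<and> ?L M' \<and> nat_mem M' aR 0 = reach mid"
        using x that by (simp add: window_state_def v')
    qed simp
    then show ?thesis using that True by (intro runs_in_Cond) auto
  qed
  have 6: "runs_in P store_tasks_com M5 150 ?Q"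
    if "window_state M5 ts s2 v' \<and> ?L M5 \<and> nat_mem M5 aR 0 = reach mid" for M5
  proof -
    from that obtain z where z: "locals M5 = (h, z, m, la, lb, ra, rb)" by blast
    have st5: "window_state M5 ts s2 v'" using that by blast
    show ?thesis
    proof (rule runs_in_mono[OF run_store_tasks[OF z]])
      fix M' assume x: "tasks M' = tasks M5 @
        [(h, mid, m, la, mid, ra, reach mid), (h, max lb ra, reach mid, mid + 1, lb, reach mid, rb)] \<and>
        frame ({20..27} \<union> {29, 31}) M5 M'"
      then have se: "frame ({20..27} \<union> {29, 31}) M5 M'" by blast
      have "ready M'" using ready_frame[OF se] st5 by (auto simp: window_state_def)
      moreover have "dsu w M'" using dsu_cong[OF se, of w] st5 by (simp add: window_state_def)
      moreover have "stack M' = s2" using stack_cong[OF se] st5 by (simp add: window_state_def)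
      moreover have "result M' = v'" using result_cong[OF se] st5 by (simp add: window_state_def)
      ultimately have "window_state M' (ts @ [(h, mid, m, la, mid, ra, reach mid),
          (h, max lb ra, reach mid, mid + 1, lb, reach mid, rb)]) s2 v'"
        using x st5 by (simp add: window_state_def)
      moreover have "s2 = s @ (map ord [mid..<m] @ map ord [a..<reach mid])"
        by (simp add: s2_def s1_def)
      moreover have "length (map ord [mid..<m] @ map ord [a..<reach mid]) \<le> (lb - la) + (rb - ra)"
        using mid rm ab by (simp add: m_def)
      moreover have "set (map ord [mid..<m] @ map ord [a..<reach mid]) \<subseteq> ord ` {..<N}"
        using ab rm b by auto
      ultimately show "?Q M'" unfolding m_def v'_def by blast
    qed (use that in auto)
  qed
  have "m - mid \<le> lb - la" "rb - a \<le> rb - ra" using mid ab by (auto simp: m_def)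
  then have "unit * (m - mid) \<le> unit * (lb - la)" "unit * (rb - a) \<le> unit * (rb - ra)" by simp_all
  then have t: "60 + ((unit * (m - mid) + 6) + ((44 * bits N + 150) + ((unit * (rb - a) + 20) +
      (110 + 150 + 1) + 1) + 1) + 1) + 1 \<le> unit * ((lb - la) + (rb - ra) + 2)"
    by (simp add: unit_def distrib_left distrib_right)
  show ?thesis unfolding split_com_def
    by (rule runs_in_Seq[OF 1 _ t], rule runs_in_Seq[OF 2 _ order_refl], assumption,
      rule runs_in_Seq[OF 3 _ order_refl], assumption,
      rule runs_in_Seq[OF 4 _ order_refl], assumption,
      rule runs_in_Seq[OF 5 6 order_refl], assumption, assumption)
qed

text \<open>Rolling back at the start of a task, not at its end, makes it irrelevant which task ran
  before. The price \<open>length s - h\<close> is paid by credit that the stack already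
  holds.\<close>

lemma run_process:
  assumes st: "window_state M (ts @ [(h, x, y, la, lb, ra, rb)]) s v"
    and s: "set s \<subseteq> ord ` {..<N}" "h \<le> length s" "set (take h s) = ord ` A" "A \<subseteq> {..<N}"
    and A: "A \<union> {x..<y} = {lb..<ra}" "A \<inter> {x..<y} = {}"
    and b: "la \<le> lb" "lb \<le> N" "ra \<le> rb" "rb \<le> N" "y \<le> N"
    and reach: "\<And>l. la \<le> l \<Longrightarrow> l < lb \<Longrightarrow> ra \<le> reach l \<and> reach l \<le> rb"
  defines "mid \<equiv> la + (lb - la) div 2" and "s1 \<equiv> take h s @ map ord [x..<y]"
    and "e \<equiv> (if la < lb then (lb - la) + (rb - ra) else 0)"
  shows "runs_in P (process_com record_com) M
    (unit * ((length s - h) + (y - x) + e + 3)) (\<lambda>M'. \<exists>s'.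
    window_state M' (ts @ (if la < lb then [(length s1, mid, min lb ra, la, mid, ra, reach mid),
        (length s1, max lb ra, reach mid, mid + 1, lb, reach mid, rb)] else [])) (s1 @ s')
      (if la < lb then min v (candidate mid) else v) \<and>
    length s' \<le> e \<and> set s' \<subseteq> ord ` {..<N})"
    (is "runs_in _ _ _ _ ?Q")
proof -
  have 1: "runs_in P load_task_com M 70 (\<lambda>M'. window_state M' ts s v \<and>
      locals M' = (h, x, y, la, lb, ra, rb))"
  proof (rule runs_in_mono[OF run_load_task])
    show "tasks M = ts @ [(h, x, y, la, lb, ra, rb)]" using st by (simp add: window_state_def)
    fix M' assume a: "tasks M' = ts \<and> locals M' = (h, x, y, la, lb, ra, rb) \<and>
      frame {27, 28, 29, 30, 31, 32, 33, 34} M M'"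
    then have se: "frame {27, 28, 29, 30, 31, 32, 33, 34} M M'" by blast
    have "ready M'" using ready_frame[OF se] st by (auto simp: window_state_def)
    moreover have "dsu w M'" using dsu_cong[OF se, of w] st by (simp add: window_state_def)
    moreover have "stack M' = s" using stack_cong[OF se] st by (simp add: window_state_def)
    moreover have "result M' = v" using result_cong[OF se] st by (simp add: window_state_def)
    ultimately show "window_state M' ts s v \<and> locals M' = (h, x, y, la, lb, ra, rb)"
      using a by (simp add: window_state_def)
  qed simp
  have 2: "runs_in P rollback_com M1 (unit * (length s - h) + 6) (\<lambda>M'. window_state M' ts (take h s) v \<and>
      locals M' = (h, x, y, la, lb, ra, rb))"
    if "window_state M1 ts s v \<and> locals M1 = (h, x, y, la, lb, ra, rb)" for M1
  proof -
    have st1: "window_state M1 ts s v" using that by blast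
    then have *: "dsu w M1" "stack M1 = s" "nat_mem M1 aH 0 = h" "h \<le> length (stack M1)"
      using that s(2) by (simp_all add: window_state_def locals_def)
    show ?thesis
    proof (rule runs_in_mono[OF run_rollback[OF *(1,3,4)]])
      fix M' assume a: "dsu w M' \<and> stack M' = take h (stack M1) \<and> frame {8..18} M1 M'"
      then have "window_state M' ts (take h s) v"
        using *(2) by (intro window_state_frame[OF st1, of "{8..18}"]) auto
      then show "window_state M' ts (take h s) v \<and> locals M' = (h, x, y, la, lb, ra, rb)"
        using a that by (simp add: frame_def locals_def)
    qed (simp add: *(2))
  qed
  have 3: "runs_in P push_range_com M2 (unit * (y - x) + 6) (\<lambda>M'. window_state M' ts s1 v \<and>
      (\<exists>z h. locals M' = (h, z, y, la, lb, ra, rb)))"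
    if "window_state M2 ts (take h s) v \<and> locals M2 = (h, x, y, la, lb, ra, rb)" for M2
  proof -
    have st2: "window_state M2 ts (take h s) v" using that by blast
    have "runs_in P push_range_com M2 (unit * (y - x) + 6)
      (\<lambda>M'. dsu w M' \<and> stack M' = stack M2 @ map ord [x..<y] \<and> frame ({8..19} \<union> {29}) M2 M')"
      using that s A b by (intro run_push_range[where A = A]) (simp_all add: window_state_def locals_def)
    then show ?thesis
    proof (rule runs_in_mono)
      fix M' assume a: "dsu w M' \<and> stack M' = stack M2 @ map ord [x..<y] \<and> frame ({8..19} \<union> {29}) M2 M'"
      then have "window_state M' ts s1 v" using st2
        by (intro window_state_frame[OF st2, of "{8..19} \<union> {29}"]) (auto simp: s1_def window_state_def)
      then show "window_state M' ts s1 v \<and> (\<exists>z h. locals M' = (h, z, y, la, lb, ra, rb))"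
        using a that by (simp add: frame_def locals_def)
    qed simp
  qed
  have 4: "runs_in P (assign aH (Var aSp)) M3 5 (\<lambda>M'. window_state M' ts s1 v \<and>
      (\<exists>z. locals M' = (length s1, z, y, la, lb, ra, rb)))"
    if "window_state M3 ts s1 v \<and> (\<exists>z h. locals M3 = (h, z, y, la, lb, ra, rb))" for M3
  proof -
    have st3: "window_state M3 ts s1 v" using that by blast
    then have sp: "nat_mem M3 aSp 0 = length s1" by (auto simp: window_state_def stack_def)
    let ?M' = "M3\<lparr>nat_mem := write_cell (nat_mem M3) aH 0 (length s1)\<rparr>"
    have "frame {28} M3 ?M'" by (simp add: frame_def)
    then have "window_state ?M' ts s1 v" by (rule window_state_frame'[OF st3]) auto
    moreover have "\<exists>z. locals ?M' = (length s1, z, y, la, lb, ra, rb)" using that by (auto simp: locals_def)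
    ultimately show ?thesis using sp by (simp add: runs_in_def)
  qed
  have set1: "set s1 = ord ` {lb..<ra}"
    using s(3) A(1) by (simp add: s1_def image_Un[symmetric])
  have 5: "runs_in P (Cond (NLess (Var aLa) (Var aLb)) (split_com record_com) Skip) M4
      (unit * (e + 2) + 10) ?Q"
    if "window_state M4 ts s1 v \<and> (\<exists>z. locals M4 = (length s1, z, y, la, lb, ra, rb))" for M4
  proof (cases "la < lb")
    case True
    from that obtain z where z: "locals M4 = (length s1, z, y, la, lb, ra, rb)" by blast
    have st4: "window_state M4 ts s1 v" using that by blast
    show ?thesis
      using run_split[OF st4 z set1 True b(2,3,4) reach] True z
      by (intro runs_in_Cond[where t = "unit * ((lb - la) + (rb - ra) + 2)"])
        (simp_all add: mid_def e_def locals_def)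
  next
    case False
    then show ?thesis using that
      by (auto simp: runs_in_def locals_def intro!: exI[of _ "[]"])
  qed
  have t: "70 + ((unit * (length s - h) + 6) + ((unit * (y - x) + 6) + (5 +
      (unit * (e + 2) + 10) + 1) + 1) + 1) + 1 \<le>
      unit * ((length s - h) + (y - x) + e + 3)"
    by (simp add: unit_def distrib_left distrib_right)
  show ?thesis unfolding process_com_def
    by (rule runs_in_Seq[OF 1 _ t], rule runs_in_Seq[OF 2 _ order_refl], assumption,
      rule runs_in_Seq[OF 3 _ order_refl], assumption,
      rule runs_in_Seq[OF 4 5 order_refl], assumption, assumption)
qed

end

text \<open>
  The potential of a task: each of the \<open>bits (lb - la)\<close> levels of the recursion below it handles
  disjoint ranges of left ends and of right ends, and activates and rolls back each index at most
  a constant number of times.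
\<close>

fun task_weight :: "task \<Rightarrow> nat" where
  "task_weight (h, x, y, la, lb, ra, rb) =
     2 * (y - x) + (4 * (bits (lb - la) * ((lb - la) + (rb - ra))) + 4 * (2 * (lb - la) + 1))"

text \<open>One level of the \<open>bits\<close> factor, worth
  \<open>4 * ((lb - la) + (rb - ra))\<close>, is released. Half of it pays for activating and later
  removing the vertices of this split; the other half covers the ranges that the two halves add
  first, of lengths at most \<open>lb - la\<close> and \<open>rb - ra\<close>. The ranges of left
  ends and of right ends of the halves do not add up to more than the original ones. The last
  summand allows 4 units for each of at most \<open>2 * (lb - la) + 1\<close> nodes of the recursion
  tree.\<close>

lemma task_weight_split:
  fixes la lb ra rb :: nat
  assumes "la < lb" "ra \<le> r" "r \<le> rb"
  defines "mid \<equiv> la + (lb - la) div 2"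
  shows "2 * ((lb - la) + (rb - ra)) + 4 + task_weight (h, mid, min lb ra, la, mid, ra, r) +
      task_weight (h, max lb ra, r, mid + 1, lb, r, rb)
    \<le> 4 * (bits (lb - la) * ((lb - la) + (rb - ra))) + 4 * (2 * (lb - la) + 1)"
proof -
  define n where "n = lb - la"
  define b where "b = bits (n div 2)"
  define a c where "a = mid - la" and "c = lb - (mid + 1)"
  have n: "0 < n" using assms(1) by (simp add: n_def)
  have bn: "bits n = Suc b" using n by (simp add: b_def bits.simps[of n])
  have ac: "a = n div 2" "c \<le> n div 2" "a + c + 1 = n" using assms(1) by (auto simp: a_def c_def mid_def n_def)
  have le: "bits a \<le> b" "bits c \<le> b" unfolding b_def using ac by (auto intro: bits_mono)
  have 1: "bits a * (a + (r - ra)) \<le> b * (a + (r - ra))" "bits c * (c + (rb - r)) \<le> b * (c + (rb - r))"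
    using le by simp_all
  have "b * (a + (r - ra)) + b * (c + (rb - r)) = b * (a + (r - ra) + (c + (rb - r)))"
    by (simp add: distrib_left)
  also have "\<dots> \<le> b * (n + (rb - ra))" using ac assms(2,3) by (intro mult_le_mono2) simp
  finally have 2: "bits a * (a + (r - ra)) + bits c * (c + (rb - r)) \<le> b * (n + (rb - ra))"
    using 1 by linarith
  have 3: "min lb ra - mid \<le> n" "r - max lb ra \<le> rb - ra" using assms(2,3) by (auto simp: n_def mid_def)
  have 4: "bits n * (n + (rb - ra)) = n + (rb - ra) + b * (n + (rb - ra))" by (simp add: bn)
  have *: "2 * (n + d) + 4 + (2 * u + (4 * X + 4 * (2 * a + 1))) + (2 * v + (4 * Y + 4 * (2 * c + 1)))
      \<le> 4 * (n + d + Z) + 4 * (2 * n + 1)"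
    if "X + Y \<le> Z" "u \<le> n" "v \<le> d" for d u v X Y Z :: nat
    using that ac(3) by presburger
  show ?thesis
    unfolding task_weight.simps n_def[symmetric] a_def[symmetric] c_def[symmetric] 4
    by (rule *[OF 2 3])
qed

context window_search
begin

section \<open>Invariant and potential of the main loop\<close>

fun task_span :: "task \<Rightarrow> nat set" where
  "task_span (h, x, y, la, lb, ra, rb) = {la..<lb}"

text \<open>The condition sees only the first \<open>h\<close> entries of the stack, so a pending
  task stays correct whatever happens above that height.\<close>

fun task_ok :: "nat list \<Rightarrow> task \<Rightarrow> bool" where
  "task_ok s (h, x, y, la, lb, ra, rb) \<longleftrightarrow> h \<le> length s \<and>
     (\<exists>A. set (take h s) = ord ` A \<and> A \<subseteq> {..<N} \<and> A \<union> {x..<y} = {lb..<ra} \<and> A \<inter> {x..<y} = {}) \<and>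
     la \<le> lb \<and> lb \<le> N \<and> ra \<le> rb \<and> rb \<le> N \<and> y \<le> N \<and>
     (\<forall>l. la \<le> l \<longrightarrow> l < lb \<longrightarrow> ra \<le> reach l \<and> reach l \<le> rb)"

text \<open>Heights increase towards the top of the task stack, so rolling back for the top task
  never destroys the prefix that a deeper task needs. The two bounds on \<open>v\<close> say that
  every left end outside the pending tasks is accounted for and that nothing too small was recorded;
  without pending tasks they pin \<open>v\<close> down.\<close>

definition search_inv :: "ram_state \<Rightarrow> bool" where
  "search_inv M \<longleftrightarrow> (\<exists>ts s v. window_state M ts s v \<and> set s \<subseteq> ord ` {..<N} \<and>
     (\<forall>k\<in>set ts. task_ok s k) \<and> sorted_wrt (\<le>) (map fst ts) \<and>
     (\<forall>l<N. (\<forall>k\<in>set ts. l \<notin> task_span k) \<longrightarrow> v \<le> candidate l) \<and>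
     (INF l\<in>{..<N}. candidate l) \<le> v)"

text \<open>Each vertex on the stack holds one unit for its removal.\<close>

definition search_measure :: "ram_state \<Rightarrow> nat" where
  "search_measure M = unit * (length (stack M) + sum_list (map task_weight (tasks M)))"

lemma task_ok_cong: "take (fst k) s' = take (fst k) s \<Longrightarrow> fst k \<le> length s' \<Longrightarrow> task_ok s k \<Longrightarrow> task_ok s' k"
  by (cases k) auto

lemma search_step:
  assumes inv: "search_inv M" and tp: "0 < nat_mem M aTp 0"
  shows "\<exists>t. runs_in P (process_com record_com) M t
    (\<lambda>M'. search_inv M' \<and> search_measure M' + t + 5 \<le> search_measure M)"
proof -
  obtain ts s v where st: "window_state M ts s v" and s: "set s \<subseteq> ord ` {..<N}"
    and ok: "\<forall>k\<in>set ts. task_ok s k" and sorted: "sorted_wrt (\<le>) (map fst ts)"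
    and v: "\<forall>l<N. (\<forall>k\<in>set ts. l \<notin> task_span k) \<longrightarrow> v \<le> candidate l"
    and inf: "(INF l\<in>{..<N}. candidate l) \<le> v"
    using inv unfolding search_inv_def by blast
  have "ts \<noteq> []" using tp st by (auto simp: window_state_def tasks_def)
  then obtain ts0 k where "ts = ts0 @ [k]" by (metis append_butlast_last_id)
  moreover obtain h x y la lb ra rb where "k = (h, x, y, la, lb, ra, rb)" by (cases k) auto
  ultimately have ts: "ts = ts0 @ [(h, x, y, la, lb, ra, rb)]" by simp
  obtain A where A: "set (take h s) = ord ` A" "A \<subseteq> {..<N}" "A \<union> {x..<y} = {lb..<ra}" "A \<inter> {x..<y} = {}"
    and b: "h \<le> length s" "la \<le> lb" "lb \<le> N" "ra \<le> rb" "rb \<le> N" "y \<le> N"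
    and reach: "\<And>l. la \<le> l \<Longrightarrow> l < lb \<Longrightarrow> ra \<le> reach l \<and> reach l \<le> rb"
    using ok unfolding ts by auto
  define mid where "mid = la + (lb - la) div 2"
  define s1 where "s1 = take h s @ map ord [x..<y]"
  define new where "new = (if la < lb then [(length s1, mid, min lb ra, la, mid, ra, reach mid),
        (length s1, max lb ra, reach mid, mid + 1, lb, reach mid, rb)] else [])"
  define e where "e = (if la < lb then (lb - la) + (rb - ra) else 0)"
  define v' where "v' = (if la < lb then min v (candidate mid) else v)"
  let ?t = "unit * ((length s - h) + (y - x) + e + 3)"
  have run: "runs_in P (process_com record_com) M ?t (\<lambda>M'. \<exists>s'.
    window_state M' (ts0 @ new) (s1 @ s') v' \<and> length s' \<le> e \<and> set s' \<subseteq> ord ` {..<N})"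
    unfolding new_def v'_def mid_def s1_def e_def
    by (rule run_process[OF st[unfolded ts] s b(1) A b(2-6) reach])
  have len1: "h \<le> length s1" "length s1 \<le> h + (y - x)" using b(1) by (simp_all add: s1_def)
  have set1: "set s1 = ord ` {lb..<ra}" using A(1,3) by (simp add: s1_def image_Un[symmetric])
  have oldh: "fst k \<le> h" if "k \<in> set ts0" for k
    using sorted that unfolding ts by (auto simp: sorted_wrt_append)
  have w_new: "2 * e + sum_list (map task_weight new) + 4 + 2 * (y - x)
      \<le> task_weight (h, x, y, la, lb, ra, rb)"
  proof (cases "la < lb")
    case True
    have "la \<le> mid" "mid < lb" using True by (auto simp: mid_def)
    then have "2 * ((lb - la) + (rb - ra)) + 4 + task_weight (length s1, mid, min lb ra, la, mid, ra, reach mid) +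
        task_weight (length s1, max lb ra, reach mid, mid + 1, lb, reach mid, rb)
        \<le> 4 * (bits (lb - la) * ((lb - la) + (rb - ra))) + 4 * (2 * (lb - la) + 1)"
      using reach[of mid] task_weight_split[OF True, of ra "reach mid" rb "length s1"]
      unfolding mid_def by blast
    moreover have "sum_list (map task_weight new) =
        task_weight (length s1, mid, min lb ra, la, mid, ra, reach mid) +
        task_weight (length s1, max lb ra, reach mid, mid + 1, lb, reach mid, rb)"
      using True by (simp add: new_def del: task_weight.simps)
    ultimately show ?thesis using True unfolding task_weight.simps(1)[of h x] by (simp add: e_def)
  qed (simp add: new_def e_def)
  show ?thesis
  proof (rule exI[of _ ?t], rule runs_in_mono[OF run order_refl])
    fix M' assume "\<exists>s'. window_state M' (ts0 @ new) (s1 @ s') v' \<and> length s' \<le> e \<and>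
      set s' \<subseteq> ord ` {..<N}"
    then obtain s' where s': "window_state M' (ts0 @ new) (s1 @ s') v'" "length s' \<le> e"
      "set s' \<subseteq> ord ` {..<N}" by blast
    have "set (s1 @ s') \<subseteq> ord ` {..<N}" using set1 s'(3) b(4,5) by auto
    moreover have "task_ok (s1 @ s') k" if "k \<in> set ts0" for k
    proof (rule task_ok_cong)
      have "fst k \<le> h" by (rule oldh[OF that])
      then show "take (fst k) (s1 @ s') = take (fst k) s" "fst k \<le> length (s1 @ s')"
        using b(1) by (simp_all add: s1_def)
      show "task_ok s k" using ok that by (simp add: ts)
    qed
    moreover have "\<forall>k\<in>set new. task_ok (s1 @ s') k"
    proof (cases "la < lb")
      case True
      have m: "la \<le> mid" "mid < lb" using True by (auto simp: mid_def)
      have rm: "ra \<le> reach mid" "reach mid \<le> rb" using reach[OF m] by auto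
      \<comment> \<open>Here monotonicity enters: \<open>reach mid\<close> bounds the values of
        \<open>reach\<close> from above in the left half and from below in the right one.\<close>
      have rr: "ra \<le> reach l \<and> reach l \<le> reach mid" if "la \<le> l" "l < mid" for l
        using reach[of l] that m reach_mono[of l mid] by simp
      have rr': "reach mid \<le> reach l \<and> reach l \<le> rb" if "mid + 1 \<le> l" "l < lb" for l
        using reach[of l] that m reach_mono[of mid l] by simp
      have sub: "{lb..<ra} \<subseteq> {..<N}" using b by auto
      have L: "{lb..<ra} \<union> {mid..<min lb ra} = {mid..<ra}" "{lb..<ra} \<inter> {mid..<min lb ra} = {}"
        using m by auto
      have R: "{lb..<ra} \<union> {max lb ra..<reach mid} = {lb..<reach mid}" "{lb..<ra} \<inter> {max lb ra..<reach mid} = {}"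
        using rm by auto
      have "task_ok (s1 @ s') (length s1, mid, min lb ra, la, mid, ra, reach mid)"
        using m rm rr b L sub set1 by (auto intro!: exI[of _ "{lb..<ra}"] simp del: Un_Int_eq)
      moreover have "task_ok (s1 @ s') (length s1, max lb ra, reach mid, mid + 1, lb, reach mid, rb)"
        using m rm rr' b R sub set1 by (auto intro!: exI[of _ "{lb..<ra}"] simp del: Un_Int_eq)
      ultimately show ?thesis using True by (simp add: new_def)
    qed (simp add: new_def)
    moreover have "sorted_wrt (\<le>) (map fst (ts0 @ new))"
      using sorted oldh len1(1) unfolding ts by (fastforce simp: sorted_wrt_append new_def)
    moreover have "v' \<le> candidate l" if l: "l < N" "\<forall>k\<in>set (ts0 @ new). l \<notin> task_span k" for l
    proof (cases "la < lb \<and> l = mid")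
      case False
      have "\<forall>k\<in>set ts. l \<notin> task_span k"
      proof (cases "la < lb")
        case True
        then have "l \<notin> {la..<mid}" "l \<notin> {mid + 1..<lb}" "\<forall>k\<in>set ts0. l \<notin> task_span k"
          using l(2) by (simp_all add: new_def)
        then show ?thesis using True False by (auto simp: ts)
      next
        case nl: False
        then show ?thesis using l(2) by (simp add: ts)
      qed
      then have "v \<le> candidate l" using v l(1) by blast
      then show ?thesis by (auto simp: v'_def min_le_iff_disj)
    qed (simp add: v'_def)
    moreover have "(INF l\<in>{..<N}. candidate l) \<le> v'"
    proof (cases "la < lb")
      case True
      then have "mid < N" using b(3) by (auto simp: mid_def)
      then have "(INF l\<in>{..<N}. candidate l) \<le> candidate mid" by (intro INF_lower) simp
      then show ?thesis using inf by (simp add: v'_def)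
    qed (use inf in \<open>simp add: v'_def\<close>)
    ultimately have "search_inv M'" unfolding search_inv_def using s'(1)
      by (intro exI[of _ "ts0 @ new"] exI[of _ "s1 @ s'"] exI[of _ v'])
        (simp add: ball_Un)
    moreover have "search_measure M' + ?t + 5 \<le> search_measure M"
    proof -
      let ?W = "sum_list (map task_weight ts0)"
      have "search_measure M' = unit * (length s1 + length s' + (?W + sum_list (map task_weight new)))"
        using s'(1) by (simp add: search_measure_def window_state_def)
      moreover have "search_measure M = unit * (length s + (?W + task_weight (h, x, y, la, lb, ra, rb)))"
        using st unfolding ts by (simp add: search_measure_def window_state_def del: task_weight.simps)
      \<comment> \<open>The new stack has at most \<open>h + (y - x) + e\<close> entries and the
        step costs \<open>(length s - h) + (y - x) + e + 3\<close> units. So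
        \<open>2 * (y - x) + 2 * e + 4\<close> must come out of the weight of the task, the last
        unit paying for the loop test.\<close>
      moreover have "length s1 + length s' + (?W + sum_list (map task_weight new)) +
          ((length s - h) + (y - x) + e + 3) + 1
          \<le> length s + (?W + task_weight (h, x, y, la, lb, ra, rb))"
        using w_new len1(2) s'(2) b(1) by (simp del: task_weight.simps)
      then have "unit * (length s1 + length s' + (?W + sum_list (map task_weight new)) +
          ((length s - h) + (y - x) + e + 3) + 1)
          \<le> unit * (length s + (?W + task_weight (h, x, y, la, lb, ra, rb)))" by (rule mult_le_mono2)
      moreover have "5 \<le> unit" by (simp add: unit_def)
      ultimately show ?thesis by (simp add: distrib_left del: task_weight.simps)
    qed
    ultimately show "search_inv M' \<and> search_measure M' + ?t + 5 \<le> search_measure M" by blast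
  qed
qed


lemma run_search:
  assumes r: "ready M" and d: "dsu w M" and s: "stack M = []" and v: "result M = \<infinity>"
  shows "runs_in P (search_com record_com) M (unit * (8 * bits N * N + 8 * N + 5))
    (\<lambda>M'. result M' = (INF l\<in>{..<N}. candidate l))"
    (is "runs_in _ _ _ _ ?Q")
  unfolding search_com_def
proof (rule runs_in_Seq)
  have "unit * (k + 5) = unit * (k + 4) + unit" for k by (simp add: algebra_simps)
  moreover have "56 \<le> unit" by (simp add: unit_def)
  ultimately show "50 + (unit * (8 * bits N * N + 8 * N + 4) + 5) + 1 \<le> unit * (8 * bits N * N + 8 * N + 5)"
    by simp
next
  have N: "nat_mem M aN 0 = N" using r by (simp add: prepared_def)
  show "runs_in P first_task_com M 50
      (\<lambda>M'. tasks M' = [(0, 0, 0, 0, N, 0, N)] \<and> frame {20..27} M M')"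
    apply (simp add: first_task_com_def runs_in_def N cong: runs_weak_cong)
    apply (simp add: tasks_def)
    apply (simp add: frame_def)
    done
next
  fix M1 assume a: "tasks M1 = [(0, 0, 0, 0, N, 0, N)] \<and> frame {20..27} M M1"
  then have se: "frame {20..27} M M1" by blast
  have "ready M1" using ready_frame[OF se] r by auto
  moreover have "dsu w M1" using dsu_cong[OF se, of w] d by simp
  moreover have st: "stack M1 = []" using stack_cong[OF se] s by simp
  moreover have "result M1 = \<infinity>" using result_cong[OF se] v by simp
  ultimately have "window_state M1 [(0, 0, 0, 0, N, 0, N)] [] \<infinity>" using a by (simp add: window_state_def)
  \<comment> \<open>The first task has the empty common part \<open>{N..<0}\<close> and spans all
    left ends, so nothing is yet claimed about the initial result
    \<open>\<infinity>\<close>.\<close>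
  then have inv: "search_inv M1" unfolding search_inv_def using reach_le
    by (intro exI[of _ "[(0, 0, 0, 0, N, 0, N)]"] exI[of _ "[]"] exI[of _ \<infinity>]) auto
  have m: "search_measure M1 = unit * (8 * bits N * N + 8 * N + 4)"
    using a st by (simp add: search_measure_def)
  show "runs_in P (While (NLess (NConst 0) (Var aTp)) (process_com record_com)) M1
      (unit * (8 * bits N * N + 8 * N + 4) + 5) ?Q"
  proof (rule runs_in_mono[OF runs_in_While[where I = search_inv and m = search_measure, OF inv]])
    fix M' assume "search_inv M'" "bval P M' (NLess (NConst 0) (Var aTp))"
    then obtain t where "runs_in P (process_com record_com) M' t
        (\<lambda>M''. search_inv M'' \<and> search_measure M'' + t + 5 \<le> search_measure M')"
      using search_step[of M'] by auto
    then show "\<exists>t. runs_in P (process_com record_com) M' t (\<lambda>M''. search_inv M'' \<and>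
        search_measure M'' + t + bcost (NLess (NConst 0) (Var aTp)) + 1 \<le> search_measure M')"
      by (intro exI[of _ t]) (auto elim: runs_in_mono)
  next
    fix M' assume x: "search_inv M' \<and> \<not> bval P M' (NLess (NConst 0) (Var aTp))"
    then have "tasks M' = []" by (simp add: tasks_def)
    then obtain v where v: "result M' = v" "\<forall>l<N. v \<le> candidate l" "(INF l\<in>{..<N}. candidate l) \<le> v"
      using x unfolding search_inv_def window_state_def by auto
    then have "v \<le> (INF l\<in>{..<N}. candidate l)" by (intro INF_greatest) simp
    then show "?Q M'" using v by simp
  qed (simp add: m)
qed

end

section \<open>Sorting\<close>

abbreviation (input) "aTmp \<equiv> 7 :: nat"
abbreviation (input) "aWidth \<equiv> 40 :: nat"
abbreviation (input) "aStart \<equiv> 41 :: nat"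
abbreviation (input) "aM \<equiv> 42 :: nat"
abbreviation (input) "aE \<equiv> 43 :: nat"
abbreviation (input) "aI \<equiv> 44 :: nat"
abbreviation (input) "aJ \<equiv> 45 :: nat"
abbreviation (input) "aK \<equiv> 46 :: nat"

text \<open>Conjunction evaluates both sides, so keys may be read beyond the end of a run. This is
  harmless, as memory is total and the comparison is then irrelevant.\<close>

definition merge_cond :: bexp where
  "merge_cond = BAnd (NLess (Var aI) (Var aM)) (BNot (BAnd (NLess (Var aJ) (Var aE))
     (RLess (RCell 1 (NCell aOrd (Var aJ))) (RCell 1 (NCell aOrd (Var aI))))))"

definition merge_step_com :: com where
  "merge_step_com =
     Cond merge_cond
        (NAssign aTmp (Var aK) (NCell aOrd (Var aI));; incr aI)
        (NAssign aTmp (Var aK) (NCell aOrd (Var aJ));; incr aJ);;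
      incr aK"

definition merge_com :: com where
  "merge_com = While (NLess (Var aK) (Var aE))
     merge_step_com"

definition bounds_com :: com where
  "bounds_com = assign aM (NSub (Var aN) (NSub (Var aN) (NAdd (Var aStart) (Var aWidth))));;
     assign aE (NSub (Var aN) (NSub (Var aN) (NAdd (Var aM) (Var aWidth))));;
     assign aI (Var aStart);; assign aJ (Var aM);; assign aK (Var aStart)"

definition merge_pass_com :: com where
  "merge_pass_com = While (NLess (Var aStart) (Var aN))
     (bounds_com;;
      merge_com;; assign aStart (Var aE))"

definition copy_com :: com where
  "copy_com = While (NLess (Var aK) (Var aN))
     (NAssign aOrd (Var aK) (NCell aTmp (Var aK));; incr aK)"

text \<open>Bottom-up merge sort: block widths double by addition, so neither recursion nor division
  is needed.\<close>

definition sort_com :: com where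
  "sort_com = assign aWidth (NConst 1);;
     While (NLess (Var aWidth) (Var aN))
       (assign aStart (NConst 0);; merge_pass_com;; assign aK (NConst 0);; copy_com;;
        assign aWidth (NAdd (Var aWidth) (Var aWidth)))"

lemma upt_Suc_snoc: "a \<le> b \<Longrightarrow> [a..<Suc b] = [a..<b] @ [b]"
  by simp

text \<open>One iteration of the merge, free of machine states. The third part of the invariant,
  that everything written is at most everything unread, is what allows the smaller head to be
  appended.\<close>

lemma merge_step:
  fixes key :: "nat \<Rightarrow> real" and a b :: "nat \<Rightarrow> nat"
  assumes ij: "lo \<le> i" "i \<le> m" "m \<le> j" "j \<le> e" "k = i + j - m"
    and b: "mset (map b [lo..<k]) = mset (map a [lo..<i]) + mset (map a [m..<j])"
      "sorted (map (\<lambda>x. key (b x)) [lo..<k])"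
      "\<forall>x\<in>{lo..<k}. \<forall>y\<in>{i..<m} \<union> {j..<e}. key (b x) \<le> key (a y)"
    and s: "sorted (map (\<lambda>x. key (a x)) [lo..<m])" "sorted (map (\<lambda>x. key (a x)) [m..<e])"
    and ne: "k < e"
    and c: "if i < m \<and> \<not> (j < e \<and> key (a j) < key (a i)) then b' = b(k := a i) \<and> i' = Suc i \<and> j' = j
      else b' = b(k := a j) \<and> i' = i \<and> j' = Suc j"
  shows "lo \<le> i' \<and> i' \<le> m \<and> m \<le> j' \<and> j' \<le> e \<and> Suc k = i' + j' - m \<and>
    mset (map b' [lo..<Suc k]) = mset (map a [lo..<i']) + mset (map a [m..<j']) \<and>
    sorted (map (\<lambda>x. key (b' x)) [lo..<Suc k]) \<and>
    (\<forall>x\<in>{lo..<Suc k}. \<forall>y\<in>{i'..<m} \<union> {j'..<e}. key (b' x) \<le> key (a y)) \<and> (\<forall>x<lo. b' x = b x)"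
proof -
  have sA: "key (a x) \<le> key (a y)" if "lo \<le> x" "x \<le> y" "y < m" for x y
    using sorted_nth_mono[OF s(1), of "x - lo" "y - lo"] that by simp
  have sB: "key (a x) \<le> key (a y)" if "m \<le> x" "x \<le> y" "y < e" for x y
    using sorted_nth_mono[OF s(2), of "x - m" "y - m"] that by simp
  have k: "lo \<le> k" using ij by simp
  have eq: "map (b(k := v)) [lo..<k] = map b [lo..<k]" "map (\<lambda>x. key ((b(k := v)) x)) [lo..<k] = map (\<lambda>x. key (b x)) [lo..<k]" for v
    by simp_all
  have snoc: "sorted (map (\<lambda>x. key ((b(k := v)) x)) [lo..<Suc k])"
    if "\<forall>x\<in>{lo..<k}. key (b x) \<le> key v" for v
    unfolding upt_Suc_snoc[OF k] map_append eq using b(2) that by (auto simp: sorted_append)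
  show ?thesis
  proof (cases "i < m \<and> \<not> (j < e \<and> key (a j) < key (a i))")
    case True
    then have c': "b' = b(k := a i)" "i' = Suc i" "j' = j" using c by auto
    have min: "key (a i) \<le> key (a y)" if "y \<in> {i..<m} \<union> {j..<e}" for y
    proof (cases "y \<in> {i..<m}")
      case True
      then show ?thesis using sA ij by auto
    next
      case False
      then have "j \<le> y" "y < e" using that by auto
      then show ?thesis using \<open>i < m \<and> _\<close> sB[of j y] ij by fastforce
    qed
    have "mset (map b' [lo..<Suc k]) = mset (map a [lo..<i']) + mset (map a [m..<j'])"
      unfolding c' upt_Suc_snoc[OF k] upt_Suc_snoc[OF ij(1)] map_append eq using b(1) by simp
    moreover have "sorted (map (\<lambda>x. key (b' x)) [lo..<Suc k])"
      unfolding c' using b(3) True by (intro snoc) auto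
    moreover have "\<forall>x\<in>{lo..<Suc k}. \<forall>y\<in>{i'..<m} \<union> {j'..<e}. key (b' x) \<le> key (a y)"
    proof (intro ballI)
      fix x y assume x: "x \<in> {lo..<Suc k}" and y: "y \<in> {i'..<m} \<union> {j'..<e}"
      have "y \<in> {i..<m} \<union> {j..<e}" using y c' by auto
      then show "key (b' x) \<le> key (a y)" using x min[of y] b(3) c' by (cases "x = k") auto
    qed
    ultimately show ?thesis using ij True k unfolding c' by auto
  next
    case False
    then have c': "b' = b(k := a j)" "i' = i" "j' = Suc j" using c by auto
    have je: "j < e" using False ij ne by auto
    have min: "key (a j) \<le> key (a y)" if "y \<in> {i..<m} \<union> {j..<e}" for y
    proof (cases "y \<in> {i..<m}")
      case True
      then have "i < m" by simp
      then have "key (a j) \<le> key (a i)" using False by auto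
      also have "\<dots> \<le> key (a y)" using True sA ij by auto
      finally show ?thesis .
    next
      case False
      then show ?thesis using that sB ij by auto
    qed
    have "mset (map b' [lo..<Suc k]) = mset (map a [lo..<i']) + mset (map a [m..<j'])"
      unfolding c' upt_Suc_snoc[OF k] upt_Suc_snoc[OF ij(3)] map_append eq using b(1) by simp
    moreover have "sorted (map (\<lambda>x. key (b' x)) [lo..<Suc k])"
      unfolding c' using b(3) je by (intro snoc) auto
    moreover have "\<forall>x\<in>{lo..<Suc k}. \<forall>y\<in>{i'..<m} \<union> {j'..<e}. key (b' x) \<le> key (a y)"
    proof (intro ballI)
      fix x y assume x: "x \<in> {lo..<Suc k}" and y: "y \<in> {i'..<m} \<union> {j'..<e}"
      have "y \<in> {i..<m} \<union> {j..<e}" using y c' by auto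
      then show "key (b' x) \<le> key (a y)" using x min[of y] b(3) c' by (cases "x = k") auto
    qed
    ultimately show ?thesis using ij je k unfolding c' by auto
  qed
qed

text \<open>That the target below \<open>lo\<close> is untouched protects the blocks merged earlier
  in the same pass.\<close>

lemma run_merge:
  assumes v: "nat_mem M aI 0 = lo" "nat_mem M aM 0 = m" "nat_mem M aJ 0 = m" "nat_mem M aE 0 = e" "nat_mem M aK 0 = lo"
    and le: "lo \<le> m" "m \<le> e"
  defines "a \<equiv> nat_mem M aOrd" and "key \<equiv> real_mem M 1"
  assumes s: "sorted (map (\<lambda>x. key (a x)) [lo..<m])" "sorted (map (\<lambda>x. key (a x)) [m..<e])"
  shows "runs_in P merge_com M (60 * (e - lo) + 6) (\<lambda>M'.
    mset (map (nat_mem M' aTmp) [lo..<e]) = mset (map a [lo..<e]) \<and>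
    sorted (map (\<lambda>x. key (nat_mem M' aTmp x)) [lo..<e]) \<and>
    (\<forall>x<lo. nat_mem M' aTmp x = nat_mem M aTmp x) \<and> frame {7, 44, 45, 46} M M')"
    (is "runs_in _ _ _ _ ?Q")
proof -
  let ?I = "\<lambda>M'. \<exists>b i j k. nat_mem M' aTmp = b \<and> nat_mem M' aI 0 = i \<and> nat_mem M' aJ 0 = j \<and> nat_mem M' aK 0 = k \<and>
    lo \<le> i \<and> i \<le> m \<and> m \<le> j \<and> j \<le> e \<and> k = i + j - m \<and>
    mset (map b [lo..<k]) = mset (map a [lo..<i]) + mset (map a [m..<j]) \<and>
    sorted (map (\<lambda>x. key (b x)) [lo..<k]) \<and>
    (\<forall>x\<in>{lo..<k}. \<forall>y\<in>{i..<m} \<union> {j..<e}. key (b x) \<le> key (a y)) \<and>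
    (\<forall>x<lo. b x = nat_mem M aTmp x) \<and> frame {7, 44, 45, 46} M M'"
  have I0: "?I M" using v le by simp
  show ?thesis unfolding merge_com_def
  proof (rule runs_in_mono[OF runs_in_While[where I = ?I and m = "\<lambda>M'. 60 * (e - nat_mem M' aK 0)", OF I0]])
    fix M' assume "?I M'" and bv: "bval P M' (NLess (Var aK) (Var aE))"
    then obtain b i j k where h: "nat_mem M' aTmp = b" "nat_mem M' aI 0 = i" "nat_mem M' aJ 0 = j" "nat_mem M' aK 0 = k"
      and ij: "lo \<le> i" "i \<le> m" "m \<le> j" "j \<le> e" "k = i + j - m"
      and b: "mset (map b [lo..<k]) = mset (map a [lo..<i]) + mset (map a [m..<j])"
      "sorted (map (\<lambda>x. key (b x)) [lo..<k])"
      "\<forall>x\<in>{lo..<k}. \<forall>y\<in>{i..<m} \<union> {j..<e}. key (b x) \<le> key (a y)"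
      and fr: "\<forall>x<lo. b x = nat_mem M aTmp x" "frame {7, 44, 45, 46} M M'" by blast
    have m: "nat_mem M' aOrd = a" "nat_mem M' aM 0 = m" "nat_mem M' aE 0 = e" "real_mem M' 1 = key"
      using fr(2) v by (auto simp: frame_def a_def key_def)
    have ke: "k < e" using bv h m by simp
    let ?c = "i < m \<and> \<not> (j < e \<and> key (a j) < key (a i))"
    define b' i' j' where "b' = (if ?c then b(k := a i) else b(k := a j))"
      and "i' = (if ?c then Suc i else i)" and "j' = (if ?c then j else Suc j)"
    have c: "if ?c then b' = b(k := a i) \<and> i' = Suc i \<and> j' = j else b' = b(k := a j) \<and> i' = i \<and> j' = Suc j"
    proof (cases ?c)
      case True
      then show ?thesis unfolding b'_def i'_def j'_def if_P[OF True] by blast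
    next
      case False
      then show ?thesis unfolding b'_def i'_def j'_def if_not_P[OF False] by blast
    qed
    note step = merge_step[OF ij b s ke c]
    have bc: "bval P M' merge_cond \<longleftrightarrow> ?c" using h m by (simp add: merge_cond_def)
    have "runs_in P merge_step_com M' 50
      (\<lambda>M''. nat_mem M'' aTmp = b' \<and> nat_mem M'' aI 0 = i' \<and> nat_mem M'' aJ 0 = j' \<and>
        nat_mem M'' aK 0 = Suc k \<and> frame {7, 44, 45, 46} M' M'')"
    proof (cases ?c)
      case True
      then have "bval P M' merge_cond" "b' = b(k := a i)" "i' = Suc i" "j' = j"
        using bc c by (simp_all add: True)
      then show ?thesis using h m by (simp add: runs_in_def frame_def merge_step_com_def merge_cond_def[THEN arg_cong, of bcost])
    next
      case False
      then have "\<not> bval P M' merge_cond" "b' = b(k := a j)" "i' = i" "j' = Suc j"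
        using bc c by (simp_all only: if_False simp_thms)
      then show ?thesis using h m by (simp add: runs_in_def frame_def merge_step_com_def merge_cond_def[THEN arg_cong, of bcost])
    qed
    then show "\<exists>t. runs_in P merge_step_com M' t
      (\<lambda>M''. ?I M'' \<and> 60 * (e - nat_mem M'' aK 0) + t + bcost (NLess (Var aK) (Var aE)) + 1
        \<le> 60 * (e - nat_mem M' aK 0))"
    proof (intro exI[of _ 50], elim runs_in_mono)
      fix M'' assume x: "nat_mem M'' aTmp = b' \<and> nat_mem M'' aI 0 = i' \<and> nat_mem M'' aJ 0 = j' \<and>
        nat_mem M'' aK 0 = Suc k \<and> frame {7, 44, 45, 46} M' M''"
      have "frame {7, 44, 45, 46} M M''" using frame_trans[OF fr(2)] x by blast
      moreover have "\<forall>x<lo. b' x = nat_mem M aTmp x" using step fr(1) by metis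
      ultimately have "?I M''" using x step
        by (intro exI[of _ b'] exI[of _ i'] exI[of _ j'] exI[of _ "Suc k"]) blast
      moreover have "nat_mem M'' aK 0 = Suc k" "e - k = Suc (e - Suc k)" using x ke by simp_all
      then have "60 * (e - nat_mem M'' aK 0) + 50 + bcost (NLess (Var aK) (Var aE)) + 1
        \<le> 60 * (e - nat_mem M' aK 0)" using h(4) by simp
      ultimately show "?I M'' \<and> 60 * (e - nat_mem M'' aK 0) + 50 + bcost (NLess (Var aK) (Var aE)) + 1
        \<le> 60 * (e - nat_mem M' aK 0)" by (rule conjI)
    qed simp
  next
    fix M' assume x: "?I M' \<and> \<not> bval P M' (NLess (Var aK) (Var aE))"
    then obtain b i j k where h: "nat_mem M' aTmp = b" "nat_mem M' aK 0 = k"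
      and ij: "lo \<le> i" "i \<le> m" "m \<le> j" "j \<le> e" "k = i + j - m"
      and b: "mset (map b [lo..<k]) = mset (map a [lo..<i]) + mset (map a [m..<j])"
      "sorted (map (\<lambda>x. key (b x)) [lo..<k])"
      and fr: "\<forall>x<lo. b x = nat_mem M aTmp x" "frame {7, 44, 45, 46} M M'" by blast
    have "nat_mem M' aE 0 = e" using fr(2) v by (simp add: frame_def)
    then have "e \<le> k" using x h by simp
    then have "k = e" "i = m" "j = e" using ij by simp_all
    moreover have "mset (map a [lo..<m]) + mset (map a [m..<e]) = mset (map a [lo..<e])"
    proof -
      have "[lo..<e] = [lo..<m] @ [m..<e]" using le upt_add_eq_append[of lo m "e - m"] by simp
      then show ?thesis by simp
    qed
    ultimately show "?Q M'"
      using b fr h(1) by simp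
  qed (use v in simp)
qed

text \<open>The index \<open>q\<close> is unbounded: the cut at \<open>N\<close> shortens the last
  block and empties all later ones.\<close>

definition blocks_sorted :: "(nat \<Rightarrow> real) \<Rightarrow> (nat \<Rightarrow> nat) \<Rightarrow> nat \<Rightarrow> nat \<Rightarrow> bool" where
  "blocks_sorted key a N w \<longleftrightarrow> (\<forall>q. sorted (map (\<lambda>x. key (a x)) [q * w..<min (q * w + w) N]))"

lemma run_merge_pass:
  assumes v: "nat_mem M aN 0 = N" "nat_mem M aWidth 0 = w" "nat_mem M aStart 0 = 0" "0 < w"
  defines "a \<equiv> nat_mem M aOrd" and "key \<equiv> real_mem M 1"
  assumes s: "blocks_sorted key a N w"
  shows "runs_in P merge_pass_com M (160 * N + 6) (\<lambda>M'.
    mset (map (nat_mem M' aTmp) [0..<N]) = mset (map a [0..<N]) \<and>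
    blocks_sorted key (nat_mem M' aTmp) N (w + w) \<and> frame ({7} \<union> {40..46} - {40}) M M')"
    (is "runs_in _ _ _ _ ?Q")
proof -
  let ?I = "\<lambda>M'. \<exists>Q. nat_mem M' aStart 0 = min (Q * (w + w)) N \<and>
    mset (map (nat_mem M' aTmp) [0..<min (Q * (w + w)) N]) = mset (map a [0..<min (Q * (w + w)) N]) \<and>
    (\<forall>q<Q. sorted (map (\<lambda>x. key (nat_mem M' aTmp x)) [q * (w + w)..<min (q * (w + w) + (w + w)) N])) \<and>
    frame ({7} \<union> {40..46} - {40}) M M'"
  have I0: "?I M" using v by (intro exI[of _ 0]) simp
  let ?body = "bounds_com;;
      merge_com;; assign aStart (Var aE)"
  show ?thesis unfolding merge_pass_com_def
  proof (rule runs_in_mono[OF runs_in_While[where I = ?I and m = "\<lambda>M'. 160 * (N - nat_mem M' aStart 0)", OF I0]])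
    fix M' assume "?I M'" and bv: "bval P M' (NLess (Var aStart) (Var aN))"
    then obtain Q where Q: "nat_mem M' aStart 0 = min (Q * (w + w)) N"
      "mset (map (nat_mem M' aTmp) [0..<min (Q * (w + w)) N]) = mset (map a [0..<min (Q * (w + w)) N])"
      "\<forall>q<Q. sorted (map (\<lambda>x. key (nat_mem M' aTmp x)) [q * (w + w)..<min (q * (w + w) + (w + w)) N])"
      and fr: "frame ({7} \<union> {40..46} - {40}) M M'" by blast
    define lo where "lo = Q * (w + w)"
    define m where "m = min (lo + w) N"
    define e where "e = min (lo + (w + w)) N"
    have mm: "nat_mem M' aN 0 = N" "nat_mem M' aWidth 0 = w" "nat_mem M' aOrd = a" "real_mem M' 1 = key"
      using fr v by (auto simp: frame_def a_def key_def)
    have loN: "lo < N" using bv Q(1) mm by (simp add: lo_def)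
    then have st: "nat_mem M' aStart 0 = lo" "min (Q * (w + w)) N = lo" using Q(1) by (simp_all add: lo_def)
    have le: "lo \<le> m" "m \<le> e" "lo < e" "e \<le> N" using loN v(4) by (auto simp: m_def e_def)
    have sub: "N - (N - x) = min x N" for x by auto
    have eq: "min (m + w) N = e" by (auto simp: m_def e_def)
    have S1: "sorted (map (\<lambda>x. key (a x)) [lo..<m])"
    proof -
      have "lo = 2 * Q * w" by (simp add: lo_def algebra_simps)
      then show ?thesis using s[unfolded blocks_sorted_def, rule_format, of "2 * Q"] by (simp add: m_def)
    qed
    have S2: "sorted (map (\<lambda>x. key (a x)) [m..<e])"
    proof (cases "lo + w \<le> N")
      case True
      then have "m = (2 * Q + 1) * w" "e = min ((2 * Q + 1) * w + w) N"
        by (simp_all add: lo_def m_def e_def algebra_simps)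
      then show ?thesis using s[unfolded blocks_sorted_def, rule_format, of "2 * Q + 1"] by simp
    qed (simp add: m_def e_def)
    let ?fin = "\<lambda>M''. mset (map (nat_mem M'' aTmp) [lo..<e]) = mset (map a [lo..<e]) \<and>
        sorted (map (\<lambda>x. key (nat_mem M'' aTmp x)) [lo..<e]) \<and>
        (\<forall>x<lo. nat_mem M'' aTmp x = nat_mem M' aTmp x) \<and> nat_mem M'' aStart 0 = e \<and>
        frame ({7} \<union> {40..46} - {40}) M M''"
    have "runs_in P ?body M' (60 * (e - lo) + 80) ?fin"
    proof (rule runs_in_Seq)
      show "runs_in P bounds_com M' 55
       (\<lambda>M''. nat_mem M'' aI 0 = lo \<and> nat_mem M'' aM 0 = m \<and> nat_mem M'' aJ 0 = m \<and> nat_mem M'' aE 0 = e \<and>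
         nat_mem M'' aK 0 = lo \<and> frame {42..46} M' M'')"
        using st(1) mm eq
        apply (simp add: bounds_com_def runs_in_def sub m_def[symmetric] cong: runs_weak_cong)
        apply (simp add: frame_def)
        done
    next
      fix M1 assume x: "nat_mem M1 aI 0 = lo \<and> nat_mem M1 aM 0 = m \<and> nat_mem M1 aJ 0 = m \<and> nat_mem M1 aE 0 = e \<and>
         nat_mem M1 aK 0 = lo \<and> frame {42..46} M' M1"
      then have m1: "nat_mem M1 aOrd = a" "real_mem M1 1 = key" "nat_mem M1 aTmp = nat_mem M' aTmp"
        using mm by (auto simp: frame_def)
      show "runs_in P (merge_com;; assign aStart (Var aE)) M1 (60 * (e - lo) + 6 + 5 + 1) ?fin"
      proof (rule runs_in_Seq[OF run_merge])
        fix M2 assume y: "mset (map (nat_mem M2 aTmp) [lo..<e]) = mset (map (nat_mem M1 aOrd) [lo..<e]) \<and>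
          sorted (map (\<lambda>x. real_mem M1 1 (nat_mem M2 aTmp x)) [lo..<e]) \<and>
          (\<forall>x<lo. nat_mem M2 aTmp x = nat_mem M1 aTmp x) \<and> frame {7, 44, 45, 46} M1 M2"
        have e2: "nat_mem M2 aE 0 = e" using x y by (simp add: frame_def)
        have "frame ({7} \<union> {40..46} - {40}) M M2"
        proof -
          have "frame ({7} \<union> {40..46} - {40}) M' M1"
            by (rule frame_mono[of "{42..46}"]) (use x in auto)
          moreover have "frame ({7} \<union> {40..46} - {40}) M1 M2"
            by (rule frame_mono[of "{7, 44, 45, 46}"]) (use y in auto)
          ultimately show ?thesis using fr frame_trans by blast
        qed
        then show "runs_in P (assign aStart (Var aE)) M2 5 ?fin"
          using y m1 e2 by (simp add: runs_in_def frame_def)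
      qed (use x m1 le S1 S2 in simp_all)
    qed simp
    then show "\<exists>t. runs_in P ?body M' t (\<lambda>M''. ?I M'' \<and>
        160 * (N - nat_mem M'' aStart 0) + t + bcost (NLess (Var aStart) (Var aN)) + 1
        \<le> 160 * (N - nat_mem M' aStart 0))"
    proof (intro exI[of _ "60 * (e - lo) + 80"], elim runs_in_mono)
      fix M'' assume x: "?fin M''"
      have e: "min (Suc Q * (w + w)) N = e" by (simp add: e_def lo_def algebra_simps)
      have spl: "[0..<e] = [0..<lo] @ [lo..<e]" using le upt_add_eq_append[of 0 lo "e - lo"] by simp
      have low: "map (nat_mem M'' aTmp) [0..<lo] = map (nat_mem M' aTmp) [0..<lo]" using x by simp
      have "mset (map (nat_mem M'' aTmp) [0..<e]) = mset (map a [0..<e])"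
        unfolding spl map_append mset_append low using x Q(2) st(2) by simp
      moreover have "sorted (map (\<lambda>x. key (nat_mem M'' aTmp x)) [q * (w + w)..<min (q * (w + w) + (w + w)) N])"
        if "q < Suc Q" for q
      proof (cases "q = Q")
        case True
        then show ?thesis using x by (simp add: lo_def e_def)
      next
        case False
        then have "Suc q \<le> Q" using that by simp
        then have "Suc q * (w + w) \<le> lo" unfolding lo_def by (rule mult_le_mono1)
        then have eq: "map (\<lambda>x. key (nat_mem M'' aTmp x)) [q * (w + w)..<min (q * (w + w) + (w + w)) N] =
            map (\<lambda>x. key (nat_mem M' aTmp x)) [q * (w + w)..<min (q * (w + w) + (w + w)) N]"
          using x by simp
        show ?thesis unfolding eq using Q(3) \<open>Suc q \<le> Q\<close> by simp
      qed
      ultimately have "?I M''" using x unfolding e[symmetric] by blast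
      \<comment> \<open>Every merged block is nonempty, so the surplus \<open>100 * (e - lo)\<close>
        covers the constant costs.\<close>
      moreover have "160 * (N - e) + (60 * (e - lo) + 80) + 6 \<le> 160 * (N - lo)" using le by simp
      then have "160 * (N - nat_mem M'' aStart 0) + (60 * (e - lo) + 80) + bcost (NLess (Var aStart) (Var aN)) + 1
        \<le> 160 * (N - nat_mem M' aStart 0)" using x st(1) by simp
      ultimately show "?I M'' \<and>
        160 * (N - nat_mem M'' aStart 0) + (60 * (e - lo) + 80) + bcost (NLess (Var aStart) (Var aN)) + 1
        \<le> 160 * (N - nat_mem M' aStart 0)" by (rule conjI)
    qed simp
  next
    fix M' assume x: "?I M' \<and> \<not> bval P M' (NLess (Var aStart) (Var aN))"
    then obtain Q where Q: "nat_mem M' aStart 0 = min (Q * (w + w)) N"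
      "mset (map (nat_mem M' aTmp) [0..<min (Q * (w + w)) N]) = mset (map a [0..<min (Q * (w + w)) N])"
      "\<forall>q<Q. sorted (map (\<lambda>x. key (nat_mem M' aTmp x)) [q * (w + w)..<min (q * (w + w) + (w + w)) N])"
      and fr: "frame ({7} \<union> {40..46} - {40}) M M'" by blast
    have "nat_mem M' aN 0 = N" using fr v by (simp add: frame_def)
    then have QN: "min (Q * (w + w)) N = N" "N \<le> Q * (w + w)" using x Q(1) by auto
    have "sorted (map (\<lambda>x. key (nat_mem M' aTmp x)) [q * (w + w)..<min (q * (w + w) + (w + w)) N])" for q
    proof (cases "q < Q")
      case False
      then have "Q * (w + w) \<le> q * (w + w)" by (intro mult_le_mono1) simp
      then have "N \<le> q * (w + w)" by (rule order_trans[OF QN(2)])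
      then show ?thesis by simp
    qed (use Q(3) in blast)
    then show "?Q M'"
      using Q(2) QN fr by (simp add: blocks_sorted_def)
  qed (use v in simp)
qed

lemma run_copy:
  assumes v: "nat_mem M aN 0 = N" "nat_mem M aK 0 = 0"
  shows "runs_in P copy_com M (30 * N + 6) (\<lambda>M'.
    (\<forall>x<N. nat_mem M' aOrd x = nat_mem M aTmp x) \<and> frame {5, 46} M M')"
    (is "runs_in _ _ _ _ ?Q")
proof -
  let ?I = "\<lambda>M'. (\<forall>x<nat_mem M' aK 0. nat_mem M' aOrd x = nat_mem M aTmp x) \<and> frame {5, 46} M M'"
  have I0: "?I M" using v by simp
  show ?thesis unfolding copy_com_def
  proof (rule runs_in_mono[OF runs_in_While[where I = ?I and m = "\<lambda>M'. 30 * (N - nat_mem M' aK 0)", OF I0]])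
    fix M' assume I: "?I M'" and b: "bval P M' (NLess (Var aK) (Var aN))"
    have "nat_mem M' aN 0 = N" "nat_mem M' aTmp = nat_mem M aTmp" using I v by (auto simp: frame_def)
    moreover from this have "N - nat_mem M' aK 0 = Suc (N - Suc (nat_mem M' aK 0))" using b by simp
    ultimately show "\<exists>t. runs_in P (NAssign aOrd (Var aK) (NCell aTmp (Var aK));; incr aK) M' t
      (\<lambda>M''. ?I M'' \<and> 30 * (N - nat_mem M'' aK 0) + t + bcost (NLess (Var aK) (Var aN)) + 1
        \<le> 30 * (N - nat_mem M' aK 0))"
      using I by (intro exI[of _ 20]) (auto simp: runs_in_def frame_def less_Suc_eq)
  next
    fix M' assume x: "?I M' \<and> \<not> bval P M' (NLess (Var aK) (Var aN))"
    then have "nat_mem M' aN 0 = N" using v by (simp add: frame_def)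
    then show "?Q M'"
      using x by auto
  qed (use v in simp)
qed

lemma run_sort:
  assumes N: "nat_mem M aN 0 = N"
  defines "a \<equiv> nat_mem M aOrd" and "key \<equiv> real_mem M 1"
  shows "runs_in P sort_com M ((190 * N + 50) * (bits N + 1) + 12) (\<lambda>M'.
    mset (map (nat_mem M' aOrd) [0..<N]) = mset (map a [0..<N]) \<and>
    sorted (map (\<lambda>x. key (nat_mem M' aOrd x)) [0..<N]) \<and> frame ({5, 7} \<union> {40..46}) M M')"
    (is "runs_in _ _ _ _ ?Q")
  unfolding sort_com_def
proof (rule runs_in_Seq)
  let ?M1 = "M\<lparr>nat_mem := write_cell (nat_mem M) aWidth 0 1\<rparr>"
  show "runs_in P (assign aWidth (NConst 1)) M 4 (\<lambda>M'. M' = ?M1)" by (simp add: runs_in_def)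
  fix M1 assume M1: "M1 = ?M1"
  let ?I = "\<lambda>M'. \<exists>w. nat_mem M' aWidth 0 = w \<and> 0 < w \<and>
     mset (map (nat_mem M' aOrd) [0..<N]) = mset (map a [0..<N]) \<and>
     blocks_sorted key (nat_mem M' aOrd) N w \<and> frame ({5, 7} \<union> {40..46}) M M'"
  have "blocks_sorted key a N 1"
  proof -
    have "sorted (map (\<lambda>x. key (a x)) [q..<min (Suc q) N])" for q by (cases "q < N") (simp_all add: min_def)
    then show ?thesis by (simp add: blocks_sorted_def)
  qed
  then have I0: "?I M1" unfolding M1 by (intro exI[of _ 1]) (simp add: a_def frame_def)
  let ?body = "assign aStart (NConst 0);; merge_pass_com;; assign aK (NConst 0);; copy_com;;
        assign aWidth (NAdd (Var aWidth) (Var aWidth))"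
  \<comment> \<open>Doubling the width raises its binary length by one, so this counts the remaining
    passes.\<close>
  let ?m = "\<lambda>M'. (190 * N + 50) * (bits N + 1 - bits (nat_mem M' aWidth 0))"
  show "runs_in P (While (NLess (Var aWidth) (Var aN)) ?body) M1 ((190 * N + 50) * (bits N + 1) + 6) ?Q"
  proof (rule runs_in_mono[OF runs_in_While[where I = ?I and m = ?m, OF I0]])
    fix M' assume "?I M'" and b: "bval P M' (NLess (Var aWidth) (Var aN))"
    then obtain w where w: "nat_mem M' aWidth 0 = w" "0 < w"
     "mset (map (nat_mem M' aOrd) [0..<N]) = mset (map a [0..<N])"
     "blocks_sorted key (nat_mem M' aOrd) N w" "frame ({5, 7} \<union> {40..46}) M M'" by blast
    have N': "nat_mem M' aN 0 = N" and key: "real_mem M' 1 = key"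
      using w(5) N by (simp_all add: frame_def key_def)
    have wN: "w < N" using b w(1) N' by simp
    let ?fin = "\<lambda>M''. nat_mem M'' aWidth 0 = w + w \<and> mset (map (nat_mem M'' aOrd) [0..<N]) = mset (map a [0..<N]) \<and>
      blocks_sorted key (nat_mem M'' aOrd) N (w + w) \<and> frame ({5, 7} \<union> {40..46}) M M''"
    have "runs_in P ?body M' (190 * N + 40) ?fin"
    proof (rule runs_in_Seq)
      let ?M2 = "M'\<lparr>nat_mem := write_cell (nat_mem M') aStart 0 0\<rparr>"
      show "runs_in P (assign aStart (NConst 0)) M' 3 (\<lambda>M''. M'' = ?M2)" by (simp add: runs_in_def)
      fix M2 assume M2: "M2 = ?M2"
      have 2: "nat_mem M2 aN 0 = N" "nat_mem M2 aWidth 0 = w" "nat_mem M2 aStart 0 = 0"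
        "nat_mem M2 aOrd = nat_mem M' aOrd" "real_mem M2 1 = key"
        "frame ({5, 7} \<union> {40..46}) M M2"
        using w N' key by (simp_all add: M2 frame_def)
      have bs2: "blocks_sorted (real_mem M2 1) (nat_mem M2 aOrd) N w" using 2 w(4) by simp
      show "runs_in P (merge_pass_com;; assign aK (NConst 0);; copy_com;;
        assign aWidth (NAdd (Var aWidth) (Var aWidth))) M2 (190 * N + 36) ?fin"
      proof (rule runs_in_Seq[OF run_merge_pass[OF 2(1-3) w(2) bs2]])
        fix M3 assume x: "mset (map (nat_mem M3 aTmp) [0..<N]) = mset (map (nat_mem M2 aOrd) [0..<N]) \<and>
          blocks_sorted (real_mem M2 1) (nat_mem M3 aTmp) N (w + w) \<and> frame ({7} \<union> {40..46} - {40}) M2 M3"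
        have se3: "frame ({5, 7} \<union> {40..46}) M M3"
          by (rule frame_trans[OF 2(6) frame_mono[of "{7} \<union> {40..46} - {40}"]]) (use x in auto)
        have w3: "nat_mem M3 aWidth 0 = w" "nat_mem M3 aN 0 = N" using x 2(1,2) by (simp_all add: frame_def)
        show "runs_in P (assign aK (NConst 0);; copy_com;;
          assign aWidth (NAdd (Var aWidth) (Var aWidth))) M3 (30 * N + 29) ?fin"
        proof (rule runs_in_Seq)
          let ?M4 = "M3\<lparr>nat_mem := write_cell (nat_mem M3) aK 0 0\<rparr>"
          show "runs_in P (assign aK (NConst 0)) M3 3 (\<lambda>M''. M'' = ?M4)" by (simp add: runs_in_def)
          fix M4 assume M4: "M4 = ?M4"
          have 4: "nat_mem M4 aN 0 = N" "nat_mem M4 aK 0 = 0" "nat_mem M4 aTmp = nat_mem M3 aTmp"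
            "nat_mem M4 aWidth 0 = w" "frame ({5, 7} \<union> {40..46}) M M4"
            using w3 se3 by (simp_all add: M4 frame_def)
          show "runs_in P (copy_com;; assign aWidth (NAdd (Var aWidth) (Var aWidth))) M4 (30 * N + 25) ?fin"
          proof (rule runs_in_Seq[OF run_copy[OF 4(1,2)]])
            fix M5 assume y: "(\<forall>x<N. nat_mem M5 aOrd x = nat_mem M4 aTmp x) \<and> frame {5, 46} M4 M5"
            have w5: "nat_mem M5 aWidth 0 = w" using y 4 by (simp add: frame_def)
            have se5: "frame ({5, 7} \<union> {40..46}) M M5"
              by (rule frame_trans[OF 4(5) frame_mono[of "{5, 46}"]]) (use y in auto)
            have m5: "map (nat_mem M5 aOrd) [0..<N] = map (nat_mem M3 aTmp) [0..<N]" using y 4(3) by simp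
            have ms5: "mset (map (nat_mem M5 aOrd) [0..<N]) = mset (map a [0..<N])"
              unfolding m5 using x 2(4) w(3) by simp
            have eq: "map (\<lambda>x. key (nat_mem M5 aOrd x)) [q * (w + w)..<min (q * (w + w) + (w + w)) N] =
              map (\<lambda>x. key (nat_mem M3 aTmp x)) [q * (w + w)..<min (q * (w + w) + (w + w)) N]" for q
              using y 4(3) by simp
            have "blocks_sorted key (nat_mem M5 aOrd) N (w + w)"
              unfolding blocks_sorted_def eq using x 2(5) by (simp add: blocks_sorted_def)
            then show "runs_in P (assign aWidth (NAdd (Var aWidth) (Var aWidth))) M5 9 ?fin"
              using w5 se5 ms5 by (simp add: runs_in_def frame_def del: map_map)
          qed simp
        qed simp
      qed simp
    qed simp
    then show "\<exists>t. runs_in P ?body M' t (\<lambda>M''. ?I M'' \<and> ?m M'' + t + bcost (NLess (Var aWidth) (Var aN)) + 1 \<le> ?m M')"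
    proof (intro exI[of _ "190 * N + 40"], elim runs_in_mono)
      fix M'' assume x: "?fin M''"
      have "?I M''" using x w(2) by auto
      moreover have "bits (w + w) = Suc (bits w)" using bits_double[OF w(2)] by (simp add: mult_2)
      moreover have "bits w \<le> bits N" using wN by (intro bits_mono) simp
      then have "bits N + 1 - bits w = Suc (bits N + 1 - Suc (bits w))" by simp
      ultimately show "?I M'' \<and> ?m M'' + (190 * N + 40) + bcost (NLess (Var aWidth) (Var aN)) + 1 \<le> ?m M'"
        using x w(1) by simp
    qed simp
  next
    fix M' assume x: "?I M' \<and> \<not> bval P M' (NLess (Var aWidth) (Var aN))"
    then obtain w where w: "nat_mem M' aWidth 0 = w"
     "mset (map (nat_mem M' aOrd) [0..<N]) = mset (map a [0..<N])"
     "blocks_sorted key (nat_mem M' aOrd) N w" "frame ({5, 7} \<union> {40..46}) M M'" by blast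
    \<comment> \<open>Once the width reaches \<open>N\<close>, block 0 is the whole array.\<close>
    have "N \<le> w" using x w N by (auto simp: frame_def)
    then show "?Q M'"
      using w(2,4) w(3)[unfolded blocks_sorted_def, rule_format, of 0] by (simp add: min_absorb2)
  next
    show "?m M1 + 1 + bcost (NLess (Var aWidth) (Var aN)) \<le> (190 * N + 50) * (bits N + 1) + 6"
    proof -
      have "?m M1 \<le> (190 * N + 50) * (bits N + 1)" by (rule mult_le_mono2) simp
      then show ?thesis by simp
    qed
  qed
qed simp

section \<open>Setting up the grid\<close>

text \<open>
  One column of padding, which is never activated, makes the neighbours of a code \<open>c\<close> simply
  \<open>c \<plusminus> 1\<close> and \<open>c \<plusminus> (n + 1)\<close>, without any test for the border of the grid.
\<close>

definition code :: "nat \<Rightarrow> nat \<times> nat \<Rightarrow> nat" where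
  "code n = (\<lambda>(i, j). (i + 1) * (n + 1) + j)"

lemma code_div_mod:
  assumes "j \<le> n"
  shows "code n (i, j) div (n + 1) = i + 1" "code n (i, j) mod (n + 1) = j"
proof -
  have "n + 1 \<noteq> 0" by simp
  show "code n (i, j) div (n + 1) = i + 1"
    unfolding code_def prod.case div_mult_self3[OF \<open>n + 1 \<noteq> 0\<close>] using assms by simp
  show "code n (i, j) mod (n + 1) = j"
    unfolding code_def prod.case mod_mult_self3 using assms by simp
qed

lemma code_inject:
  assumes "code n (i, j) = code n (i', j')" "j \<le> n" "j' \<le> n"
  shows "i = i' \<and> j = j'"
  using assms code_div_mod[of j n i] code_div_mod[of j' n i'] by simp

lemma inj_on_code: "inj_on (code n) (positions n)"
  by (auto simp: inj_on_def positions_def dest!: code_inject)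

text \<open>Before sorting, \<open>aOrd\<close> is filled in row-major order without padding, unlike
  the codes it contains.\<close>

lemma row_major_inject:
  fixes n :: nat
  assumes "a * n + b = i * n + j" "b < n" "j < n"
  shows "a = i \<and> b = j"
proof -
  have "(a * n + b) div n = a" "(i * n + j) div n = i" "(a * n + b) mod n = b" "(i * n + j) mod n = j"
    using assms(2,3) by simp_all
  then show ?thesis using assms(1) by metis
qed

abbreviation (input) "aRow \<equiv> 37 :: nat"
abbreviation (input) "aCol \<equiv> 38 :: nat"
abbreviation (input) "aCode \<equiv> 39 :: nat"

text \<open>The table of halves is kept two entries ahead of \<open>aN\<close> by the recurrence
  that the half of \<open>x + 2\<close> is one more than the half of \<open>x\<close>; the zeros of
  the initial memory provide the halves of 0 and 1.\<close>

definition enter_com :: com where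
  "enter_com = RAssign 1 (Var aCode) (RDist (Var aRow) (NAdd (Var 0) (Var aCol)));;
     NAssign aOrd (Var aN) (Var aCode);;
     NAssign aHalf (NAdd (Var aN) (NConst 2)) (NAdd (NCell aHalf (Var aN)) (NConst 1));;
     incr aN;; incr aCol;; incr aCode"

text \<open>Writing 1 to natural array 1 sets the result to \<open>\<infinity>\<close>. A single
  loop runs through all cells, with one extra iteration per row that skips the padding cell.\<close>

definition setup_com :: com where
  "setup_com =
     (assign aW (NAdd (Var 0) (NConst 1));; assign 1 (NConst 1);; assign aCode (Var aW));;
     While (NLess (Var aRow) (Var 0))
       (Cond (NLess (Var aCol) (Var 0)) enter_com
         (assign aCol (NConst 0);; incr aRow;; incr aCode));;
     assign aT (NSub (Var aCode) (NConst 2))"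

lemma run_setup:
  fixes Q :: "'a::euclidean_space list"
  assumes n: "0 < n"
  defines "M \<equiv> initial_state n" and "D \<equiv> (\<lambda>i j. point_dist Q i (n + j))"
  shows "runs_in Q setup_com M (80 * ((n + 1) * (n + 1)) + 50) (\<lambda>M'.
    nat_mem M' aW 0 = n + 1 \<and> nat_mem M' 1 0 = 1 \<and> nat_mem M' aT 0 = code n (n - 1, n - 1) \<and>
    nat_mem M' aN 0 = n * n \<and> (\<forall>x\<le>n * n. nat_mem M' aHalf x = x div 2) \<and>
    (\<forall>a<n. \<forall>b<n. nat_mem M' aOrd (a * n + b) = code n (a, b) \<and> real_mem M' 1 (code n (a, b)) = D a b) \<and>
    (\<forall>k\<in>{8..27}. nat_mem M' k = (\<lambda>_. 0)))"
proof -
  define J where "J M' i j \<longleftrightarrow> nat_mem M' aRow 0 = i \<and> nat_mem M' aCol 0 = j \<and> i \<le> n \<and> j \<le> n \<and> (i = n \<longrightarrow> j = 0) \<and>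
    nat_mem M' aCode 0 = code n (i, j) \<and> nat_mem M' aN 0 = i * n + j \<and>
    (\<forall>x<i * n + j + 2. nat_mem M' aHalf x = x div 2) \<and>
    (\<forall>a b. b < n \<longrightarrow> a < i \<or> a = i \<and> b < j \<longrightarrow>
       nat_mem M' aOrd (a * n + b) = code n (a, b) \<and> real_mem M' 1 (code n (a, b)) = D a b) \<and>
    nat_mem M' aW 0 = n + 1 \<and> nat_mem M' 1 0 = 1 \<and> nat_mem M' 0 0 = n \<and>
    (\<forall>k\<in>{8..27}. nat_mem M' k = (\<lambda>_. 0))" for M' :: ram_state and i j
  let ?I = "\<lambda>M'. \<exists>i j. J M' i j"
  let ?fin = "\<lambda>M'. nat_mem M' aW 0 = n + 1 \<and> nat_mem M' 1 0 = 1 \<and> nat_mem M' aT 0 = code n (n - 1, n - 1) \<and>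
    nat_mem M' aN 0 = n * n \<and> (\<forall>x\<le>n * n. nat_mem M' aHalf x = x div 2) \<and>
    (\<forall>a<n. \<forall>b<n. nat_mem M' aOrd (a * n + b) = code n (a, b) \<and> real_mem M' 1 (code n (a, b)) = D a b) \<and>
    (\<forall>k\<in>{8..27}. nat_mem M' k = (\<lambda>_. 0))"
  \<comment> \<open>The remaining iterations: \<open>n + 1\<close> for each row, the padding cell
    included.\<close>
  let ?m = "\<lambda>M'. 80 * ((n - nat_mem M' aRow 0) * (n + 1) + (n - nat_mem M' aCol 0))"
  let ?body = "Cond (NLess (Var aCol) (Var 0)) enter_com (assign aCol (NConst 0);; incr aRow;; incr aCode)"
  have step: "\<exists>t. runs_in Q ?body M1 t (\<lambda>M'. ?I M' \<and> ?m M' + t + bcost (NLess (Var aRow) (Var 0)) + 1 \<le> ?m M1)"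
    if "?I M1" and bv: "bval Q M1 (NLess (Var aRow) (Var 0))" for M1
  proof -
    from that(1) obtain i j where h: "nat_mem M1 aRow 0 = i" "nat_mem M1 aCol 0 = j" "i \<le> n" "j \<le> n"
      "nat_mem M1 aCode 0 = code n (i, j)" "nat_mem M1 aN 0 = i * n + j"
      and half: "\<forall>x<i * n + j + 2. nat_mem M1 aHalf x = x div 2"
      and tab: "\<forall>a b. b < n \<longrightarrow> a < i \<or> a = i \<and> b < j \<longrightarrow>
       nat_mem M1 aOrd (a * n + b) = code n (a, b) \<and> real_mem M1 1 (code n (a, b)) = D a b"
      and fr: "nat_mem M1 aW 0 = n + 1" "nat_mem M1 1 0 = 1" "nat_mem M1 0 0 = n"
      "\<forall>k\<in>{8..27}. nat_mem M1 k = (\<lambda>_. 0)" unfolding J_def by blast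
    have i: "i < n" using bv h fr by simp
    show ?thesis
    proof (cases "j < n")
      case True
      let ?N = "i * n + j"
      let ?S = "\<lambda>M'. nat_mem M' aRow 0 = i \<and> nat_mem M' aCol 0 = Suc j \<and>
        nat_mem M' aCode 0 = Suc (code n (i, j)) \<and> nat_mem M' aN 0 = Suc ?N \<and>
        nat_mem M' aHalf = (nat_mem M1 aHalf)(?N + 2 := nat_mem M1 aHalf ?N + 1) \<and>
        nat_mem M' aOrd = (nat_mem M1 aOrd)(?N := code n (i, j)) \<and>
        real_mem M' 1 = (real_mem M1 1)(code n (i, j) := D i j) \<and>
        (\<forall>k. k \<notin> {4, 5, 6, 38, 39} \<longrightarrow> nat_mem M' k = nat_mem M1 k)"
      have "runs_in Q ?body M1 60 ?S"
        using h fr(3) True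
        by (simp add: enter_com_def runs_in_def D_def cong: runs_weak_cong)
      moreover have "?I M' \<and> ?m M' + 60 + bcost (NLess (Var aRow) (Var 0)) + 1 \<le> ?m M1"
        if x: "?S M'" for M' :: ram_state
      proof -
        have half': "\<forall>x<i * n + Suc j + 2. nat_mem M' aHalf x = x div 2"
        proof (intro allI impI)
          fix x assume "x < i * n + Suc j + 2"
          then have "x < ?N + 2 \<or> x = ?N + 2" by auto
          then show "nat_mem M' aHalf x = x div 2" using x half by auto
        qed
        have tab': "\<forall>a b. b < n \<longrightarrow> a < i \<or> a = i \<and> b < Suc j \<longrightarrow>
           nat_mem M' aOrd (a * n + b) = code n (a, b) \<and> real_mem M' 1 (code n (a, b)) = D a b"
        proof (intro allI impI)
          fix a b assume b: "b < n" "a < i \<or> a = i \<and> b < Suc j"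
          show "nat_mem M' aOrd (a * n + b) = code n (a, b) \<and> real_mem M' 1 (code n (a, b)) = D a b"
          proof (cases "a = i \<and> b = j")
            case False
            have "a * n + b \<noteq> ?N" using row_major_inject[of a n b i j] False b(1) True by blast
            moreover have "code n (a, b) \<noteq> code n (i, j)" using code_inject[of n a b i j] False b(1) True by auto
            moreover have "a < i \<or> a = i \<and> b < j" using b(2) False by auto
            then have "nat_mem M1 aOrd (a * n + b) = code n (a, b) \<and> real_mem M1 1 (code n (a, b)) = D a b"
              using tab b(1) by blast
            ultimately show ?thesis using x by simp
          qed (use x in simp)
        qed
        have c: "Suc (code n (i, j)) = code n (i, Suc j)" by (simp add: code_def)
        have fr': "nat_mem M' aW 0 = n + 1 \<and> nat_mem M' 1 0 = 1 \<and> nat_mem M' 0 0 = n \<and>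
          (\<forall>k\<in>{8..27}. nat_mem M' k = (\<lambda>_. 0))" using x fr by auto
        have "nat_mem M' aRow 0 = i" "nat_mem M' aCol 0 = Suc j" "nat_mem M' aCode 0 = code n (i, Suc j)"
          "nat_mem M' aN 0 = i * n + Suc j" "i \<le> n" "Suc j \<le> n" "i = n \<longrightarrow> Suc j = 0"
          using x c i True h(1) by simp_all
        then have "J M' i (Suc j)" using half' tab' fr' unfolding J_def by (intro conjI) (assumption | elim conjE, assumption)+
        then have "?I M'" by blast
        moreover have nj: "n - j = Suc (n - Suc j)" using True by simp
        have eqs: "nat_mem M' aRow 0 = i" "nat_mem M' aCol 0 = Suc j" using x by blast+
        have "?m M' + 60 + bcost (NLess (Var aRow) (Var 0)) + 1 \<le> ?m M1"
          unfolding h(1,2) eqs nj by simp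
        ultimately show ?thesis by (rule conjI)
      qed
      ultimately show ?thesis by (intro exI[of _ 60]) (rule runs_in_mono[OF _ order_refl])
    next
      case False
      then have j: "j = n" using h(4) by simp
      let ?S = "\<lambda>M'. nat_mem M' aRow 0 = Suc i \<and> nat_mem M' aCol 0 = 0 \<and>
        nat_mem M' aCode 0 = Suc (code n (i, n)) \<and> real_mem M' = real_mem M1 \<and>
        (\<forall>k. k \<notin> {37, 38, 39} \<longrightarrow> nat_mem M' k = nat_mem M1 k)"
      have "runs_in Q ?body M1 60 ?S"
        using h fr(3) j
        by (simp add: runs_in_def cong: runs_weak_cong)
      moreover have "?I M' \<and> ?m M' + 60 + bcost (NLess (Var aRow) (Var 0)) + 1 \<le> ?m M1"
        if x: "?S M'" for M' :: ram_state
      proof -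
        have c: "Suc (code n (i, n)) = code n (Suc i, 0)" "Suc i * n + 0 = i * n + j"
          by (simp_all add: code_def j)
        have half': "\<forall>x<Suc i * n + 0 + 2. nat_mem M' aHalf x = x div 2" unfolding c(2) using x half by simp
        have tab': "\<forall>a b. b < n \<longrightarrow> a < Suc i \<or> a = Suc i \<and> b < 0 \<longrightarrow>
           nat_mem M' aOrd (a * n + b) = code n (a, b) \<and> real_mem M' 1 (code n (a, b)) = D a b"
          using x tab j by (auto simp: less_Suc_eq)
        have N': "nat_mem M' aN 0 = Suc i * n + 0" unfolding c(2) using x h by simp
        have fr': "nat_mem M' aW 0 = n + 1 \<and> nat_mem M' 1 0 = 1 \<and> nat_mem M' 0 0 = n \<and>
          (\<forall>k\<in>{8..27}. nat_mem M' k = (\<lambda>_. 0))" using x fr by auto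
        have si: "Suc i \<le> n" using i by simp
        have "nat_mem M' aRow 0 = Suc i" "nat_mem M' aCol 0 = 0" "nat_mem M' aCode 0 = code n (Suc i, 0)"
          "0 \<le> n" "Suc i = n \<longrightarrow> (0::nat) = 0"
          using x c(1) by simp_all
        then have "J M' (Suc i) 0" using half' tab' N' fr' si unfolding J_def by (intro conjI) (assumption | elim conjE, assumption)+
        then have "?I M'" by blast
        moreover have ni: "n - i = Suc (n - Suc i)" using i by simp
        have eqs: "nat_mem M' aRow 0 = Suc i" "nat_mem M' aCol 0 = 0" using x by blast+
        have "?m M' + 60 + bcost (NLess (Var aRow) (Var 0)) + 1 \<le> ?m M1"
          unfolding h(1,2) eqs ni j by simp
        ultimately show ?thesis by (rule conjI)
      qed
      ultimately show ?thesis by (intro exI[of _ 60]) (rule runs_in_mono[OF _ order_refl])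
    qed
  qed
  show ?thesis unfolding setup_com_def
  proof (rule runs_in_Seq)
    show "runs_in Q (assign aW (NAdd (Var 0) (NConst 1));; assign 1 (NConst 1);; assign aCode (Var aW)) M 20
      (\<lambda>M'. ?I M' \<and> ?m M' = 80 * (n * (n + 1) + n))"
    proof -
      let ?M' = "M\<lparr>nat_mem := write_cell (write_cell (write_cell (nat_mem M) aW 0 (Suc n)) (Suc 0) 0 (Suc 0)) aCode 0 (Suc n)\<rparr>"
      have half: "x < 2 \<Longrightarrow> x div 2 = 0" for x :: nat by simp
      have "J ?M' 0 0" using n unfolding J_def
        by (intro conjI) (auto simp: M_def initial_state_def code_def half)
      then have "?I ?M'" by blast
      moreover have "?m ?M' = 80 * (n * (n + 1) + n)" by (simp add: M_def initial_state_def)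
      ultimately have "?I ?M' \<and> ?m ?M' = 80 * (n * (n + 1) + n)" by (rule conjI)
      moreover have "runs_in Q (assign aW (NAdd (Var 0) (NConst 1));; assign 1 (NConst 1);; assign aCode (Var aW)) M 20
        (\<lambda>M'. M' = ?M')"
        by (simp add: runs_in_def M_def initial_state_def)
      ultimately show ?thesis by - (erule runs_in_mono, rule order_refl, erule ssubst)
    qed
  next
    fix M1 assume 1: "?I M1 \<and> ?m M1 = 80 * (n * (n + 1) + n)"
    show "runs_in Q (While (NLess (Var aRow) (Var 0)) ?body;; assign aT (NSub (Var aCode) (NConst 2))) M1
      (80 * (n * (n + 1) + n) + 20) ?fin"
    proof (rule runs_in_Seq[OF runs_in_While[where I = ?I and m = ?m, OF conjunct1[OF 1] step]])
      fix M2 assume x: "?I M2 \<and> \<not> bval Q M2 (NLess (Var aRow) (Var 0))"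
      then obtain i j where ij: "nat_mem M2 aRow 0 = i" "i \<le> n" "i = n \<longrightarrow> j = 0" and
        h: "nat_mem M2 aCode 0 = code n (i, j)" "nat_mem M2 aN 0 = i * n + j"
        and half: "\<forall>x<i * n + j + 2. nat_mem M2 aHalf x = x div 2"
        and tab: "\<forall>a b. b < n \<longrightarrow> a < i \<or> a = i \<and> b < j \<longrightarrow>
         nat_mem M2 aOrd (a * n + b) = code n (a, b) \<and> real_mem M2 1 (code n (a, b)) = D a b"
        and fr: "nat_mem M2 aW 0 = n + 1" "nat_mem M2 1 0 = 1" "nat_mem M2 0 0 = n"
        "\<forall>k\<in>{8..27}. nat_mem M2 k = (\<lambda>_. 0)" unfolding J_def by blast
      have "i = n" "j = 0" using x ij fr by auto
      \<comment> \<open>Two steps back from the cell after the grid: over the padding cell of the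
        last row to the goal.\<close>
      moreover have "code n (n, 0) - 2 = code n (n - 1, n - 1)" using n by (cases n) (simp_all add: code_def)
      ultimately show "runs_in Q (assign aT (NSub (Var aCode) (NConst 2))) M2 8 ?fin"
        using h half tab fr by (simp add: runs_in_def)
    qed (use 1 in simp_all)
  qed simp
qed

section \<open>Correctness and running time\<close>

definition valid_positions :: "nat \<Rightarrow> (nat \<times> nat \<Rightarrow> bool) \<Rightarrow> (nat \<times> nat) set" where
  "valid_positions n f = {q \<in> positions n. f q}"

lemma weak_path_rtrancl:
  assumes "weak_path n ps" "\<forall>q\<in>set ps. f q"
  defines "V \<equiv> valid_positions n f"
  shows "hd ps \<in> V \<and> (hd ps, last ps) \<in> (weak_edges n \<inter> V \<times> V)\<^sup>*"
  using assms(1,2)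
proof (induction ps rule: induct_list012)
  case 1
  then show ?case by (simp add: weak_path_def)
next
  case (2 x)
  then show ?case by (simp add: weak_path_def V_def valid_positions_def)
next
  case (3 x y zs)
  then have "weak_path n (y # zs)" "x \<in> V" "(x, y) \<in> weak_edges n"
    by (auto simp: weak_path_def V_def valid_positions_def)
  moreover from this 3 have "y \<in> V \<and> (y, last (y # zs)) \<in> (weak_edges n \<inter> V \<times> V)\<^sup>*" by auto
  ultimately have "(x, y) \<in> weak_edges n \<inter> V \<times> V" "(y, last (y # zs)) \<in> (weak_edges n \<inter> V \<times> V)\<^sup>*" by auto
  then have "(x, last (y # zs)) \<in> (weak_edges n \<inter> V \<times> V)\<^sup>*" by (rule converse_rtrancl_into_rtrancl)
  then show ?case using \<open>x \<in> V\<close> by simp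
qed

text \<open>Lists of valid positions become reachability in the induced graph. Validity of the start
  is a separate conjunct, since the reflexive closure does not imply it; validity of the end
  follows.\<close>

lemma w_reachable_iff:
  assumes "V = valid_positions n f"
  shows "w_reachable n f p \<longleftrightarrow> (0, 0) \<in> V \<and> ((0, 0), p) \<in> (weak_edges n \<inter> V \<times> V)\<^sup>*"
proof
  assume "w_reachable n f p"
  then obtain ps where "weak_path n ps" "hd ps = (0, 0)" "last ps = p" "\<forall>q\<in>set ps. f q"
    unfolding w_reachable_def by blast
  then show "(0, 0) \<in> V \<and> ((0, 0), p) \<in> (weak_edges n \<inter> V \<times> V)\<^sup>*"
    using weak_path_rtrancl[of n ps f] assms by auto
next
  assume a: "(0, 0) \<in> V \<and> ((0, 0), p) \<in> (weak_edges n \<inter> V \<times> V)\<^sup>*"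
  then have z: "(0, 0) \<in> V" and "((0, 0), p) \<in> (weak_edges n \<inter> V \<times> V)\<^sup>*" by auto
  from this(2) show "w_reachable n f p"
  proof (induction rule: rtrancl_induct)
    case base
    then show ?case using z assms unfolding w_reachable_def
      by (intro exI[of _ "[(0, 0)]"]) (simp add: weak_path_def valid_positions_def)
  next
    case (step y p)
    then obtain ps where "weak_path n ps" "hd ps = (0, 0)" "last ps = y" "\<forall>q\<in>set ps. f q"
      unfolding w_reachable_def by blast
    with step(2) show ?case using assms unfolding w_reachable_def
      by (intro exI[of _ "ps @ [p]"])
        (auto simp: weak_path_def successively_append_iff valid_positions_def)
  qed
qed

text \<open>The successor of a code in column \<open>n - 1\<close> lies in the padding column
  \<open>n\<close>. Because \<open>code\<close> is injective for columns up to \<open>n\<close>,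
  that successor is not the code of a position, so rows do not wrap around.\<close>

lemma code_adj:
  assumes "p \<in> positions n" "q \<in> positions n"
  shows "(code n p, code n q) \<in> adj (n + 1) \<longleftrightarrow> (p, q) \<in> weak_edges n"
proof -
  obtain i j i' j' where p: "p = (i, j)" and q: "q = (i', j')" by (metis prod.exhaust)
  have b: "i < n" "j < n" "i' < n" "j' < n" using assms by (auto simp: p q positions_def)
  have right: "code n (a, b) + 1 = code n (a, b + 1)" and down: "code n (a, b) + (n + 1) = code n (a + 1, b)" for a b
    by (simp_all add: code_def)
  have 1: "code n q = code n p + 1 \<longleftrightarrow> i' = i \<and> j' = j + 1"
    unfolding p q right using code_inject[of n i' j' i "j + 1"] b by auto
  have 2: "code n p = code n q + 1 \<longleftrightarrow> i = i' \<and> j = j' + 1"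
    unfolding p q right using code_inject[of n i j i' "j' + 1"] b by auto
  have 3: "code n q = code n p + (n + 1) \<longleftrightarrow> i' = i + 1 \<and> j' = j"
    unfolding p q down using code_inject[of n i' j' "i + 1" j] b by auto
  have 4: "code n p = code n q + (n + 1) \<longleftrightarrow> i = i' + 1 \<and> j = j'"
    unfolding p q down using code_inject[of n i j "i' + 1" j'] b by auto
  have "(code n p, code n q) \<in> adj (n + 1) \<longleftrightarrow>
    (i' = i \<and> j' = j + 1) \<or> (i = i' \<and> j = j' + 1) \<or> (i' = i + 1 \<and> j' = j) \<or> (i = i' + 1 \<and> j = j')"
    unfolding adj_def mem_Collect_eq prod.case 1 2 3 4 ..
  also have "\<dots> \<longleftrightarrow> (p, q) \<in> weak_edges n"
    using b by (auto simp: p q weak_edges_def forward_edges_def)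
  finally show ?thesis .
qed

text \<open>By \<open>code_adj\<close> and injectivity, \<open>code\<close> is an isomorphism
  between the induced graphs.\<close>

lemma code_rtrancl:
  assumes V: "V \<subseteq> positions n" and p: "p \<in> V" and q: "q \<in> positions n"
  shows "(code n p, code n q) \<in> (adj (n + 1) \<inter> code n ` V \<times> code n ` V)\<^sup>* \<longleftrightarrow>
    (p, q) \<in> (weak_edges n \<inter> V \<times> V)\<^sup>*"
proof
  assume "(code n p, code n q) \<in> (adj (n + 1) \<inter> code n ` V \<times> code n ` V)\<^sup>*"
  then have "\<exists>y\<in>V. code n q = code n y \<and> (p, y) \<in> (weak_edges n \<inter> V \<times> V)\<^sup>*"
  proof (induction rule: rtrancl_induct)
    case base
    then show ?case using p by auto
  next
    case (step c d)
    then obtain y z where y: "y \<in> V" "c = code n y" "(p, y) \<in> (weak_edges n \<inter> V \<times> V)\<^sup>*"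
      and z: "z \<in> V" "d = code n z" "(c, d) \<in> adj (n + 1)" by blast
    have "(y, z) \<in> weak_edges n \<inter> V \<times> V" using y z V code_adj[of y n z] by auto
    with y(3) have "(p, z) \<in> (weak_edges n \<inter> V \<times> V)\<^sup>*" by (rule rtrancl_into_rtrancl)
    then show ?case using z by blast
  qed
  then obtain y where "y \<in> V" "code n q = code n y" "(p, y) \<in> (weak_edges n \<inter> V \<times> V)\<^sup>*" by blast
  moreover from this have "q = y" using inj_on_code q V by (metis inj_onD subsetD)
  ultimately show "(p, q) \<in> (weak_edges n \<inter> V \<times> V)\<^sup>*" by simp
next
  assume "(p, q) \<in> (weak_edges n \<inter> V \<times> V)\<^sup>*"
  then show "(code n p, code n q) \<in> (adj (n + 1) \<inter> code n ` V \<times> code n ` V)\<^sup>*"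
  proof (induction rule: rtrancl_induct)
    case (step y z)
    then have "(code n y, code n z) \<in> adj (n + 1) \<inter> code n ` V \<times> code n ` V"
      using V code_adj[of y n z] by auto
    with step.IH show ?case by (rule rtrancl_into_rtrancl)
  qed simp
qed

lemma (in window_search) joins_iff:
  assumes n: "0 < n" and w: "w = n + 1" and t: "t = code n (n - 1, n - 1)"
    and ord: "ord ` {..<N} = code n ` positions n" and r: "r \<le> N"
  shows "joins l r \<longleftrightarrow> w_reachable n (\<lambda>q. code n q \<in> window l r) (n - 1, n - 1)"
proof -
  define V where "V = valid_positions n (\<lambda>q. code n q \<in> window l r)"
  have sub: "window l r \<subseteq> code n ` positions n"
    unfolding window_def ord[symmetric] using r by (intro image_mono) auto
  have V: "V \<subseteq> positions n" "code n ` V = window l r"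
    using sub by (auto simp: V_def valid_positions_def)
  have pos: "(0, 0) \<in> positions n" "(n - 1, n - 1) \<in> positions n" using n by (simp_all add: positions_def)
  have w': "w = code n (0, 0)" by (simp add: w code_def)
  have mem: "code n q \<in> window l r \<longleftrightarrow> q \<in> V" if "q \<in> positions n" for q
    using that by (simp add: V_def valid_positions_def)
  have "q \<in> V" if "(p, q) \<in> (weak_edges n \<inter> V \<times> V)\<^sup>*" "p \<in> V" for p q
    using that by (induction rule: rtrancl_induct) auto
  moreover have "w \<in> window l r \<longleftrightarrow> (0, 0) \<in> V" using mem[OF pos(1)] by (simp only: w')
  moreover have "t \<in> window l r \<longleftrightarrow> (n - 1, n - 1) \<in> V" using mem[OF pos(2)] by (simp only: t)
  moreover have "(w, t) \<in> (adj w \<inter> window l r \<times> window l r)\<^sup>* \<longleftrightarrow>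
    ((0, 0), (n - 1, n - 1)) \<in> (weak_edges n \<inter> V \<times> V)\<^sup>*" if "(0, 0) \<in> V"
    using code_rtrancl[OF V(1) that pos(2)]
    unfolding V(2) t[symmetric] w'[symmetric] w[symmetric] .
  ultimately show ?thesis unfolding joins_def w_reachable_iff[OF V_def] by blast
qed

section \<open>Windows of the sorted order and ranges of distances\<close>

lemma w_reachable_mono:
  assumes "w_reachable n f p" "\<And>q. q \<in> positions n \<Longrightarrow> f q \<Longrightarrow> f' q"
  shows "w_reachable n f' p"
  using assms unfolding w_reachable_def weak_path_def by blast

text \<open>A joining window makes the range between its extreme keys feasible, so no candidate is
  below the optimum. Conversely, all positions valid for an optimal range lie in one window, and
  shrinking that window to \<open>reach l\<close> does not increase \<open>g\<close>.\<close>

lemma (in window_search) INF_candidate: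
  fixes A B :: "'b::euclidean_space list"
  assumes n: "0 < n" "length A = n" and w: "w = n + 1" and t: "t = code n (n - 1, n - 1)"
    and ord: "ord ` {..<N} = code n ` positions n"
    and key: "\<And>i j. i < n \<Longrightarrow> j < n \<Longrightarrow> key (code n (i, j)) = dist (A ! i) (B ! j)"
    and sorted: "\<And>i j. i \<le> j \<Longrightarrow> j < N \<Longrightarrow> key (ord i) \<le> key (ord j)"
    and g: "\<And>s t s' t'. 0 \<le> s \<Longrightarrow> s \<le> s' \<Longrightarrow> s' \<le> t' \<Longrightarrow> t' \<le> t \<Longrightarrow> g s' t' \<le> g s t"
    and attained: "feasible_weak_range A B s0 t0" "m = g s0 t0"
    and least: "\<And>s t. feasible_weak_range A B s t \<Longrightarrow> m \<le> g s t"
  shows "(INF l\<in>{..<N}. candidate l) = m"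
proof (rule antisym)
  have key0: "0 \<le> key (ord i)" if "i < N" for i
  proof -
    have "ord i \<in> code n ` positions n" using that unfolding ord[symmetric] by simp
    then show ?thesis using key by (auto simp: positions_def)
  qed
  show "m \<le> (INF l\<in>{..<N}. candidate l)"
  proof (rule INF_greatest)
    fix l assume l: "l \<in> {..<N}"
    show "m \<le> candidate l"
    proof (cases "joins l (reach l)")
      case True
      define r where "r = reach l - 1"
      have r: "reach l = Suc r" "l \<le> r" "r < N"
        using joins_less[OF True] reach_le[of l] by (auto simp: r_def)
      have "w_reachable n (\<lambda>q. code n q \<in> window l (reach l)) (n - 1, n - 1)"
        using True joins_iff[OF n(1) w t ord reach_le] by simp
      then have "w_reachable n (range_valid A B (key (ord l)) (key (ord r))) (n - 1, n - 1)"
      proof (rule w_reachable_mono)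
        fix q assume q: "q \<in> positions n" "code n q \<in> window l (reach l)"
        then obtain i where "code n q = ord i" "l \<le> i" "i \<le> r" by (auto simp: window_def r(1))
        then have "key (ord l) \<le> key (code n q)" "key (code n q) \<le> key (ord r)"
          using sorted r(3) by auto
        then show "range_valid A B (key (ord l)) (key (ord r)) q"
          using q(1) key by (auto simp: range_valid_def positions_def)
      qed
      then have "feasible_weak_range A B (key (ord l)) (key (ord r))"
        using key0 l sorted r n(2) by (simp add: feasible_weak_range_def)
      then show ?thesis using least True by (simp add: candidate_def r_def)
    qed (simp add: candidate_def)
  qed
  have st: "0 \<le> s0" "s0 \<le> t0" and reach0: "w_reachable n (range_valid A B s0 t0) (n - 1, n - 1)"
    using attained(1) n(2) by (auto simp: feasible_weak_range_def)
  \<comment> \<open>The ranks of all positions valid for the optimal range; the window from its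
    least to its greatest element contains every one of them.\<close>
  define I where "I = {i. i < N \<and> s0 \<le> key (ord i) \<and> key (ord i) \<le> t0}"
  define l where "l = Min I"
  define r where "r = Max I"
  have idx: "\<exists>i\<in>I. code n q = ord i" if "q \<in> positions n" "range_valid A B s0 t0 q" for q
  proof -
    have "code n q \<in> ord ` {..<N}" using that(1) unfolding ord by simp
    then obtain i where "i < N" "code n q = ord i" by auto
    moreover have "s0 \<le> key (code n q) \<and> key (code n q) \<le> t0"
      using that key by (auto simp: range_valid_def positions_def)
    ultimately show ?thesis by (auto simp: I_def)
  qed
  have fin: "finite I" by (simp add: I_def)
  have "(0, 0) \<in> valid_positions n (range_valid A B s0 t0)" using reach0 w_reachable_iff by blast
  then have ne: "I \<noteq> {}" using idx by (auto simp: valid_positions_def)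
  have lr: "l \<in> I" "r \<in> I" using Min_in[OF fin ne] Max_in[OF fin ne] by (simp_all add: l_def r_def)
  then have rN: "Suc r \<le> N" "l < N" by (auto simp: I_def)
  have "w_reachable n (\<lambda>q. code n q \<in> window l (Suc r)) (n - 1, n - 1)"
  proof (rule w_reachable_mono[OF reach0])
    fix q assume "q \<in> positions n" "range_valid A B s0 t0 q"
    then obtain i where "i \<in> I" "code n q = ord i" using idx by blast
    moreover from this have "l \<le> i" "i \<le> r" using fin by (auto simp: l_def r_def)
    ultimately show "code n q \<in> window l (Suc r)" by (auto simp: window_def)
  qed
  then have j: "joins l (Suc r)" using joins_iff[OF n(1) w t ord rN(1)] by simp
  have le: "reach l \<le> Suc r" by (rule reach_least[OF j])
  have jr: "joins l (reach l)" using reach_cases[of l] j le rN(1) by (metis le_antisym)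
  have "l < reach l" by (rule joins_less[OF jr])
  then have "g (key (ord l)) (key (ord (reach l - 1))) \<le> g s0 t0"
  proof (intro g)
    have "key (ord (reach l - 1)) \<le> key (ord r)" using le rN by (intro sorted) auto
    then show "key (ord (reach l - 1)) \<le> t0" using lr(2) by (simp add: I_def)
    show "key (ord l) \<le> key (ord (reach l - 1))" using \<open>l < reach l\<close> le rN by (intro sorted) auto
  qed (use st lr in \<open>auto simp: I_def\<close>)
  then have "candidate l \<le> m" using jr attained(2) by (simp add: candidate_def)
  then show "(INF l\<in>{..<N}. candidate l) \<le> m" using rN(2) by (meson INF_lower2 lessThan_iff)
qed

text \<open>The guard \<open>b\<close> says whether the value \<open>e\<close> is finite. Conditions
  lack disjunction, so the negated conjunction expresses that the result is still
  \<open>\<infinity>\<close> or exceeds \<open>e\<close>.\<close>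

definition record_com :: "bexp \<Rightarrow> rexp \<Rightarrow> com" where
  "record_com b e = Cond b
     (Cond (BNot (BAnd (BNot (NLess (NConst 0) (Var 1))) (BNot (RLess e (RCell 0 (NConst 0))))))
        (RAssign 0 (NConst 0) e;; assign 1 (NConst 0)) Skip) Skip"

definition low_exp :: rexp where
  "low_exp = RCell 1 (NCell aOrd (Var aMid))"

definition high_exp :: rexp where
  "high_exp = RCell 1 (NCell aOrd (NSub (Var aR) (NConst 1)))"

definition program :: "com \<Rightarrow> com" where
  "program rec = setup_com;; sort_com;; search_com rec"

lemma run_record_com:
  assumes "bcost b \<le> 8" "rcost e \<le> 15"
    and "v = (if bval P M b then ereal (rval P M e) else \<infinity>)"
  shows "runs_in P (record_com b e) M 100 (\<lambda>M'. result M' = min (result M) v \<and>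
    (\<forall>k. k \<noteq> 1 \<longrightarrow> nat_mem M' k = nat_mem M k) \<and> real_mem M' 1 = real_mem M 1)"
proof (cases "bval P M b")
  case True
  then show ?thesis using assms(1,2)
    by (simp add: record_com_def runs_in_def assms(3) cong: runs_weak_cong)
      (simp add: result_def min_def)
next
  case False
  then show ?thesis using assms(1,2)
    by (simp add: record_com_def runs_in_def assms(3))
qed

text \<open>The hypothesis on \<open>rec\<close> is stated for every \<open>ord\<close>, because the
  sorted order is known only in the state after sorting. It may use that keys are nonnegative, which
  the ratio needs.\<close>

lemma run_program:
  fixes A B :: "'a::euclidean_space list" and g :: "real \<Rightarrow> real \<Rightarrow> ereal" and rec :: com
  assumes n: "0 < n" "length A = n" "length B = n"
    and rec: "\<And>M ord key l r N. prepared (n + 1) (code n (n - 1, n - 1)) N ord key M \<Longrightarrow>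
      nat_mem M aMid 0 = l \<Longrightarrow> nat_mem M aR 0 = Suc r \<Longrightarrow> l < N \<Longrightarrow> r < N \<Longrightarrow> (\<And>x. 0 \<le> key x) \<Longrightarrow>
      runs_in (A @ B) rec M 100 (\<lambda>M'. result M' = min (result M) (g (key (ord l)) (key (ord r))) \<and>
        (\<forall>k. k \<noteq> 1 \<longrightarrow> nat_mem M' k = nat_mem M k) \<and> real_mem M' 1 = real_mem M 1)"
    and g: "\<And>s t s' t'. 0 \<le> s \<Longrightarrow> s \<le> s' \<Longrightarrow> s' \<le> t' \<Longrightarrow> t' \<le> t \<Longrightarrow> g s' t' \<le> g s t"
    and attained: "\<exists>s t. feasible_weak_range A B s t \<and> m = g s t"
    and least: "\<And>s t. feasible_weak_range A B s t \<Longrightarrow> m \<le> g s t"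
  shows "runs_in (A @ B) (program rec) (initial_state n) (30000 * (n * n) * bits (n * n) ^ 2) (\<lambda>M. result M = m)"
proof -
  define N where "N = n * n"
  \<comment> \<open>Division and remainder decode a position; they occur in the proof only, not in
    the program.\<close>
  define key where "key = (\<lambda>c. dist (A ! (c div (n + 1) - 1)) (B ! (c mod (n + 1))))"
  have key_code: "key (code n (i, j)) = dist (A ! i) (B ! j)" if "j < n" for i j
    using code_div_mod[of j n i] that by (simp add: key_def)
  have N0: "0 < N" using n by (simp add: N_def)
  define b where "b = bits N"
  have b1: "1 \<le> b" using bits_pos[OF N0] by (simp add: b_def)
  have D: "point_dist (A @ B) i (n + j) = dist (A ! i) (B ! j)" if "i < n" "j < n" for i j
    using that n by (simp add: point_dist_def nth_append)
  define R where "R M' \<longleftrightarrow> nat_mem M' aW 0 = n + 1 \<and> nat_mem M' 1 0 = 1 \<and> nat_mem M' aT 0 = code n (n - 1, n - 1) \<and>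
    nat_mem M' aN 0 = N \<and> (\<forall>x\<le>N. nat_mem M' aHalf x = x div 2) \<and>
    (\<forall>k\<in>{8..27}. nat_mem M' k = (\<lambda>_. 0)) \<and> (\<forall>c\<in>code n ` positions n. real_mem M' 1 c = key c)"
    for M' :: ram_state
  let ?S = "\<lambda>M'. R M' \<and> inj_on (nat_mem M' aOrd) {..<N} \<and> nat_mem M' aOrd ` {..<N} = code n ` positions n \<and>
      (\<forall>i j. i \<le> j \<longrightarrow> j < N \<longrightarrow> key (nat_mem M' aOrd i) \<le> key (nat_mem M' aOrd j))"
  have A1: "runs_in (A @ B) setup_com (initial_state n) (80 * ((n + 1) * (n + 1)) + 50) (\<lambda>M'. R M' \<and>
    nat_mem M' aOrd ` {..<N} = code n ` positions n)"
  proof (rule runs_in_mono[OF run_setup[OF n(1)] order_refl])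
    fix M' :: ram_state
    assume x: "nat_mem M' aW 0 = n + 1 \<and> nat_mem M' 1 0 = 1 \<and> nat_mem M' aT 0 = code n (n - 1, n - 1) \<and>
      nat_mem M' aN 0 = n * n \<and> (\<forall>x\<le>n * n. nat_mem M' aHalf x = x div 2) \<and>
      (\<forall>a<n. \<forall>b<n. nat_mem M' aOrd (a * n + b) = code n (a, b) \<and>
         real_mem M' 1 (code n (a, b)) = point_dist (A @ B) a (n + b)) \<and>
      (\<forall>k\<in>{8..27}. nat_mem M' k = (\<lambda>_. 0))"
    have "nat_mem M' aOrd ` {..<N} = code n ` positions n"
    proof (intro equalityI subsetI)
      fix c assume "c \<in> nat_mem M' aOrd ` {..<N}"
      then obtain q where q: "q < n * n" "c = nat_mem M' aOrd q" by (auto simp: N_def)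
      have "q div n < n" "q mod n < n" using q(1) n(1) by (simp_all add: less_mult_imp_div_less)
      moreover have "q = (q div n) * n + q mod n" by simp
      ultimately have "c = code n (q div n, q mod n)" using x q(2) by metis
      then show "c \<in> code n ` positions n" using \<open>q div n < n\<close> \<open>q mod n < n\<close> by (auto simp: positions_def)
    next
      fix c assume "c \<in> code n ` positions n"
      then obtain i j where ij: "i < n" "j < n" "c = code n (i, j)" by (auto simp: positions_def)
      have "i * n + j < N"
      proof -
        have "i * n + j < Suc i * n" using ij by simp
        also have "\<dots> \<le> n * n" using ij by (intro mult_le_mono1) simp
        finally show ?thesis by (simp add: N_def)
      qed
      moreover have "c = nat_mem M' aOrd (i * n + j)" using x ij by simp
      ultimately show "c \<in> nat_mem M' aOrd ` {..<N}" by blast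
    qed
    moreover have "\<forall>c\<in>code n ` positions n. real_mem M' 1 c = key c"
    proof
      fix c assume "c \<in> code n ` positions n"
      then obtain i j where "i < n" "j < n" "c = code n (i, j)" by (auto simp: positions_def)
      then show "real_mem M' 1 c = key c" using x D key_code by simp
    qed
    moreover have "R M'" unfolding R_def N_def using x calculation(2) by (intro conjI) (elim conjE; assumption)+
    ultimately show "R M' \<and> nat_mem M' aOrd ` {..<N} = code n ` positions n" by blast
  qed
  have A2: "runs_in (A @ B) sort_com M1 ((190 * N + 50) * (b + 1) + 12) ?S"
    if R1: "R M1 \<and> nat_mem M1 aOrd ` {..<N} = code n ` positions n" for M1
  proof (rule runs_in_mono[OF run_sort])
    have R: "R M1" "nat_mem M1 aOrd ` {..<N} = code n ` positions n" using R1 by blast+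
    show N1: "nat_mem M1 aN 0 = N" using R(1) by (simp add: R_def)
    have k1: "\<forall>c\<in>code n ` positions n. real_mem M1 1 c = key c" using R(1) by (simp add: R_def)
    fix M' assume x: "mset (map (nat_mem M' aOrd) [0..<N]) = mset (map (nat_mem M1 aOrd) [0..<N]) \<and>
      sorted (map (\<lambda>x. real_mem M1 1 (nat_mem M' aOrd x)) [0..<N]) \<and> frame ({5, 7} \<union> {40..46}) M1 M'"
    then have "set (map (nat_mem M' aOrd) [0..<N]) = set (map (nat_mem M1 aOrd) [0..<N])"
      using mset_eq_setD by blast
    then have im: "nat_mem M' aOrd ` {..<N} = code n ` positions n"
      using R(2) by (simp add: atLeast0LessThan)
    \<comment> \<open>The table has as many entries as there are positions and hits all their codes,
      hence it is injective.\<close>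
    have "card (nat_mem M' aOrd ` {..<N}) = card (positions n)"
      unfolding im by (rule card_image[OF inj_on_code])
    then have inj: "inj_on (nat_mem M' aOrd) {..<N}"
      by (intro eq_card_imp_inj_on) (simp_all add: positions_def N_def)
    have se: "frame ({5, 7} \<union> {40..46}) M1 M'" using x by blast
    have m: "nat_mem M' k = nat_mem M1 k" if "k \<in> {1, 2, 3, 4, 6} \<union> {8..27}" for k
      by (rule frameD(1)[OF se]) (use that in auto)
    have "\<forall>k\<in>{8..27}. nat_mem M' k = (\<lambda>_. 0)" using R(1) m by (simp add: R_def)
    then have R': "R M'"
      using R(1) m[of 1] m[of 2] m[of 3] m[of 4] m[of 6] frameD(2)[OF se] by (simp add: R_def)
    have "key (nat_mem M' aOrd i) \<le> key (nat_mem M' aOrd j)" if "i \<le> j" "j < N" for i j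
    proof -
      have "real_mem M1 1 (nat_mem M' aOrd i) \<le> real_mem M1 1 (nat_mem M' aOrd j)"
        using sorted_nth_mono[of "map (\<lambda>x. real_mem M1 1 (nat_mem M' aOrd x)) [0..<N]" i j] x that by simp
      moreover have "nat_mem M' aOrd i \<in> code n ` positions n" "nat_mem M' aOrd j \<in> code n ` positions n"
        using that unfolding im[symmetric] by auto
      ultimately show ?thesis using k1[rule_format] by metis
    qed
    then show "?S M'"
      using R' inj im by blast
  qed (simp add: b_def)
  have A3: "runs_in (A @ B) (search_com rec) M2 ((220 * b + 1100) * (8 * b * N + 8 * N + 5)) (\<lambda>M'. result M' = m)"
    if R2: "?S M2" for M2
  proof -
    let ?ord = "nat_mem M2 aOrd"
    have R: "R M2" "inj_on ?ord {..<N}" "?ord ` {..<N} = code n ` positions n"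
      "\<And>i j. i \<le> j \<Longrightarrow> j < N \<Longrightarrow> key (?ord i) \<le> key (?ord j)" using R2 by blast+
    interpret window_search "A @ B" "n + 1" "code n (n - 1, n - 1)" N ?ord key g rec
    proof
      show "0 < n + 1" by simp
      show "inj_on ?ord {..<N}" by (rule R(2))
      \<comment> \<open>The row offset \<open>i + 1\<close> in \<open>code\<close> keeps 0 free as
        the mark of inactive vertices.\<close>
      show "?ord i \<noteq> 0" if "i < N" for i
      proof -
        have "?ord i \<in> code n ` positions n" using that unfolding R(3)[symmetric] by simp
        then show ?thesis by (auto simp: code_def)
      qed
      show "runs_in (A @ B) rec M 100 (\<lambda>M'. result M' = min (result M) (g (key (?ord l)) (key (?ord r))) \<and>
        (\<forall>k. k \<noteq> 1 \<longrightarrow> nat_mem M' k = nat_mem M k) \<and> real_mem M' 1 = real_mem M 1)"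
        if "prepared (n + 1) (code n (n - 1, n - 1)) N ?ord key M" "nat_mem M aMid 0 = l"
          "nat_mem M aR 0 = Suc r" "l < N" "r < N" for M l r
        by (rule rec[OF that]) (simp add: key_def)
    qed
    obtain s0 t0 where st: "feasible_weak_range A B s0 t0" "m = g s0 t0" using attained by blast
    have "(INF l\<in>{..<N}. candidate l) = m"
      by (rule INF_candidate[OF n(1,2) refl refl R(3) key_code R(4) g st least])
    moreover have "ready M2"
    proof -
      have "real_mem M2 1 (?ord i) = key (?ord i)" if "i < N" for i
      proof -
        have "?ord i \<in> code n ` positions n" using that unfolding R(3)[symmetric] by simp
        then show ?thesis using R(1) unfolding R_def by blast
      qed
      then show ?thesis using R(1) by (simp add: prepared_def R_def)
    qed
    moreover have st: "stack M2 = []" using R(1) by (simp add: stack_def R_def)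
    moreover have "dsu (n + 1) M2" using R(1) st history_Nil[of "n + 1"] by (simp add: dsu_def R_def)
    moreover have "result M2 = \<infinity>" using R(1) by (simp add: result_def R_def)
    ultimately show ?thesis using run_search[of M2] by (simp add: unit_def b_def)
  qed
  \<comment> \<open>With \<open>1 \<le> b\<close>, the terms are at most 320, 480, 27720 and 64
    times \<open>N * b * b\<close>, which fits below 30000.\<close>
  have t: "80 * ((n + 1) * (n + 1)) + 50 + (((190 * N + 50) * (b + 1) + 12) +
      ((220 * b + 1100) * (8 * b * N + 8 * N + 5)) + 1) + 1 \<le> 30000 * (n * n) * bits (n * n) ^ 2"
  proof -
    have "n + 1 \<le> 2 * n" using n by simp
    then have "(n + 1) * (n + 1) \<le> (2 * n) * (2 * n)" by (intro mult_le_mono)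
    then have n1: "(n + 1) * (n + 1) \<le> 4 * N" by (simp add: N_def)
    have Nb: "N \<le> N * b" using b1 by simp
    have Nbb: "N * b \<le> N * b * b" using b1 by simp
    have "(190 * N + 50) * (b + 1) \<le> (240 * N) * (2 * b)" using N0 b1 by (intro mult_le_mono) auto
    then have 2: "(190 * N + 50) * (b + 1) \<le> 480 * (N * b)" by simp
    have "8 * b * N = 8 * (N * b)" by simp
    then have "8 * b * N + 8 * N + 5 \<le> 21 * (N * b)" using Nb N0 by linarith
    then have "(220 * b + 1100) * (8 * b * N + 8 * N + 5) \<le> (1320 * b) * (21 * (N * b))"
      using b1 by (intro mult_le_mono) auto
    then have 3: "(220 * b + 1100) * (8 * b * N + 8 * N + 5) \<le> 27720 * (N * b * b)" by (simp add: mult_ac)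
    have "30000 * (n * n) * bits (n * n) ^ 2 = 30000 * (N * b * b)"
      by (simp add: N_def b_def power2_eq_square)
    then show ?thesis using n1 Nb Nbb 2 3 N0 by linarith
  qed
  show ?thesis unfolding program_def
    by (rule runs_in_Seq[OF A1 _ t], rule runs_in_Seq[OF A2 A3 order_refl], assumption, assumption)
qed

lemma computable_in_timeI:
  fixes F :: "'a::euclidean_space list \<Rightarrow> 'a list \<Rightarrow> ereal"
  assumes "\<And>n A B. 0 < n \<Longrightarrow> length A = n \<Longrightarrow> length B = n \<Longrightarrow>
    runs_in (A @ B) c (initial_state n) (T n) (\<lambda>M. result M = F A B)"
  shows "computable_in_time F (\<lambda>n. real (T n))"
  unfolding computable_in_time_def
proof (intro exI[of _ c] allI impI)
  fix n and A B :: "'a list"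
  assume "1 \<le> n" "length A = n \<and> length B = n"
  then have "runs_in (A @ B) c (initial_state n) (T n) (\<lambda>M. result M = F A B)"
    using assms[of n A B] by simp
  then show "\<exists>\<tau> M. exec (A @ B) c (initial_state n) \<tau> M \<and> real \<tau> \<le> real (T n) \<and> result M = F A B"
    unfolding runs_in_def runs_def by auto
qed

text \<open>From \<open>2 ^ bits (n * n) \<le> 2 * (n * n)\<close> and
  \<open>ln 2 \<ge> 1 / 2\<close> the binary length is at most \<open>6 * ln n\<close>, whose square
  gives the 36. The bound starts at 2 because \<open>ln 1 = 0\<close>.\<close>

lemma time_bound_bigo:
  "(\<lambda>n. real (30000 * (n * n) * bits (n * n) ^ 2)) \<in> O(\<lambda>n. real n ^ 2 * ln (real n) ^ 2)"
proof (rule bigoI[of _ "30000 * 36"], rule eventually_sequentiallyI[of 2])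
  fix n :: nat assume n: "2 \<le> n"
  let ?b = "bits (n * n)"
  have ln2: "1 / 2 \<le> ln (2 :: real)" using ln2_ge_two_thirds by simp
  have lnn: "ln 2 \<le> ln (real n)" using n by simp
  have "2 ^ ?b \<le> 2 * (n * n)" using n by (intro power_bits_le) simp
  then have "(2::real) ^ ?b \<le> 2 * (real n * real n)" by (metis of_nat_le_iff of_nat_mult of_nat_numeral of_nat_power)
  then have "ln ((2::real) ^ ?b) \<le> ln (2 * (real n * real n))" using n by (intro ln_mono) simp_all
  then have "real ?b * ln 2 \<le> ln 2 + 2 * ln (real n)" using n by (simp add: ln_realpow ln_mult)
  also have "\<dots> \<le> 3 * ln (real n)" using lnn by simp
  finally have "real ?b * (1 / 2) \<le> 3 * ln (real n)"
    using mult_left_mono[OF ln2, of "real ?b"] by simp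
  then have "real ?b \<le> 6 * ln (real n)" by simp
  then have "real ?b ^ 2 \<le> (6 * ln (real n)) ^ 2" by (intro power_mono) simp_all
  then have "real n ^ 2 * real ?b ^ 2 \<le> real n ^ 2 * (36 * ln (real n) ^ 2)"
    by (intro mult_left_mono) (simp_all add: power_mult_distrib)
  then show "norm (real (30000 * (n * n) * ?b ^ 2)) \<le> 30000 * 36 * norm (real n ^ 2 * ln (real n) ^ 2)"
    by (simp add: power2_eq_square)
qed

theorem theorem2:
  shows "(\<exists>T \<in> O(\<lambda>n. real n ^ 2 * ln (real n) ^ 2).
            computable_in_time
              (\<lambda>A B :: 'a::euclidean_space list. ereal (weak_frechet_gap A B)) T) \<and>
         (\<exists>T \<in> O(\<lambda>n. real n ^ 2 * ln (real n) ^ 2).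
            computable_in_time
              (\<lambda>A B :: 'a::euclidean_space list. weak_frechet_ratio A B) T)"
proof
  let ?T = "\<lambda>n. 30000 * (n * n) * bits (n * n) ^ 2"
  have keys: "real_mem M 1 (nat_mem M aOrd l) = key (ord l) \<and> real_mem M 1 (nat_mem M aOrd r) = key (ord r)"
    if "prepared w t N ord key M" "l < N" "r < N" for w t N ord key M l r
    using that by (simp add: prepared_def)
  have "computable_in_time (\<lambda>A B :: 'a list. ereal (weak_frechet_gap A B)) (\<lambda>n. real (?T n))"
  proof (rule computable_in_timeI)
    fix n and A B :: "'a list"
    assume n: "0 < n" "length A = n" "length B = n"
    then have AB: "A \<noteq> []" "length B = length A" by auto
    \<comment> \<open>A gap is always finite, so the guard is a test that always succeeds.\<close>
    show "runs_in (A @ B) (program (record_com (NLess (NConst 0) (NConst 1)) (RSub high_exp low_exp)))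
      (initial_state n) (?T n) (\<lambda>M. result M = ereal (weak_frechet_gap A B))"
    proof (rule run_program[OF n, where g = "\<lambda>s t. ereal (t - s)"])
      fix M ord key l r N
      assume p: "prepared (n + 1) (code n (n - 1, n - 1)) N ord key M" "nat_mem M aMid 0 = l"
        "nat_mem M aR 0 = Suc r" "l < N" "r < N"
      show "runs_in (A @ B) (record_com (NLess (NConst 0) (NConst 1)) (RSub high_exp low_exp)) M 100
        (\<lambda>M'. result M' = min (result M) (ereal (key (ord r) - key (ord l))) \<and>
        (\<forall>k. k \<noteq> 1 \<longrightarrow> nat_mem M' k = nat_mem M k) \<and> real_mem M' 1 = real_mem M 1)"
        using keys[OF p(1,4,5)] p(2,3)
        by (intro run_record_com) (simp_all add: high_exp_def low_exp_def)
    next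
      show "\<exists>s t. feasible_weak_range A B s t \<and> ereal (weak_frechet_gap A B) = ereal (t - s)"
        using weak_frechet_gap_attained(1)[OF AB] by auto
      show "ereal (weak_frechet_gap A B) \<le> ereal (t - s)" if "feasible_weak_range A B s t" for s t
        using weak_frechet_gap_attained(2)[OF AB that] by simp
    qed simp
  qed
  then show "\<exists>T \<in> O(\<lambda>n. real n ^ 2 * ln (real n) ^ 2).
      computable_in_time (\<lambda>A B :: 'a list. ereal (weak_frechet_gap A B)) T"
    using time_bound_bigo by blast
  have "computable_in_time (\<lambda>A B :: 'a list. weak_frechet_ratio A B) (\<lambda>n. real (?T n))"
  proof (rule computable_in_timeI)
    fix n and A B :: "'a list"
    assume n: "0 < n" "length A = n" "length B = n"
    then have AB: "A \<noteq> []" "length B = length A" by auto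
    \<comment> \<open>A range starting at 0 has ratio \<open>\<infinity>\<close> and must not be
      recorded: dividing by 0 yields 0 and would spoil the minimum.\<close>
    show "runs_in (A @ B) (program (record_com (RLess (RConst 0) low_exp) (RDiv high_exp low_exp)))
      (initial_state n) (?T n) (\<lambda>M. result M = weak_frechet_ratio A B)"
    proof (rule run_program[OF n, where g = range_ratio])
      fix M ord l r N and key :: "nat \<Rightarrow> real"
      assume p: "prepared (n + 1) (code n (n - 1, n - 1)) N ord key M" "nat_mem M aMid 0 = l"
        "nat_mem M aR 0 = Suc r" "l < N" "r < N" and pos: "\<And>x. 0 \<le> key x"
      have "0 < key (ord l) \<longleftrightarrow> key (ord l) \<noteq> 0" using pos[of "ord l"] by linarith
      then show "runs_in (A @ B) (record_com (RLess (RConst 0) low_exp) (RDiv high_exp low_exp)) M 100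
        (\<lambda>M'. result M' = min (result M) (range_ratio (key (ord l)) (key (ord r))) \<and>
        (\<forall>k. k \<noteq> 1 \<longrightarrow> nat_mem M' k = nat_mem M k) \<and> real_mem M' 1 = real_mem M 1)"
        using keys[OF p(1,4,5)] p(2,3)
        by (intro run_record_com) (simp_all add: high_exp_def low_exp_def range_ratio_def)
    next
      show "range_ratio s' t' \<le> range_ratio s t" if "0 \<le> s" "s \<le> s'" "s' \<le> t'" "t' \<le> t" for s t s' t'
        using that by (auto simp: range_ratio_def intro!: frac_le)
      show "\<exists>s t. feasible_weak_range A B s t \<and> weak_frechet_ratio A B = range_ratio s t"
        by (rule weak_frechet_ratio_attained(1)[OF AB])
      show "weak_frechet_ratio A B \<le> range_ratio s t" if "feasible_weak_range A B s t" for s t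
        by (rule weak_frechet_ratio_attained(2)[OF AB that])
    qed
  qed
  then show "\<exists>T \<in> O(\<lambda>n. real n ^ 2 * ln (real n) ^ 2).
      computable_in_time (\<lambda>A B :: 'a list. weak_frechet_ratio A B) T"
    using time_bound_bigo by blast
qed

end
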